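(* Let $T_{a,b,c}$ be a minuscule Dynkin diagram, i.e. $(a,b,c)$ is one of: $(s+1,1,n+1)$ with $n\ge 2$ and $1\le s\le n$ (type $A_{r+s-1}$, $r=n+2$); $(2,2,n)$ with $n\ge 3$ (type $D_r$, $r=n+2$); $(2,3,3)$ (type $E_6$); $(2,4,3)$ (type $E_7$). Let $G_{a,b,c}=(V,M_{a,b,c})$ be the multigraph of $(-1)$-divisors of $X_{a,b,c}$. (1) $G_{a,b,c}$ is a strongly regular multigraph. Its spectrum (the spectrum of $M_{a,b,c}$) has three values $1+\lambda<1<1+\eta$, where: - for $G_{s+1,1,n+1}$: $\lambda=-\binom{r+s-2}{r-2}$ and $\eta=s^2\binom{r+s-2}{r-3}-s\binom{r+s-2}{r-2}+\binom{r+s-2}{r-1}$; - for $G_{2,2,n}$: $\lambda=-2^{r-3}$ and $\eta=(r-4)2^{r-3}$; - for $G_{2,3,3}$: $\lambda=-6$ and $\eta=9$; - for $G_{2,4,3}$: $\lambda=-12$ and $\eta=28$. (2) The normalized orthogonal projection $f:V(G_{a,b,c})\to K^\perp\otimes\mathbb{R}$ is optimal for the Goemans-Williamson semidefinite (geometric) relaxation of the maximum cut problem on $G_{a,b,c}$, i.e. $SD(f)=SD(G_{a,b,c})$. (3) Let $m(a,b,c)$ be the maximum cut of $G_{a,b,c}$. Then $\lceil \ell(a,b,c)\rceil\le m(a,b,c)\le\lfloor u(a,b,c)\rfloor$, where: - for $G_{s+1,1,n+1}$: $$\ell=\frac{1}{2\pi}\binom{r+s}{r-1}\sum_{k=0}^{s}\binom{s+1}{k+1}\binom{r-1}{k+1}\,k\,\arccos\left(1-\frac{(r+s)(k+1)}{(s+1)(r-1)}\right),$$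 $$u=\frac{r+s}{2(s+1)(r-1)}\binom{r+s}{r-1}\binom{s+1}{2}\binom{r+s-2}{r-3};$$ - for $G_{2,2,n}$: $$\ell=\frac{2^{r-2}}{\pi}\sum_{k=0}^{\lfloor r/2\rfloor-1}\binom{r}{2(k+1)}\,k\,\arccos\left(1-\frac{4(k+1)}{r}\right),\qquad u=(r-3)2^{2r-6};$$ - for $G_{2,3,3}$: $\ell=90$, $u=101.25$; - for $G_{2,4,3}$: $\ell=516$, $u=560$. Moreover, $\lim_{|V|\to\infty}\frac{m(a,b,c)}{u(a,b,c)}=1$, so the percentage error of approximating the maximum cut by its upper bound is asymptotically zero on the infinite families. (4) The upper bound agrees with the maximum cut $m(a,b,c)$ for $G_{2,2,n}$ with $n\le 8$ and for $G_{s+1,1,n+1}$ with $r-s=2$, $r\le 7$.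
   Context: A multigraph $G=(V,M)$ is a finite set $V$ with a symmetric function $M:V\times V\to\mathbb{R}_{\ge 0}$ vanishing on the diagonal, viewed as a symmetric matrix. The weight of a cut $\{S,S^c\}$ is $\sum_{i\in S,\,j\in S^c}M_{ij}$, and the maximum cut is the largest weight of a cut. $G$ is a strongly regular multigraph if there are real $\alpha,\beta,\gamma,d$ with $(M^2)_{ij}=\alpha M_{ij}+\beta$ for all $i\ne j$, $(M^2)_{ii}=\gamma$ for all $i$, and $MJ=dJ$ ($J$ the all-ones matrix). For an assignment $f$ of $V$ to unit vectors in a Euclidean space, $SD(f):=\sum_{i<j}M_{ij}\frac{1-\langle f(i),f(j)\rangle}{2}$, and $SD(G):=\max_f SD(f)=\max\{\sum_{i<j}M_{ij}\frac{1-X_{ij}}{2}: X\succeq 0,\ X_{ii}=1\}$. Geometry. Let $a,b,c$ be positive integers with $a,c\ge2$, $a\le c$, and $c>2$ if $a=2$; put $r:=b+c$. $T_{a,b,c}$ is the T-shaped tree whose three arms have $a,b,c$ vertices, the central vertex being counted in each ($a+b+c-2$ vertices in total). It is assumed to be the Dynkin diagram of a finite root system, i.e. $\frac1a+\frac1b+\frac1c>1$. $X_{a,b,c}$ is the blow-up of $(\mathbb{P}^{c-1})^{a-1}$ at $b+c$ general points. $\mathrm{Pic}(X_{a,b,c})$ is the free $\mathbb{Z}$-module with basis $H_1,\dots,H_{a-1},E_1,\dots,E_r$ and symmetric bilinear form $E_i\cdot E_j=-\delta_{ij}$, $H_i\cdot H_j=c-1-\delta_{ij}$, $H_i\cdot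 E_j=0$. The canonical class is $K=-c\sum_i H_i+(ac-a-c)\sum_j E_j$. The classes $\alpha_i=E_i-E_{i+1}$ ($1\le i\le r-1$), $\alpha_r=H_1-E_1-\dots-E_c$, $\alpha_{r+i}=H_{i+1}-H_i$ ($1\le i\le a-2$) are simple roots in $K^\perp$ of a root system with Dynkin diagram $T_{a,b,c}$. The Weyl group $W$ is generated by the reflections $D\mapsto D+(D\cdot\alpha_i)\alpha_i$. The $(-1)$-divisors are the elements of the $W$-orbit of $E_r$. $G_{a,b,c}$ has the $(-1)$-divisors as vertices, with $M_{a,b,c}(U,V)=U\cdot V$ for $U\neq V$. The form is negative definite on $K^\perp$; its negative $\langle\cdot,\cdot\rangle$ makes $K^\perp\otimes\mathbb{R}$ a Euclidean space. With $\delta:=bc+ac+ab-abc$, the normalized orthogonal projection is $f(V)=\left(1+\frac{ac-a-c}{\delta}\right)^{-1/2}\left(V+\frac1\delta K\right)$, which has unit length.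
   Formalization: For G_{s+1,1,n+1} the printed η is false (n=2, s=1 is the Petersen graph with η=2; the printed formula gives 1); it is replaced by η = s·C(r+s-2,r-3) + (s-1)·C(r+s-2,r-2) − C(r+s-2,r-1). *)

theory Defs
  imports "HOL-Analysis.Analysis" "HOL-Library.Function_Algebras"
begin

section \<open>Multigraphs, cuts and the semidefinite relaxation\<close>

text \<open>
  A multigraph is a vertex set \<open>V\<close> together with a weight function \<open>M\<close>, of which only the
  values on \<open>V \<times> V\<close> matter.
\<close>

definition multigraph :: "'v set \<Rightarrow> ('v \<Rightarrow> 'v \<Rightarrow> real) \<Rightarrow> bool" where
  "multigraph V M \<longleftrightarrow> finite V \<and>
     (\<forall>i\<in>V. \<forall>j\<in>V. M i j = M j i \<and> 0 \<le> M i j) \<and> (\<forall>i\<in>V. M i i = 0)"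

definition strongly_regular_multigraph :: "'v set \<Rightarrow> ('v \<Rightarrow> 'v \<Rightarrow> real) \<Rightarrow> bool" where
  "strongly_regular_multigraph V M \<longleftrightarrow> multigraph V M \<and>
     (\<exists>\<alpha> \<beta> \<gamma> d.
        (\<forall>i\<in>V. \<forall>j\<in>V. i \<noteq> j \<longrightarrow> (\<Sum>k\<in>V. M i k * M k j) = \<alpha> * M i j + \<beta>) \<and>
        (\<forall>i\<in>V. (\<Sum>k\<in>V. M i k * M k i) = \<gamma>) \<and>
        (\<forall>i\<in>V. (\<Sum>k\<in>V. M i k) = d))"

text \<open>The set of eigenvalues of the real symmetric matrix \<open>M\<close>; eigenvectors are functions on \<open>V\<close>.\<close>

definition graph_spectrum :: "'v set \<Rightarrow> ('v \<Rightarrow> 'v \<Rightarrow> real) \<Rightarrow> real set" where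
  "graph_spectrum V M =
     {\<mu>. \<exists>x. (\<exists>i\<in>V. x i \<noteq> 0) \<and> (\<forall>i\<in>V. (\<Sum>j\<in>V. M i j * x j) = \<mu> * x i)}"

definition cut_weight :: "'v set \<Rightarrow> ('v \<Rightarrow> 'v \<Rightarrow> real) \<Rightarrow> 'v set \<Rightarrow> real" where
  "cut_weight V M S = (\<Sum>i\<in>S. \<Sum>j\<in>V - S. M i j)"

definition max_cut :: "'v set \<Rightarrow> ('v \<Rightarrow> 'v \<Rightarrow> real) \<Rightarrow> real" where
  "max_cut V M = Max (cut_weight V M ` Pow V)"

text \<open>Positive semidefinite matrices on \<open>V\<close> with unit diagonal.\<close>

definition elliptope :: "'v set \<Rightarrow> ('v \<Rightarrow> 'v \<Rightarrow> real) set" where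
  "elliptope V = {X. (\<forall>i\<in>V. \<forall>j\<in>V. X i j = X j i) \<and> (\<forall>i\<in>V. X i i = 1) \<and>
     (\<forall>x. 0 \<le> (\<Sum>i\<in>V. \<Sum>j\<in>V. x i * X i j * x j))}"

text \<open>
  The sum over unordered pairs \<open>i < j\<close> is written as half of the sum over all ordered pairs; the
  diagonal contributes nothing because \<open>M\<close> vanishes there. The argument \<open>X\<close> is the Gram matrix
  of an assignment of unit vectors to the vertices.
\<close>

definition SD_value :: "'v set \<Rightarrow> ('v \<Rightarrow> 'v \<Rightarrow> real) \<Rightarrow> ('v \<Rightarrow> 'v \<Rightarrow> real) \<Rightarrow> real" where
  "SD_value V M X = (1/2) * (\<Sum>i\<in>V. \<Sum>j\<in>V. M i j * ((1 - X i j) / 2))"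

definition SD_opt :: "'v set \<Rightarrow> ('v \<Rightarrow> 'v \<Rightarrow> real) \<Rightarrow> real" where
  "SD_opt V M = (SUP X\<in>elliptope V. SD_value V M X)"

text \<open>
  The supremum is taken over a nonempty set bounded above, so it is never a junk value, and
  \<open>SD_value V M X = SD_opt V M\<close> for a feasible \<open>X\<close> says that the maximum is attained at \<open>X\<close>.
\<close>

lemma elliptope_entry_ge:
  assumes "finite V" "X \<in> elliptope V" "p \<in> V" "q \<in> V"
  shows "- 1 \<le> X p q"
proof (cases "p = q")
  case True
  then show ?thesis using assms by (auto simp: elliptope_def)
next
  case False
  define x :: "'a \<Rightarrow> real" where "x = (\<lambda>i. if i = p \<or> i = q then 1 else 0)"
  have sup: "(\<Sum>i\<in>V. h i) = h p + h q" if "\<And>i. i \<noteq> p \<Longrightarrow> i \<noteq> q \<Longrightarrow> h i = 0" for h :: "'a \<Rightarrow> real"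
  proof -
    have "(\<Sum>i\<in>V. h i) = (\<Sum>i\<in>{p, q}. h i)"
      using assms that by (intro sum.mono_neutral_right) auto
    then show ?thesis using False by simp
  qed
  have row: "(\<Sum>j\<in>V. x i * X i j * x j) = x i * X i p + x i * X i q" for i
    by (subst sup) (auto simp: x_def)
  have "(\<Sum>i\<in>V. \<Sum>j\<in>V. x i * X i j * x j) = X p p + X p q + (X q p + X q q)"
    unfolding row by (subst sup) (auto simp: x_def)
  moreover have "0 \<le> (\<Sum>i\<in>V. \<Sum>j\<in>V. x i * X i j * x j)" "X p p = 1" "X q q = 1" "X q p = X p q"
    using assms by (auto simp: elliptope_def)
  ultimately show ?thesis by linarith
qed

lemma elliptope_nonempty: "elliptope V \<noteq> {}"
proof -
  have "(\<lambda>i j. 1) \<in> elliptope V"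
  proof -
    have "(\<Sum>i\<in>V. \<Sum>j\<in>V. x i * 1 * x j) = (\<Sum>i\<in>V. x i) ^ 2" for x :: "'a \<Rightarrow> real"
      by (simp add: power2_eq_square sum_product)
    then show ?thesis by (simp add: elliptope_def)
  qed
  then show ?thesis by blast
qed

lemma SD_value_bdd_above:
  assumes "multigraph V M"
  shows "bdd_above (SD_value V M ` elliptope V)"
proof (rule bdd_aboveI2)
  fix X assume X: "X \<in> elliptope V"
  have "M i j * ((1 - X i j) / 2) \<le> M i j * 1" if "i \<in> V" "j \<in> V" for i j
    using elliptope_entry_ge[OF _ X that] assms that
    by (intro mult_left_mono) (auto simp: multigraph_def)
  then show "SD_value V M X \<le> (1/2) * (\<Sum>i\<in>V. \<Sum>j\<in>V. M i j)"
    unfolding SD_value_def by (intro mult_left_mono sum_mono) auto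
qed


section \<open>The Picard lattice and the $(-1)$-divisors\<close>

text \<open>
  \<open>Hyp i\<close> and \<open>Exc j\<close> index the basis \<open>H\<^sub>i\<close> (\<open>1 \<le> i \<le> a - 1\<close>), \<open>E\<^sub>j\<close> (\<open>1 \<le> j \<le> b + c\<close>) of the
  Picard group. A class is its coefficient function: integer valued for the Picard group itself,
  real valued after extension of scalars. Coefficients at indices outside these ranges are zero for
  all classes constructed below. Addition is pointwise.
\<close>

datatype pic_basis = Hyp nat | Exc nat

definition hyp_class :: "nat \<Rightarrow> pic_basis \<Rightarrow> int" where
  "hyp_class i = (\<lambda>x. if x = Hyp i then 1 else 0)"

definition exc_class :: "nat \<Rightarrow> pic_basis \<Rightarrow> int" where
  "exc_class j = (\<lambda>x. if x = Exc j then 1 else 0)"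

definition pic_form ::
    "nat \<Rightarrow> nat \<Rightarrow> nat \<Rightarrow> (pic_basis \<Rightarrow> 'r) \<Rightarrow> (pic_basis \<Rightarrow> 'r) \<Rightarrow> 'r::comm_ring_1" where
  "pic_form a b c D D' =
     (\<Sum>i = 1..a - 1. \<Sum>j = 1..a - 1.
        (of_nat c - 1 - (if i = j then 1 else 0)) * D (Hyp i) * D' (Hyp j))
     - (\<Sum>j = 1..b + c. D (Exc j) * D' (Exc j))"

definition canonical_class :: "nat \<Rightarrow> nat \<Rightarrow> nat \<Rightarrow> pic_basis \<Rightarrow> int" where
  "canonical_class a b c =
     (\<lambda>x. - int c * (\<Sum>i = 1..a - 1. hyp_class i x)
          + (int a * int c - int a - int c) * (\<Sum>j = 1..b + c. exc_class j x))"

definition simple_roots :: "nat \<Rightarrow> nat \<Rightarrow> nat \<Rightarrow> (pic_basis \<Rightarrow> int) set" where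
  "simple_roots a b c =
     {exc_class i - exc_class (i + 1) | i. 1 \<le> i \<and> i \<le> b + c - 1}
     \<union> {hyp_class 1 - (\<Sum>j = 1..c. exc_class j)}
     \<union> {hyp_class (i + 1) - hyp_class i | i. 1 \<le> i \<and> i \<le> a - 2}"

definition reflection ::
    "nat \<Rightarrow> nat \<Rightarrow> nat \<Rightarrow> (pic_basis \<Rightarrow> int) \<Rightarrow> (pic_basis \<Rightarrow> int) \<Rightarrow> (pic_basis \<Rightarrow> int)" where
  "reflection a b c \<alpha> D = (\<lambda>x. D x + pic_form a b c D \<alpha> * \<alpha> x)"

text \<open>
  Simple roots have self-intersection \<open>-2\<close>, so the generating reflections are involutions and
  products of them already form a group.
\<close>

inductive_set weyl_group :: "nat \<Rightarrow> nat \<Rightarrow> nat \<Rightarrow> ((pic_basis \<Rightarrow> int) \<Rightarrow> (pic_basis \<Rightarrow> int)) set"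
  for a b c :: nat where
  id: "id \<in> weyl_group a b c"
| refl: "\<lbrakk>\<alpha> \<in> simple_roots a b c; w \<in> weyl_group a b c\<rbrakk>
           \<Longrightarrow> reflection a b c \<alpha> \<circ> w \<in> weyl_group a b c"

definition minus_one_divisors :: "nat \<Rightarrow> nat \<Rightarrow> nat \<Rightarrow> (pic_basis \<Rightarrow> int) set" where
  "minus_one_divisors a b c = (\<lambda>w. w (exc_class (b + c))) ` weyl_group a b c"

definition divisor_mult ::
    "nat \<Rightarrow> nat \<Rightarrow> nat \<Rightarrow> (pic_basis \<Rightarrow> int) \<Rightarrow> (pic_basis \<Rightarrow> int) \<Rightarrow> real" where
  "divisor_mult a b c U V = (if U = V then 0 else real_of_int (pic_form a b c U V))"

abbreviation m_cut :: "nat \<Rightarrow> nat \<Rightarrow> nat \<Rightarrow> real" where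
  "m_cut a b c \<equiv> max_cut (minus_one_divisors a b c) (divisor_mult a b c)"

definition proj_delta :: "nat \<Rightarrow> nat \<Rightarrow> nat \<Rightarrow> real" where
  "proj_delta a b c =
     real b * real c + real a * real c + real a * real b - real a * real b * real c"

definition normalized_projection ::
    "nat \<Rightarrow> nat \<Rightarrow> nat \<Rightarrow> (pic_basis \<Rightarrow> int) \<Rightarrow> (pic_basis \<Rightarrow> real)" where
  "normalized_projection a b c V =
     (\<lambda>x. (1 + (real a * real c - real a - real c) / proj_delta a b c) powr (- 1 / 2)
          * (real_of_int (V x) + (1 / proj_delta a b c) * real_of_int (canonical_class a b c x)))"

text \<open>Gram matrix of the normalized projection for the Euclidean structure \<open>\<langle>x, y\<rangle> = - x \<cdot> y\<close>.\<close>

definition projection_gram ::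
    "nat \<Rightarrow> nat \<Rightarrow> nat \<Rightarrow> (pic_basis \<Rightarrow> int) \<Rightarrow> (pic_basis \<Rightarrow> int) \<Rightarrow> real" where
  "projection_gram a b c U V =
     - pic_form a b c (normalized_projection a b c U) (normalized_projection a b c V)"


section \<open>The minuscule diagrams and the numerical data\<close>

definition type_A_params :: "(nat \<times> nat) set" where
  "type_A_params = {(n, s). 2 \<le> n \<and> 1 \<le> s \<and> s \<le> n}"

definition minuscule :: "nat \<Rightarrow> nat \<Rightarrow> nat \<Rightarrow> bool" where
  "minuscule a b c \<longleftrightarrow>
     (\<exists>(n, s)\<in>type_A_params. (a, b, c) = (s + 1, 1, n + 1)) \<or>
     (\<exists>n\<ge>3. (a, b, c) = (2, 2, n)) \<or>
     (a, b, c) = (2, 3, 3) \<or> (a, b, c) = (2, 4, 3)"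

definition has_spectrum_values :: "nat \<Rightarrow> nat \<Rightarrow> nat \<Rightarrow> real \<Rightarrow> real \<Rightarrow> bool" where
  "has_spectrum_values a b c lam eta \<longleftrightarrow>
     graph_spectrum (minus_one_divisors a b c) (divisor_mult a b c) = {1 + lam, 1, 1 + eta} \<and>
     1 + lam < 1 \<and> 1 < 1 + eta"

definition lambda_A :: "nat \<Rightarrow> nat \<Rightarrow> real" where
  "lambda_A r s = - real (r + s - 2 choose (r - 2))"

text \<open>
  The coefficients of the three binomials are \<open>s\<close>, \<open>s - 1\<close>, \<open>-1\<close>, whereas the source prints
  \<open>s\<^sup>2\<close>, \<open>-s\<close>, \<open>1\<close>. The printed expression cannot be meant: \<open>1 + \<eta>\<close> is the common row sum
  of the matrix, and for \<open>r = 4\<close>, \<open>s = 1\<close> the graph is the cubic Petersen graph, so \<open>\<eta> = 2\<close>,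
  while the printed expression gives \<open>1\<close>. The value below also satisfies the relation
  \<open>u = |V| (\<eta> - \<lambda>) / 4\<close> with the stated upper bound \<open>u\<close>; the printed one does not.
\<close>

definition eta_A :: "nat \<Rightarrow> nat \<Rightarrow> real" where
  "eta_A r s = real s * real (r + s - 2 choose (r - 3))
     + (real s - 1) * real (r + s - 2 choose (r - 2))
     - real (r + s - 2 choose (r - 1))"

definition lower_A :: "nat \<Rightarrow> nat \<Rightarrow> real" where
  "lower_A r s = 1 / (2 * pi) * real (r + s choose (r - 1)) *
     (\<Sum>k = 0..s. real (s + 1 choose (k + 1)) * real (r - 1 choose (k + 1)) * real k *
        arccos (1 - real (r + s) * real (k + 1) / (real (s + 1) * real (r - 1))))"

definition upper_A :: "nat \<Rightarrow> nat \<Rightarrow> real" where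
  "upper_A r s = real (r + s) / (2 * real (s + 1) * real (r - 1)) *
     real (r + s choose (r - 1)) * real (s + 1 choose 2) * real (r + s - 2 choose (r - 3))"

definition lower_D :: "nat \<Rightarrow> real" where
  "lower_D r = 2 ^ (r - 2) / pi *
     (\<Sum>k = 0..r div 2 - 1. real (r choose (2 * (k + 1))) * real k *
        arccos (1 - 4 * real (k + 1) / real r))"

definition upper_D :: "nat \<Rightarrow> real" where
  "upper_D r = (real r - 3) * 2 ^ (2 * r - 6)"

definition cut_between :: "nat \<Rightarrow> nat \<Rightarrow> nat \<Rightarrow> real \<Rightarrow> real \<Rightarrow> bool" where
  "cut_between a b c l u \<longleftrightarrow>
     real_of_int \<lceil>l\<rceil> \<le> m_cut a b c \<and> m_cut a b c \<le> real_of_int \<lfloor>u\<rfloor>"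

end

theory Submission
  imports Defs "HOL-Probability.Probability"
begin

text \<open>
  Let \<open>Q\<close> be the Gram matrix \<open>Q U V = U \<cdot> V\<close> of the (-1)-divisors, diagonal included. As every
  (-1)-divisor has self-intersection -1, the adjacency matrix is \<open>M = I + Q\<close>. In each of the four
  cases there are numbers with \<open>Q J = \<eta> J\<close> and \<open>Q\<^sup>2 = \<lambda> Q + \<beta> J\<close>: the projections of the divisors to
  \<open>K\<^sup>\<bottom>\<close> form a tight frame. Thus \<open>Q\<close> acts as \<open>\<eta>\<close> on constants and as \<open>\<lambda>\<close> or \<open>0\<close> on their complement,
  which gives strong regularity and the spectrum (locale \<open>two_eigenvalue_form\<close>).
  
  The Gram matrix \<open>G\<close> of the normalized projection is an affine function of \<open>Q\<close>, and it is a
  multiple of the projector onto the \<open>\<lambda>\<close>-eigenspace. For any \<open>X\<close> in the elliptope the value of the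
  relaxation is \<open>(|V| \<eta> - \<langle>Q, X\<rangle>) / 4\<close>. Since \<open>Q - \<lambda> I\<close> is positive semidefinite,
  \<open>\<langle>Q, X\<rangle> \<ge> \<lambda> |V|\<close>, with equality at \<open>X = G\<close>. This proves that the projection is optimal and bounds
  every cut by \<open>u = |V| (\<eta> - \<lambda>) / 4\<close>.
  
  The lower bound is random hyperplane rounding (\<open>hyperplane_rounding\<close>): a Gaussian hyperplane
  separates two unit vectors with probability equal to their angle divided by \<open>\<pi>\<close>. Cuts have integral
  weight, so the bounds may be rounded. Applied to orthonormal vectors the same lemma shows that half of
  the total weight can be cut. In type A this is enough for the limit, because
  \<open>- \<lambda> / (\<eta> - \<lambda>)\<close> is at most \<open>6 / (r + s)\<close>. In type D, and in type A with \<open>r = s + 2\<close>, a coordinate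
  of the weights takes two opposite values and gives a \<open>\<lambda>\<close>-eigenvector with entries \<open>\<plusminus>1\<close>, so that
  the maximum cut is exactly \<open>u\<close>.
  
  It remains to describe the orbits. In type A the divisors are the \<open>(s + 1)\<close>-subsets of \<open>r + s\<close>
  points, with simple reflections acting as adjacent transpositions and \<open>U \<cdot> U' = s - |U \<inter> U'|\<close>. In
  type D they are the subsets of odd size of \<open>r\<close> points, and \<open>S \<cdot> T\<close> is half the Hamming distance minus
  one. In these two types the identity for \<open>Q\<^sup>2\<close> is double counting. For \<open>E\<^sub>6\<close> and \<open>E\<^sub>7\<close> the orbits are
  lists of 27 and 56 vectors; since the Weyl group acts transitively, the identity for \<open>Q\<^sup>2\<close> follows from
  one vector identity, the value of \<open>\<Sum>\<^sub>W (E\<^sub>r \<cdot> W) W\<close>.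
\<close>

section \<open>Rotation invariance of the Gaussian plane\<close>

text \<open>
  For \<open>c \<noteq> 0\<close> a rotation is an affine substitution in \<open>x\<close> for fixed \<open>y\<close> followed by one in \<open>y\<close> for
  fixed \<open>x\<close>. Their Jacobians \<open>|c|\<close> and \<open>1 / |c|\<close> cancel; Fubini passes from one to the other. For
  \<open>c = 0\<close> the rotation exchanges the coordinates up to sign.
\<close>

lemma lborel_rotation_invariant:
  fixes k :: "real \<times> real \<Rightarrow> ennreal"
  assumes [measurable]: "k \<in> borel_measurable (borel \<Otimes>\<^sub>M borel)" and cs: "c\<^sup>2 + s\<^sup>2 = (1::real)"
  shows "(\<integral>\<^sup>+x. \<integral>\<^sup>+y. k (c * x - s * y, s * x + c * y) \<partial>lborel \<partial>lborel)
       = (\<integral>\<^sup>+x. \<integral>\<^sup>+y. k (x, y) \<partial>lborel \<partial>lborel)"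
proof (cases "c = 0")
  case True
  then have s: "s \<noteq> 0" "\<bar>s\<bar> = 1" using cs by (auto simp: power2_eq_1_iff)
  have "(\<integral>\<^sup>+x. \<integral>\<^sup>+y. k (c * x - s * y, s * x + c * y) \<partial>lborel \<partial>lborel)
      = (\<integral>\<^sup>+x. \<integral>\<^sup>+y. k (0 + (- s) * y, s * x) \<partial>lborel \<partial>lborel)"
    using True by simp
  also have "\<dots> = (\<integral>\<^sup>+x. \<integral>\<^sup>+y. k (y, s * x) \<partial>lborel \<partial>lborel)"
  proof (rule nn_integral_cong)
    fix x
    show "(\<integral>\<^sup>+y. k (0 + (- s) * y, s * x) \<partial>lborel) = (\<integral>\<^sup>+y. k (y, s * x) \<partial>lborel)"
      using nn_integral_real_affine[of "\<lambda>y. k (y, s * x)" "- s" 0] s by simp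
  qed
  also have "\<dots> = (\<integral>\<^sup>+y. \<integral>\<^sup>+x. k (y, s * x) \<partial>lborel \<partial>lborel)"
    by (rule lborel_pair.Fubini') measurable
  also have "\<dots> = (\<integral>\<^sup>+y. \<integral>\<^sup>+x. k (y, x) \<partial>lborel \<partial>lborel)"
  proof (rule nn_integral_cong)
    fix y
    show "(\<integral>\<^sup>+x. k (y, s * x) \<partial>lborel) = (\<integral>\<^sup>+x. k (y, x) \<partial>lborel)"
      using nn_integral_real_affine[of "\<lambda>x. k (y, x)" s 0] s by simp
  qed
  finally show ?thesis .
next
  case False
  have sub: "\<bar>c\<bar> * (\<integral>\<^sup>+x. k (c * x - s * y, s * x + c * y) \<partial>lborel)
      = (\<integral>\<^sup>+x. k (x, (s * x + y) / c) \<partial>lborel)" for y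
  proof -
    have "(\<integral>\<^sup>+x. k (x, (s * x + y) / c) \<partial>lborel)
        = \<bar>c\<bar> * (\<integral>\<^sup>+x. k (- s * y + c * x, (s * (- s * y + c * x) + y) / c) \<partial>lborel)"
      using False by (intro nn_integral_real_affine) measurable
    moreover have "(s * (- s * y + c * x) + y) / c = s * x + c * y" for x
    proof -
      have "s * (- s * y + c * x) + y = c * (s * x) + (1 - s\<^sup>2) * y"
        by (simp add: power2_eq_square algebra_simps)
      also have "\<dots> = c * (s * x + c * y)"
        using cs by (simp add: power2_eq_square algebra_simps) (metis distrib_right mult.assoc mult_1)
      finally show ?thesis using False by simp
    qed
    ultimately show ?thesis by simp
  qed
  have "\<bar>c\<bar> * (\<integral>\<^sup>+x. \<integral>\<^sup>+y. k (c * x - s * y, s * x + c * y) \<partial>lborel \<partial>lborel)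
      = \<bar>c\<bar> * (\<integral>\<^sup>+y. \<integral>\<^sup>+x. k (c * x - s * y, s * x + c * y) \<partial>lborel \<partial>lborel)"
    by (subst lborel_pair.Fubini') simp_all
  also have "\<dots> = (\<integral>\<^sup>+y. \<bar>c\<bar> * (\<integral>\<^sup>+x. k (c * x - s * y, s * x + c * y) \<partial>lborel) \<partial>lborel)"
    by (subst nn_integral_cmult) simp_all
  also have "\<dots> = (\<integral>\<^sup>+y. \<integral>\<^sup>+x. k (x, (s * x + y) / c) \<partial>lborel \<partial>lborel)"
    by (simp only: sub)
  also have "\<dots> = (\<integral>\<^sup>+x. \<integral>\<^sup>+y. k (x, (s * x + y) / c) \<partial>lborel \<partial>lborel)"
    by (rule lborel_pair.Fubini') measurable
  also have "\<dots> = (\<integral>\<^sup>+x. \<bar>c\<bar> * (\<integral>\<^sup>+y. k (x, y) \<partial>lborel) \<partial>lborel)"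
  proof (rule nn_integral_cong)
    fix x
    have "(\<integral>\<^sup>+y. k (x, (s * x + y) / c) \<partial>lborel)
        = \<bar>c\<bar> * (\<integral>\<^sup>+y. k (x, (s * x + (- s * x + c * y)) / c) \<partial>lborel)"
      using False by (intro nn_integral_real_affine) measurable
    then show "(\<integral>\<^sup>+y. k (x, (s * x + y) / c) \<partial>lborel) = \<bar>c\<bar> * (\<integral>\<^sup>+y. k (x, y) \<partial>lborel)"
      using False by simp
  qed
  also have "\<dots> = \<bar>c\<bar> * (\<integral>\<^sup>+x. \<integral>\<^sup>+y. k (x, y) \<partial>lborel \<partial>lborel)"
    by (rule nn_integral_cmult) measurable
  finally show ?thesis
    using False by (simp add: ennreal_mult_cancel_left)
qed

abbreviation gauss :: "real measure" where "gauss \<equiv> std_normal_distribution"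

lemma prob_space_gauss: "prob_space gauss"
  by (rule prob_space_normal_density) simp

interpretation gauss: prob_space gauss by (rule prob_space_gauss)
interpretation gauss2: pair_prob_space gauss gauss ..
interpretation gaussP: product_sigma_finite "\<lambda>_. gauss" ..

lemma nn_integral_gauss2:
  assumes [measurable]: "k \<in> borel_measurable (borel \<Otimes>\<^sub>M borel)"
  shows "(\<integral>\<^sup>+x. \<integral>\<^sup>+y. k (x, y) \<partial>gauss \<partial>gauss)
       = (\<integral>\<^sup>+x. \<integral>\<^sup>+y. ennreal (exp (- (x\<^sup>2 + y\<^sup>2) / 2) / (2 * pi)) * k (x, y) \<partial>lborel \<partial>lborel)"
proof -
  have "(\<integral>\<^sup>+x. \<integral>\<^sup>+y. k (x, y) \<partial>gauss \<partial>gauss)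
      = (\<integral>\<^sup>+x. ennreal (std_normal_density x) * (\<integral>\<^sup>+y. ennreal (std_normal_density y) * k (x, y) \<partial>lborel) \<partial>lborel)"
    by (simp add: nn_integral_density)
  also have "\<dots> = (\<integral>\<^sup>+x. \<integral>\<^sup>+y. ennreal (std_normal_density x) * (ennreal (std_normal_density y) * k (x, y)) \<partial>lborel \<partial>lborel)"
    by (intro nn_integral_cong nn_integral_cmult[symmetric]) measurable
  also have "\<dots> = (\<integral>\<^sup>+x. \<integral>\<^sup>+y. ennreal (exp (- (x\<^sup>2 + y\<^sup>2) / 2) / (2 * pi)) * k (x, y) \<partial>lborel \<partial>lborel)"
  proof (intro nn_integral_cong)
    fix x y :: real
    have "std_normal_density x * std_normal_density y = exp (- (x\<^sup>2 + y\<^sup>2) / 2) / (2 * pi)"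
      by (simp add: std_normal_density_def mult_exp_exp field_simps real_sqrt_mult[symmetric] flip: exp_add)
    then show "ennreal (std_normal_density x) * (ennreal (std_normal_density y) * k (x, y))
        = ennreal (exp (- (x\<^sup>2 + y\<^sup>2) / 2) / (2 * pi)) * k (x, y)"
      by (simp add: mult.assoc[symmetric] ennreal_mult[symmetric])
  qed
  finally show ?thesis .
qed

text \<open>
  The density depends only on \<open>x\<^sup>2 + y\<^sup>2\<close>.
\<close>

lemma gauss_rotation_invariant:
  fixes k :: "real \<times> real \<Rightarrow> ennreal"
  assumes [measurable]: "k \<in> borel_measurable (borel \<Otimes>\<^sub>M borel)" and cs: "c\<^sup>2 + s\<^sup>2 = (1::real)"
  shows "(\<integral>\<^sup>+x. \<integral>\<^sup>+y. k (c * x - s * y, s * x + c * y) \<partial>gauss \<partial>gauss)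
       = (\<integral>\<^sup>+x. \<integral>\<^sup>+y. k (x, y) \<partial>gauss \<partial>gauss)"
proof -
  define h :: "real \<times> real \<Rightarrow> ennreal" where
    "h = (\<lambda>p. ennreal (exp (- ((fst p)\<^sup>2 + (snd p)\<^sup>2) / 2) / (2 * pi)) * k p)"
  have h[measurable]: "h \<in> borel_measurable (borel \<Otimes>\<^sub>M borel)" unfolding h_def by measurable
  have n: "(c * x - s * y)\<^sup>2 + (s * x + c * y)\<^sup>2 = x\<^sup>2 + y\<^sup>2" for x y
  proof -
    have "(c * x - s * y)\<^sup>2 + (s * x + c * y)\<^sup>2 = (c\<^sup>2 + s\<^sup>2) * (x\<^sup>2 + y\<^sup>2)"
      by (simp add: power2_eq_square algebra_simps)
    then show ?thesis by (simp add: cs)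
  qed
  then have n: "- (c * x - s * y)\<^sup>2 - (s * x + c * y)\<^sup>2 = - x\<^sup>2 - y\<^sup>2" for x y
    by (metis minus_add_distrib add_uminus_conv_diff)
  have "(\<integral>\<^sup>+x. \<integral>\<^sup>+y. k (c * x - s * y, s * x + c * y) \<partial>gauss \<partial>gauss)
      = (\<integral>\<^sup>+x. \<integral>\<^sup>+y. h (c * x - s * y, s * x + c * y) \<partial>lborel \<partial>lborel)"
    by (subst nn_integral_gauss2[where k = "\<lambda>p. k (c * fst p - s * snd p, s * fst p + c * snd p)", simplified])
       (simp_all add: h_def n)
  also have "\<dots> = (\<integral>\<^sup>+x. \<integral>\<^sup>+y. h (x, y) \<partial>lborel \<partial>lborel)"
    by (rule lborel_rotation_invariant[OF h cs])
  also have "\<dots> = (\<integral>\<^sup>+x. \<integral>\<^sup>+y. k (x, y) \<partial>gauss \<partial>gauss)"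
    by (subst nn_integral_gauss2) (simp_all add: h_def)
  finally show ?thesis .
qed

section \<open>Angles and random hyperplanes\<close>

text \<open>
  Such a rotation turns \<open>a x + b y\<close> into a multiple of the second coordinate alone, which is how a
  Gaussian coordinate is eliminated below.
\<close>

lemma planar_rotation_exists:
  fixes a b :: real
  obtains c s where "c\<^sup>2 + s\<^sup>2 = (1::real)" "c * a + s * b = 0" "c * b - s * a = sqrt (a\<^sup>2 + b\<^sup>2)"
proof (cases "a = 0 \<and> b = 0")
  case True
  then show ?thesis using that[of 1 0] by simp
next
  case False
  define r where "r = sqrt (a\<^sup>2 + b\<^sup>2)"
  have r: "r > 0" "r\<^sup>2 = a\<^sup>2 + b\<^sup>2"
    using False by (auto simp: r_def sum_power2_gt_zero_iff)
  show ?thesis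
  proof (rule that[of "b / r" "- a / r"])
    have "(b / r)\<^sup>2 + (- a / r)\<^sup>2 = (a\<^sup>2 + b\<^sup>2) / r\<^sup>2"
      by (simp add: power_divide add_divide_distrib)
    also have "\<dots> = 1" using r by (metis divide_self less_irrefl zero_less_power)
    finally show "(b / r)\<^sup>2 + (- a / r)\<^sup>2 = 1" .
    show "b / r * a + - a / r * b = 0" by simp
    show "b / r * b - - a / r * a = sqrt (a\<^sup>2 + b\<^sup>2)"
      using r unfolding r_def[symmetric] by (simp add: field_simps power2_eq_square)
  qed
qed

lemma nn_integral_gauss_const: "(\<integral>\<^sup>+z. c \<partial>gauss) = c"
  using gauss.emeasure_space_1 by simp

definition lin :: "'i set \<Rightarrow> ('i \<Rightarrow> real) \<Rightarrow> ('i \<Rightarrow> real) \<Rightarrow> real" where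
  "lin I u g = (\<Sum>i\<in>I. u i * g i)"

lemma lin_measurable[measurable]:
  assumes "I \<subseteq> J"
  shows "lin I u \<in> borel_measurable (PiM J (\<lambda>_. gauss))"
proof -
  have "(\<lambda>g. u i * g i) \<in> borel_measurable (PiM J (\<lambda>_. gauss))" if "i \<in> I" for i
    using that assms by (intro borel_measurable_times borel_measurable_const
        measurable_compose[OF measurable_component_singleton]) auto
  then show ?thesis unfolding lin_def by (rule borel_measurable_sum)
qed

text \<open>
  A pair of linear forms in independent standard Gaussians is distributed like \<open>\<alpha> x\<close> and
  \<open>\<beta> x + \<gamma> y\<close>, where \<open>\<alpha>, \<beta>, \<gamma>\<close> is the Cholesky factor of its Gram matrix. In the induction a new
  coordinate \<open>z\<close> leads to two forms in \<open>z, x, y\<close>. A rotation of \<open>(z, x)\<close> removes \<open>z\<close> from the first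
  form, a rotation of \<open>(z, y)\<close> then removes it from the second, and \<open>z\<close> integrates to one.
\<close>

lemma joint_law_linear_forms:
  fixes u w :: "'i \<Rightarrow> real"
  assumes "finite I"
  shows "\<exists>\<alpha> \<beta> \<gamma>. 0 \<le> \<alpha> \<and> 0 \<le> \<gamma> \<and> \<alpha>\<^sup>2 = lin I u u \<and> \<alpha> * \<beta> = lin I u w \<and> \<beta>\<^sup>2 + \<gamma>\<^sup>2 = lin I w w \<and>
     (\<forall>k :: real \<times> real \<Rightarrow> ennreal. k \<in> borel_measurable (borel \<Otimes>\<^sub>M borel) \<longrightarrow>
       (\<integral>\<^sup>+g. k (lin I u g, lin I w g) \<partial>PiM I (\<lambda>_. gauss))
         = (\<integral>\<^sup>+x. \<integral>\<^sup>+y. k (\<alpha> * x, \<beta> * x + \<gamma> * y) \<partial>gauss \<partial>gauss))"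
  using assms
proof (induction I rule: finite_induct)
  case empty
  show ?case
    by (intro exI[of _ 0]) (simp add: lin_def gaussP.nn_integral_empty nn_integral_gauss_const del: nn_integral_const)
next
  case (insert i I)
  obtain \<alpha> \<beta> \<gamma> where nn: "0 \<le> \<alpha>" "0 \<le> \<gamma>" and gram: "\<alpha>\<^sup>2 = lin I u u" "\<alpha> * \<beta> = lin I u w"
      "\<beta>\<^sup>2 + \<gamma>\<^sup>2 = lin I w w"
    and law: "\<And>k :: real \<times> real \<Rightarrow> ennreal. k \<in> borel_measurable (borel \<Otimes>\<^sub>M borel) \<Longrightarrow>
       (\<integral>\<^sup>+g. k (lin I u g, lin I w g) \<partial>PiM I (\<lambda>_. gauss))
         = (\<integral>\<^sup>+x. \<integral>\<^sup>+y. k (\<alpha> * x, \<beta> * x + \<gamma> * y) \<partial>gauss \<partial>gauss)"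
    using insert.IH by blast
  obtain c s where cs: "c\<^sup>2 + s\<^sup>2 = (1::real)" "c * u i + s * \<alpha> = 0"
      "c * \<alpha> - s * u i = sqrt ((u i)\<^sup>2 + \<alpha>\<^sup>2)"
    by (rule planar_rotation_exists)
  define \<rho> where "\<rho> = sqrt ((u i)\<^sup>2 + \<alpha>\<^sup>2)"
  define p where "p = c * w i + s * \<beta>"
  define q where "q = c * \<beta> - s * w i"
  obtain c' s' where cs': "c'\<^sup>2 + s'\<^sup>2 = (1::real)" "c' * p + s' * \<gamma> = 0"
      "c' * \<gamma> - s' * p = sqrt (p\<^sup>2 + \<gamma>\<^sup>2)"
    by (rule planar_rotation_exists)
  define \<tau> where "\<tau> = sqrt (p\<^sup>2 + \<gamma>\<^sup>2)"
  have lin_ins: "lin (insert i I) u g = u i * g i + lin I u g" for u g :: "'i \<Rightarrow> real"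
    using insert.hyps by (simp add: lin_def)
  have lin_upd: "lin I u (g(i := z)) = lin I u g" for u g z
    unfolding lin_def using insert.hyps by (intro sum.cong) auto
  have "(\<integral>\<^sup>+g. k (lin (insert i I) u g, lin (insert i I) w g) \<partial>PiM (insert i I) (\<lambda>_. gauss))
      = (\<integral>\<^sup>+x. \<integral>\<^sup>+y. k (\<rho> * x, q * x + \<tau> * y) \<partial>gauss \<partial>gauss)"
    if [measurable]: "k \<in> borel_measurable (borel \<Otimes>\<^sub>M borel)" for k :: "real \<times> real \<Rightarrow> ennreal"
  proof -
    have "(\<integral>\<^sup>+g. k (lin (insert i I) u g, lin (insert i I) w g) \<partial>PiM (insert i I) (\<lambda>_. gauss))
        = (\<integral>\<^sup>+z. \<integral>\<^sup>+g. k (u i * z + lin I u g, w i * z + lin I w g) \<partial>PiM I (\<lambda>_. gauss) \<partial>gauss)"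
      using insert.hyps subset_insertI[of I i]
      by (subst gaussP.product_nn_integral_insert_rev) (simp_all add: lin_ins lin_upd)
    also have "\<dots> = (\<integral>\<^sup>+z. \<integral>\<^sup>+x. \<integral>\<^sup>+y. k (u i * z + \<alpha> * x, w i * z + (\<beta> * x + \<gamma> * y)) \<partial>gauss \<partial>gauss \<partial>gauss)"
    proof (rule nn_integral_cong)
      fix z :: real
      show "(\<integral>\<^sup>+g. k (u i * z + lin I u g, w i * z + lin I w g) \<partial>PiM I (\<lambda>_. gauss))
          = (\<integral>\<^sup>+x. \<integral>\<^sup>+y. k (u i * z + \<alpha> * x, w i * z + (\<beta> * x + \<gamma> * y)) \<partial>gauss \<partial>gauss)"
        by (subst law[of "\<lambda>p. k (u i * z + fst p, w i * z + snd p)", simplified]) simp_all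
    qed
    also have "\<dots> = (\<integral>\<^sup>+z. \<integral>\<^sup>+x. \<integral>\<^sup>+y. k (u i * (c * z - s * x) + \<alpha> * (s * z + c * x),
          w i * (c * z - s * x) + (\<beta> * (s * z + c * x) + \<gamma> * y)) \<partial>gauss \<partial>gauss \<partial>gauss)"
      by (subst gauss_rotation_invariant[symmetric, OF _ cs(1), where
            k = "\<lambda>p. \<integral>\<^sup>+y. k (u i * fst p + \<alpha> * snd p, w i * fst p + (\<beta> * snd p + \<gamma> * y)) \<partial>gauss", simplified])
         simp_all
    also have "\<dots> = (\<integral>\<^sup>+z. \<integral>\<^sup>+x. \<integral>\<^sup>+y. k (\<rho> * x, q * x + (p * z + \<gamma> * y)) \<partial>gauss \<partial>gauss \<partial>gauss)"
    proof -
      have "u i * (c * z - s * x) + \<alpha> * (s * z + c * x) = \<rho> * x" for z x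
      proof -
        have "u i * (c * z - s * x) + \<alpha> * (s * z + c * x) = (c * u i + s * \<alpha>) * z + (c * \<alpha> - s * u i) * x"
          by (simp add: algebra_simps)
        then show ?thesis by (simp add: cs \<rho>_def)
      qed
      moreover have "w i * (c * z - s * x) + (\<beta> * (s * z + c * x) + \<gamma> * y) = q * x + (p * z + \<gamma> * y)" for x y z
        by (simp add: p_def q_def algebra_simps)
      ultimately show ?thesis by (simp only:)
    qed
    also have "\<dots> = (\<integral>\<^sup>+x. \<integral>\<^sup>+z. \<integral>\<^sup>+y. k (\<rho> * x, q * x + (p * z + \<gamma> * y)) \<partial>gauss \<partial>gauss \<partial>gauss)"
      by (rule gauss2.Fubini') measurable
    also have "\<dots> = (\<integral>\<^sup>+x. \<integral>\<^sup>+z. \<integral>\<^sup>+y. k (\<rho> * x, q * x + (p * (c' * z - s' * y) + \<gamma> * (s' * z + c' * y))) \<partial>gauss \<partial>gauss \<partial>gauss)"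
    proof (rule nn_integral_cong)
      fix x
      show "(\<integral>\<^sup>+z. \<integral>\<^sup>+y. k (\<rho> * x, q * x + (p * z + \<gamma> * y)) \<partial>gauss \<partial>gauss)
          = (\<integral>\<^sup>+z. \<integral>\<^sup>+y. k (\<rho> * x, q * x + (p * (c' * z - s' * y) + \<gamma> * (s' * z + c' * y))) \<partial>gauss \<partial>gauss)"
        by (subst gauss_rotation_invariant[symmetric, OF _ cs'(1), where
            k = "\<lambda>v. k (\<rho> * x, q * x + (p * fst v + \<gamma> * snd v))", simplified]) simp_all
    qed
    also have "\<dots> = (\<integral>\<^sup>+x. \<integral>\<^sup>+z. \<integral>\<^sup>+y. k (\<rho> * x, q * x + \<tau> * y) \<partial>gauss \<partial>gauss \<partial>gauss)"
    proof -
      have "p * (c' * z - s' * y) + \<gamma> * (s' * z + c' * y) = \<tau> * y" for z y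
      proof -
        have "p * (c' * z - s' * y) + \<gamma> * (s' * z + c' * y) = (c' * p + s' * \<gamma>) * z + (c' * \<gamma> - s' * p) * y"
          by (simp add: algebra_simps)
        then show ?thesis by (simp add: cs' \<tau>_def)
      qed
      then show ?thesis by (simp only:)
    qed
    finally show ?thesis by (simp only: nn_integral_gauss_const)
  qed
  moreover have "0 \<le> \<rho>" "0 \<le> \<tau>" by (simp_all add: \<rho>_def \<tau>_def)
  moreover have "\<rho>\<^sup>2 = lin (insert i I) u u"
    by (simp add: \<rho>_def lin_ins gram[symmetric] power2_eq_square)
  moreover have "\<rho> * q = lin (insert i I) u w"
  proof -
    have "\<rho> * q = (c * \<alpha> - s * u i) * (c * \<beta> - s * w i) + (c * u i + s * \<alpha>) * (c * w i + s * \<beta>)"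
      using cs by (simp add: \<rho>_def q_def)
    also have "\<dots> = (c\<^sup>2 + s\<^sup>2) * (u i * w i + \<alpha> * \<beta>)"
      by (simp add: power2_eq_square algebra_simps)
    finally show ?thesis by (simp add: cs lin_ins gram)
  qed
  moreover have "q\<^sup>2 + \<tau>\<^sup>2 = lin (insert i I) w w"
  proof -
    have "q\<^sup>2 + p\<^sup>2 = (c\<^sup>2 + s\<^sup>2) * ((w i)\<^sup>2 + \<beta>\<^sup>2)"
      by (simp add: p_def q_def power2_eq_square algebra_simps)
    then show ?thesis using cs(1) gram(3) by (simp add: \<tau>_def lin_ins power2_eq_square)
  qed
  ultimately show ?case by blast
qed

abbreviation gauss_plane :: "(real \<times> real) measure" where
  "gauss_plane \<equiv> gauss \<Otimes>\<^sub>M gauss"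

lemma sets_gauss_plane[measurable_cong]: "sets gauss_plane = sets (borel \<Otimes>\<^sub>M borel)"
  by (rule sets_pair_measure_cong) simp_all

lemma space_gauss_plane: "space gauss_plane = UNIV"
  by (simp add: space_pair_measure)

lemma gauss_plane_rotation_invariant:
  assumes "c\<^sup>2 + s\<^sup>2 = (1::real)" and X: "X \<in> sets gauss_plane"
  shows "measure gauss_plane {p. (c * fst p - s * snd p, s * fst p + c * snd p) \<in> X} = measure gauss_plane X"
proof -
  let ?Y = "{p. (c * fst p - s * snd p, s * fst p + c * snd p) \<in> X}"
  have [measurable]: "X \<in> sets (borel \<Otimes>\<^sub>M borel)" using X by (simp add: sets_gauss_plane)
  have "?Y = (\<lambda>p. (c * fst p - s * snd p, s * fst p + c * snd p)) -` X \<inter> space (borel \<Otimes>\<^sub>M borel)"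
    by (auto simp: space_pair_measure)
  also have "\<dots> \<in> sets (borel \<Otimes>\<^sub>M borel)"
    by (rule measurable_sets) measurable
  finally have Y: "?Y \<in> sets gauss_plane" by (simp add: sets_gauss_plane)
  have "emeasure gauss_plane ?Y = (\<integral>\<^sup>+x. \<integral>\<^sup>+y. indicator ?Y (x, y) \<partial>gauss \<partial>gauss)"
    by (rule gauss.emeasure_pair_measure[OF Y])
  also have "\<dots> = (\<integral>\<^sup>+x. \<integral>\<^sup>+y. indicator X (c * x - s * y, s * x + c * y) \<partial>gauss \<partial>gauss)"
    by (intro nn_integral_cong) (simp add: indicator_def)
  also have "\<dots> = (\<integral>\<^sup>+x. \<integral>\<^sup>+y. indicator X (x, y) \<partial>gauss \<partial>gauss)"
    by (rule gauss_rotation_invariant) (use assms in measurable)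
  also have "\<dots> = emeasure gauss_plane X"
    by (rule gauss.emeasure_pair_measure[OF X, symmetric])
  finally show ?thesis by (simp add: measure_def)
qed

text \<open>
  The inner product with the unit vector at angle \<open>t\<close>.
\<close>

definition ray_height :: "real \<Rightarrow> real \<times> real \<Rightarrow> real" where
  "ray_height t p = fst p * cos t + snd p * sin t"

definition sector :: "real \<Rightarrow> real \<Rightarrow> (real \<times> real) set" where
  "sector s t = {p. 0 < ray_height s p \<and> ray_height t p \<le> 0}"

lemma sector_measurable[measurable, simp]: "sector s t \<in> sets (borel \<Otimes>\<^sub>M borel)"
proof -
  have "{p \<in> space gauss_plane. 0 < ray_height s p \<and> ray_height t p \<le> 0} \<in> sets gauss_plane"
    unfolding ray_height_def by measurable
  then show ?thesis by (simp add: sector_def space_gauss_plane sets_gauss_plane)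
qed

lemma measure_sector_rotate:
  "measure gauss_plane (sector (s + d) (t + d)) = measure gauss_plane (sector s t)"
proof -
  have "ray_height (u + d) p = ray_height u (cos d * fst p - (- sin d) * snd p, - sin d * fst p + cos d * snd p)" for u p
    by (simp add: ray_height_def cos_add sin_add algebra_simps)
  then have "sector (s + d) (t + d)
      = {p. (cos d * fst p - (- sin d) * snd p, - sin d * fst p + cos d * snd p) \<in> sector s t}"
    by (simp add: sector_def)
  then show ?thesis
    using gauss_plane_rotation_invariant[of "cos d" "- sin d" "sector s t"] by simp
qed

text \<open>
  Along a half-turn the sign of the inner product with a fixed point changes only once. This is read off
  from the linear relation \<open>id\<close> between the heights at the angles \<open>0\<close>, \<open>s\<close> and \<open>s + t\<close>, whose
  coefficients are positive.
\<close>

lemma sector_split: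
  assumes "0 \<le> s" "0 \<le> t" "s + t < pi"
  shows "sector 0 (s + t) = sector 0 s \<union> sector s (s + t)" "sector 0 s \<inter> sector s (s + t) = {}"
proof -
  show "sector 0 s \<inter> sector s (s + t) = {}" by (auto simp: sector_def)
  \<comment> \<open>The addition theorem for \<open>sin\<close>, applied in each coordinate.\<close>
  have id: "sin t * ray_height 0 p + sin s * ray_height (s + t) p = sin (s + t) * ray_height s p" for p
  proof -
    have "sin t = sin (s + t) * cos s - cos (s + t) * sin s"
      using sin_diff[of "s + t" s] by simp
    then have "sin t * ray_height 0 p = (sin (s + t) * cos s - cos (s + t) * sin s) * fst p"
      by (simp add: ray_height_def)
    then show ?thesis by (simp add: ray_height_def algebra_simps)
  qed
  consider "s = 0" | "t = 0" | "0 < s" "0 < t" using assms by linarith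
  then show "sector 0 (s + t) = sector 0 s \<union> sector s (s + t)"
  proof cases
    case 3
    then have pos: "0 < sin s" "0 < sin t" "0 < sin (s + t)"
      using assms by (auto intro!: sin_gt_zero)
    have "ray_height (s + t) p \<le> 0" if "0 < ray_height 0 p" "ray_height s p \<le> 0" for p
    proof -
      have "sin s * ray_height (s + t) p = sin (s + t) * ray_height s p - sin t * ray_height 0 p"
        using id[of p] by linarith
      also have "\<dots> \<le> 0"
        using mult_nonneg_nonpos[of "sin (s + t)" "ray_height s p"] mult_pos_pos[of "sin t" "ray_height 0 p"] that pos
        by linarith
      finally show ?thesis using pos by (simp add: mult_le_0_iff)
    qed
    moreover have "0 < ray_height 0 p" if "0 < ray_height s p" "ray_height (s + t) p \<le> 0" for p
    proof -
      have "sin t * ray_height 0 p = sin (s + t) * ray_height s p - sin s * ray_height (s + t) p"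
        using id[of p] by linarith
      also have "\<dots> > 0"
        using mult_nonneg_nonpos[of "sin s" "ray_height (s + t) p"] mult_pos_pos[of "sin (s + t)" "ray_height s p"] that pos
        by linarith
      finally show ?thesis using pos by (simp add: zero_less_mult_iff)
    qed
    ultimately show ?thesis by (auto simp: sector_def)
  qed (auto simp: sector_def)
qed

lemma measure_sector_add:
  assumes "0 \<le> s" "0 \<le> t" "s + t < pi"
  shows "measure gauss_plane (sector 0 (s + t)) = measure gauss_plane (sector 0 s) + measure gauss_plane (sector 0 t)"
proof -
  have "measure gauss_plane (sector 0 (s + t)) = measure gauss_plane (sector 0 s) + measure gauss_plane (sector s (s + t))"
    using sector_split[OF assms] gauss2.P.finite_measure_Union[of "sector 0 s" "sector s (s + t)"]
    by (simp add: sets_gauss_plane)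
  then show ?thesis using measure_sector_rotate[of 0 s t] by (simp add: add.commute)
qed

text \<open>
  Four rotated copies of the quarter plane partition the plane without the origin, a null set.
\<close>

lemma measure_quarter_plane: "measure gauss_plane (sector 0 (pi / 2)) = 1 / 4"
proof -
  let ?Q = "\<lambda>k. sector (real k * (pi / 2)) (real k * (pi / 2) + pi / 2)"
  have q: "measure gauss_plane (?Q k) = measure gauss_plane (sector 0 (pi / 2))" for k
    using measure_sector_rotate[of 0 "real k * (pi / 2)" "pi / 2"] by (simp add: add.commute)
  have Q: "?Q 0 = {p. 0 < fst p \<and> snd p \<le> 0}" "?Q 1 = {p. 0 < snd p \<and> 0 \<le> fst p}"
     "?Q 2 = {p. fst p < 0 \<and> 0 \<le> snd p}" "?Q 3 = {p. snd p < 0 \<and> fst p \<le> 0}"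
    using cos_add[of pi "pi/2"] sin_add[of pi "pi/2"] cos_add[of "pi/2" "pi/2"] sin_add[of "pi/2" "pi/2"]
    by (auto simp: sector_def ray_height_def cos_3over2_pi sin_3over2_pi)
  have "emeasure gauss_plane {(0, 0)} = emeasure gauss {0} * emeasure gauss {0}"
    using gauss.emeasure_pair_measure_Times[of "{0}" gauss "{0}"] by simp
  also have "emeasure gauss {0} = 0"
    by (subst emeasure_density) (auto simp: nn_integral_cmult_indicator[symmetric] simp flip: )
  finally have null: "measure gauss_plane {(0, 0)} = 0" by (simp add: measure_def)
  have U: "UNIV = {(0, 0)} \<union> (?Q 0 \<union> ?Q 1 \<union> ?Q 2 \<union> ?Q 3)"
    unfolding Q by auto
  have "1 = measure gauss_plane UNIV"
    using gauss2.P.prob_space by (simp add: space_gauss_plane)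
  also have "\<dots> = measure gauss_plane {(0, 0)} + (measure gauss_plane (?Q 0) + measure gauss_plane (?Q 1)
      + measure gauss_plane (?Q 2) + measure gauss_plane (?Q 3))"
  proof -
    have "{0} \<times> {0} \<in> sets gauss_plane" by (rule pair_measureI) simp_all
    then have s: "?Q k \<in> sets gauss_plane" "{(0, 0)} \<in> sets gauss_plane" for k
      using sets_gauss_plane by simp_all
    have "measure gauss_plane (?Q 0 \<union> ?Q 1) = measure gauss_plane (?Q 0) + measure gauss_plane (?Q 1)"
      by (rule gauss2.P.finite_measure_Union[OF s(1) s(1)]) (auto simp only: Q)
    moreover have "measure gauss_plane (?Q 0 \<union> ?Q 1 \<union> ?Q 2) = measure gauss_plane (?Q 0 \<union> ?Q 1) + measure gauss_plane (?Q 2)"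
      by (rule gauss2.P.finite_measure_Union[OF sets.Un[OF s(1) s(1)] s(1)]) (auto simp only: Q)
    moreover have "measure gauss_plane (?Q 0 \<union> ?Q 1 \<union> ?Q 2 \<union> ?Q 3)
        = measure gauss_plane (?Q 0 \<union> ?Q 1 \<union> ?Q 2) + measure gauss_plane (?Q 3)"
      by (rule gauss2.P.finite_measure_Union[OF sets.Un[OF sets.Un[OF s(1) s(1)] s(1)] s(1)]) (auto simp only: Q)
    moreover have "measure gauss_plane UNIV = measure gauss_plane {(0, 0)} + measure gauss_plane (?Q 0 \<union> ?Q 1 \<union> ?Q 2 \<union> ?Q 3)"
      unfolding U
      by (rule gauss2.P.finite_measure_Union[OF s(2) sets.Un[OF sets.Un[OF sets.Un[OF s(1) s(1)] s(1)] s(1)]])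
         (unfold Q, auto)
    ultimately show ?thesis by simp
  qed
  finally show ?thesis unfolding q null by simp
qed

lemma measure_sector_mult:
  assumes "0 \<le> h" "real m * h < pi"
  shows "measure gauss_plane (sector 0 (real m * h)) = real m * measure gauss_plane (sector 0 h)"
  using assms(2)
proof (induction m)
  case 0
  have "sector 0 0 = {}" by (auto simp: sector_def)
  then show ?case by simp
next
  case (Suc m)
  have "real m * h + h < pi" using Suc.prems by (simp add: algebra_simps)
  then show ?case
    using Suc.IH measure_sector_add[of "real m * h" h] assms(1) by (simp add: algebra_simps)
qed

lemma measure_sector_mono:
  assumes "0 \<le> s" "s \<le> t" "s < pi" "t \<le> pi"
  shows "measure gauss_plane (sector 0 s) \<le> measure gauss_plane (sector 0 t)"
proof (cases "t = pi")
  case True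
  then have "sector 0 s \<subseteq> sector 0 t" by (auto simp: sector_def ray_height_def)
  then show ?thesis by (intro gauss2.P.finite_measure_mono) (auto simp: sets_gauss_plane)
next
  case False
  then show ?thesis using measure_sector_add[of s "t - s"] assms by simp
qed

text \<open>
  The measure is additive in the angle and is \<open>1 / 4\<close> at \<open>\<pi> / 2\<close>. It is therefore \<open>m / (4 k)\<close> at
  \<open>m \<pi> / (2 k)\<close>, and such angles approximate \<open>t\<close> from below.
\<close>

lemma measure_sector_ge:
  assumes t: "0 \<le> t" "t \<le> pi"
  shows "t / (2 * pi) \<le> measure gauss_plane (sector 0 t)"
proof (rule field_le_epsilon)
  fix e :: real assume "0 < e"
  then obtain n where n: "inverse (real (Suc n)) < e" using reals_Archimedean by blast
  define k where "k = Suc n"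
  have k: "k > 0" "1 / real k < e" using n by (auto simp: k_def inverse_eq_divide)
  define h where "h = pi / (2 * real k)"
  \<comment> \<open>The largest multiple of \<open>h\<close> strictly below \<open>t\<close> (zero for \<open>t = 0\<close>), so that \<open>m h < \<pi>\<close> holds also for \<open>t = \<pi>\<close>.\<close>
  define m where "m = nat \<lceil>2 * real k * t / pi\<rceil> - 1"
  have h: "0 < h" using k by (simp add: h_def)
  have kt: "0 \<le> 2 * real k * t / pi" "2 * real k * t / pi \<le> 2 * real k"
    using t k by (auto simp: divide_le_eq)
  have m1: "2 * real k * t / pi - 1 \<le> real m" unfolding m_def using kt(1) by linarith
  have m2: "real m \<le> 2 * real k * t / pi" "real m < 2 * real k"
    unfolding m_def using kt k by linarith+
  have "real k * measure gauss_plane (sector 0 h) = 1 / 4"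
    using measure_sector_mult[of h k] k h measure_quarter_plane by (simp add: h_def)
  then have A: "measure gauss_plane (sector 0 h) = 1 / (4 * real k)" using k by (simp add: field_simps)
  have mh: "real m * h < pi" "real m * h \<le> t"
    using m2 k by (auto simp: h_def field_simps)
  have "measure gauss_plane (sector 0 (real m * h)) = real m / (4 * real k)"
    using measure_sector_mult[of h m] h mh A by simp
  moreover have "t / (2 * pi) - e \<le> real m / (4 * real k)"
  proof -
    have "(2 * real k * t / pi - 1) / (4 * real k) \<le> real m / (4 * real k)"
      using m1 by (intro divide_right_mono) auto
    moreover have "(2 * real k * t / pi - 1) / (4 * real k) = t / (2 * pi) - (1 / real k) / 4"
      using k by (simp add: field_simps)
    moreover have "(1 / real k) / 4 \<le> 1 / real k" using k by (simp add: field_simps)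
    ultimately show ?thesis using k(2) by linarith
  qed
  moreover have "measure gauss_plane (sector 0 (real m * h)) \<le> measure gauss_plane (sector 0 t)"
    using measure_sector_mono[of "real m * h" t] mh t h by simp
  ultimately show "t / (2 * pi) \<le> measure gauss_plane (sector 0 t) + e" by linarith
qed

text \<open>
  The joint law reduces the event to a sector of the plane, whose opening is the angle between the two
  vectors.
\<close>

lemma prob_separated_ge:
  assumes fin: "finite I" and u: "lin I u u = 1" and w: "lin I w w = 1"
  shows "arccos (lin I u w) / (2 * pi)
      \<le> measure (PiM I (\<lambda>_. gauss)) {g \<in> space (PiM I (\<lambda>_. gauss)). 0 < lin I u g \<and> lin I w g \<le> 0}"
proof -
  let ?P = "PiM I (\<lambda>_. gauss)" and ?X = "{p :: real \<times> real. 0 < fst p \<and> snd p \<le> 0}"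
  have Xs[measurable]: "?X \<in> sets (borel \<Otimes>\<^sub>M borel)"
  proof -
    have "{p :: real \<times> real \<in> space (borel \<Otimes>\<^sub>M borel). 0 < fst p \<and> snd p \<le> 0} \<in> sets (borel \<Otimes>\<^sub>M borel)"
      by measurable
    then show ?thesis by (simp add: space_pair_measure)
  qed
  obtain \<alpha> \<beta> \<gamma> where nn: "0 \<le> \<alpha>" "0 \<le> \<gamma>" and gram: "\<alpha>\<^sup>2 = lin I u u" "\<alpha> * \<beta> = lin I u w"
      "\<beta>\<^sup>2 + \<gamma>\<^sup>2 = lin I w w"
    and law: "\<And>k :: real \<times> real \<Rightarrow> ennreal. k \<in> borel_measurable (borel \<Otimes>\<^sub>M borel) \<Longrightarrow>
       (\<integral>\<^sup>+g. k (lin I u g, lin I w g) \<partial>?P)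
         = (\<integral>\<^sup>+x. \<integral>\<^sup>+y. k (\<alpha> * x, \<beta> * x + \<gamma> * y) \<partial>gauss \<partial>gauss)"
    using joint_law_linear_forms[OF fin, of u w] by blast
  define t where "t = arccos (lin I u w)"
  have a1: "\<alpha> = 1" using gram(1) nn u by (simp add: power2_eq_1_iff)
  have b: "\<beta> = lin I u w" using gram(2) a1 by simp
  have bg: "\<beta>\<^sup>2 + \<gamma>\<^sup>2 = 1" using gram(3) w by simp
  have ab: "\<bar>\<beta>\<bar> \<le> 1" using bg by (metis abs_le_square_iff abs_one one_power2 le_add_same_cancel1 zero_le_power2)
  have ct: "cos t = \<beta>" using ab by (simp add: t_def b)
  have st: "sin t = \<gamma>"
  proof -
    have "sin t = sqrt (1 - \<beta>\<^sup>2)" using ab by (simp add: t_def b sin_arccos_abs)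
    also have "1 - \<beta>\<^sup>2 = \<gamma>\<^sup>2" using bg by simp
    finally show ?thesis using nn by simp
  qed
  have t: "0 \<le> t" "t \<le> pi" using ab by (auto simp: t_def b arccos_lbound arccos_ubound)
  have "emeasure ?P {g \<in> space ?P. 0 < lin I u g \<and> lin I w g \<le> 0}
      = (\<integral>\<^sup>+g. indicator {g \<in> space ?P. 0 < lin I u g \<and> lin I w g \<le> 0} g \<partial>?P)"
    using fin by (intro nn_integral_indicator[symmetric]) measurable
  also have "\<dots> = (\<integral>\<^sup>+g. indicator ?X (lin I u g, lin I w g) \<partial>?P)"
    by (intro nn_integral_cong) (simp add: indicator_def)
  also have "\<dots> = (\<integral>\<^sup>+x. \<integral>\<^sup>+y. indicator ?X (\<alpha> * x, \<beta> * x + \<gamma> * y) \<partial>gauss \<partial>gauss)"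
    by (rule law) measurable
  also have "\<dots> = (\<integral>\<^sup>+x. \<integral>\<^sup>+y. indicator (sector 0 t) (x, y) \<partial>gauss \<partial>gauss)"
    by (intro nn_integral_cong) (simp add: indicator_def sector_def ray_height_def ct st a1 mult.commute)
  also have "\<dots> = emeasure gauss_plane (sector 0 t)"
    by (rule gauss.emeasure_pair_measure[symmetric]) (simp add: sets_gauss_plane)
  finally show ?thesis using measure_sector_ge[OF t] by (simp add: measure_def t_def)
qed

lemma cut_weight_indicator:
  assumes "finite V" "S \<subseteq> V"
  shows "cut_weight V M S = (\<Sum>i\<in>V. \<Sum>j\<in>V. M i j * of_bool (i \<in> S \<and> j \<notin> S))"
proof -
  have "(\<Sum>j\<in>V. M i j * of_bool (i \<in> S \<and> j \<notin> S)) = (if i \<in> S then \<Sum>j\<in>V - S. M i j else 0)" for i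
    using assms by (auto intro!: sum.mono_neutral_cong_right)
  moreover have "(\<Sum>i\<in>V. if i \<in> S then \<Sum>j\<in>V - S. M i j else 0) = (\<Sum>i\<in>S. \<Sum>j\<in>V - S. M i j)"
    using assms by (intro sum.mono_neutral_cong_right) auto
  ultimately show ?thesis by (simp add: cut_weight_def)
qed

lemma cut_weight_le_max_cut: "finite V \<Longrightarrow> S \<subseteq> V \<Longrightarrow> cut_weight V M S \<le> max_cut V M"
  unfolding max_cut_def by (intro Max_ge) auto

text \<open>
  The Goemans-Williamson argument. A Gaussian vector \<open>g\<close> cuts the vertices by the sign of the inner
  product with \<open>g\<close>. By \<open>prob_separated_ge\<close> the mean weight of this cut is at least the left-hand side,
  and no cut exceeds the maximum.
\<close>

lemma hyperplane_rounding:
  fixes x :: "'v \<Rightarrow> 'i \<Rightarrow> real"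
  assumes fin: "finite V" "finite I" and nonneg: "\<And>i j. i \<in> V \<Longrightarrow> j \<in> V \<Longrightarrow> 0 \<le> M i j"
    and unit: "\<And>i. i \<in> V \<Longrightarrow> lin I (x i) (x i) = 1"
  shows "(1/2) * (\<Sum>i\<in>V. \<Sum>j\<in>V. M i j * (arccos (lin I (x i) (x j)) / pi)) \<le> max_cut V M"
proof -
  let ?P = "PiM I (\<lambda>_. gauss)"
  interpret P: prob_space ?P by (rule prob_space_PiM) (rule prob_space_gauss)
  define A where "A i j = {g \<in> space ?P. 0 < lin I (x i) g \<and> lin I (x j) g \<le> 0}" for i j
  have A[measurable]: "A i j \<in> sets ?P" for i j unfolding A_def using fin by measurable
  define cut where "cut g = (\<Sum>i\<in>V. \<Sum>j\<in>V. M i j * indicator (A i j) g)" for g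
  have le: "cut g \<le> max_cut V M" if "g \<in> space ?P" for g
  proof -
    define S where "S = {i \<in> V. 0 < lin I (x i) g}"
    have "cut g = cut_weight V M S"
      using that fin by (subst cut_weight_indicator)
        (auto simp: cut_def S_def A_def indicator_def of_bool_def not_less intro!: sum.cong)
    then show ?thesis using cut_weight_le_max_cut[of V S M] fin by (auto simp: S_def)
  qed
  have int: "integrable ?P (\<lambda>g. M i j * indicator (A i j) g)" for i j
    by (intro integrable_mult_right integrable_real_indicator) (auto simp: P.emeasure_eq_measure)
  have "(1/2) * (\<Sum>i\<in>V. \<Sum>j\<in>V. M i j * (arccos (lin I (x i) (x j)) / pi))
      = (\<Sum>i\<in>V. \<Sum>j\<in>V. M i j * (arccos (lin I (x i) (x j)) / (2 * pi)))"
    by (simp add: sum_distrib_left mult.commute)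
  also have "\<dots> \<le> (\<Sum>i\<in>V. \<Sum>j\<in>V. M i j * measure ?P (A i j))"
    unfolding A_def using prob_separated_ge fin unit nonneg by (intro sum_mono mult_left_mono) auto
  also have "\<dots> = (\<Sum>i\<in>V. \<Sum>j\<in>V. \<integral>g. M i j * indicator (A i j) g \<partial>?P)"
    by simp
  also have "\<dots> = (\<integral>g. cut g \<partial>?P)"
    unfolding cut_def using int by (subst Bochner_Integration.integral_sum | simp)+
  also have "\<dots> \<le> (\<integral>g. max_cut V M \<partial>?P)"
    using le int unfolding cut_def by (intro integral_mono Bochner_Integration.integrable_sum) auto
  also have "\<dots> = max_cut V M" by (simp add: P.prob_space)
  finally show ?thesis .
qed

section \<open>Multigraphs with a two-eigenvalue form\<close>

lemma SD_value_cong: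
  assumes "\<And>i j. i \<in> V \<Longrightarrow> j \<in> V \<Longrightarrow> X i j = Y i j"
  shows "SD_value V M X = SD_value V M Y"
  unfolding SD_value_def by (intro arg_cong2[of _ _ _ _ "(*)"] sum.cong HOL.refl) (simp add: assms)

lemma elliptope_cong:
  assumes "\<And>i j. i \<in> V \<Longrightarrow> j \<in> V \<Longrightarrow> X i j = Y i j"
  shows "X \<in> elliptope V \<longleftrightarrow> Y \<in> elliptope V"
proof -
  have "(\<Sum>i\<in>V. \<Sum>j\<in>V. x i * X i j * x j) = (\<Sum>i\<in>V. \<Sum>j\<in>V. x i * Y i j * x j)" for x
    by (intro sum.cong HOL.refl) (simp add: assms)
  then show ?thesis by (simp add: elliptope_def assms cong: ball_cong)
qed

lemma gram_mem_elliptope: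
  assumes "\<And>i. i \<in> V \<Longrightarrow> (\<Sum>k\<in>I. x i k * x i k) = (1::real)"
  shows "(\<lambda>i j. \<Sum>k\<in>I. x i k * x j k) \<in> elliptope V"
proof -
  have "(\<Sum>i\<in>V. \<Sum>j\<in>V. y i * (\<Sum>k\<in>I. x i k * x j k) * y j) = (\<Sum>k\<in>I. (\<Sum>i\<in>V. y i * x i k)\<^sup>2)" for y
  proof -
    have "(\<Sum>i\<in>V. \<Sum>j\<in>V. y i * (\<Sum>k\<in>I. x i k * x j k) * y j)
        = (\<Sum>i\<in>V. \<Sum>j\<in>V. \<Sum>k\<in>I. (y i * x i k) * (y j * x j k))"
      by (simp add: sum_distrib_left sum_distrib_right mult_ac)
    also have "\<dots> = (\<Sum>i\<in>V. \<Sum>k\<in>I. \<Sum>j\<in>V. (y i * x i k) * (y j * x j k))"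
      by (rule sum.cong[OF HOL.refl], rule sum.swap)
    also have "\<dots> = (\<Sum>k\<in>I. \<Sum>i\<in>V. \<Sum>j\<in>V. (y i * x i k) * (y j * x j k))"
      by (rule sum.swap)
    finally show ?thesis by (simp add: power2_eq_square sum_product)
  qed
  then show ?thesis using assms by (simp add: elliptope_def mult.commute sum_nonneg)
qed

text \<open>
  The properties shared by all four families. \<open>Q\<close> stands for the matrix of intersection numbers with
  self-intersections on the diagonal. The two hypotheses \<open>row_sum\<close> and \<open>square\<close> say that \<open>Q\<close> is
  \<open>eta\<close> on constants and satisfies \<open>Q\<^sup>2 = lam Q\<close> on vectors of sum zero.
\<close>

locale two_eigenvalue_form =
  fixes V :: "'v set" and Q :: "'v \<Rightarrow> 'v \<Rightarrow> real" and lam eta beta :: real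
  assumes finite_V: "finite V" and V_nonempty: "V \<noteq> {}"
    and sym: "i \<in> V \<Longrightarrow> j \<in> V \<Longrightarrow> Q i j = Q j i"
    and diag: "i \<in> V \<Longrightarrow> Q i i = -1"
    and off_diag: "i \<in> V \<Longrightarrow> j \<in> V \<Longrightarrow> i \<noteq> j \<Longrightarrow> 0 \<le> Q i j"
    and row_sum: "i \<in> V \<Longrightarrow> (\<Sum>j\<in>V. Q i j) = eta"
    and square: "i \<in> V \<Longrightarrow> j \<in> V \<Longrightarrow> (\<Sum>k\<in>V. Q i k * Q k j) = lam * Q i j + beta"
    and lam_neg: "lam < 0" and eta_pos: "0 < eta"
begin

abbreviation n :: real where "n \<equiv> real (card V)"
abbreviation M :: "'v \<Rightarrow> 'v \<Rightarrow> real" where "M \<equiv> \<lambda>i j. if i = j then 0 else Q i j"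

text \<open>
  The Gram matrix of the normalized projection, written in terms of \<open>Q\<close>; the ratio \<open>eta / n\<close> is
  the self-intersection of the component of a divisor along \<open>K\<close>.
\<close>

definition G :: "'v \<Rightarrow> 'v \<Rightarrow> real" where "G i j = (eta / n - Q i j) / (1 + eta / n)"

lemma n_pos: "0 < n"
  using finite_V V_nonempty by (simp add: card_gt_0_iff)

lemma sum_M_mult: "i \<in> V \<Longrightarrow> (\<Sum>j\<in>V. M i j * f j) = (\<Sum>j\<in>V. Q i j * f j) + f i"
proof -
  assume i: "i \<in> V"
  have "(\<Sum>j\<in>V. M i j * f j) = (\<Sum>j\<in>V. Q i j * f j + (if j = i then f i else 0))"
    using i by (intro sum.cong) (auto simp: diag)
  then show ?thesis using i finite_V by (simp add: sum.distrib)
qed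

lemma column_sum: "j \<in> V \<Longrightarrow> (\<Sum>i\<in>V. Q i j) = eta"
proof -
  assume j: "j \<in> V"
  then have "(\<Sum>i\<in>V. Q i j) = (\<Sum>i\<in>V. Q j i)" by (intro sum.cong HOL.refl) (simp add: sym)
  then show ?thesis using row_sum[OF j] by simp
qed

lemma sum_mult_Q: "(\<Sum>i\<in>V. \<Sum>j\<in>V. Q i j * f j) = eta * (\<Sum>j\<in>V. f j)"
proof -
  have "(\<Sum>i\<in>V. \<Sum>j\<in>V. Q i j * f j) = (\<Sum>j\<in>V. (\<Sum>i\<in>V. Q i j) * f j)"
    by (subst sum.swap) (simp add: sum_distrib_right)
  then show ?thesis by (simp add: column_sum sum_distrib_left)
qed

lemma Q_Q_apply:
  assumes "i \<in> V"
  shows "(\<Sum>j\<in>V. Q i j * (\<Sum>k\<in>V. Q j k * f k)) = lam * (\<Sum>k\<in>V. Q i k * f k) + beta * (\<Sum>k\<in>V. f k)"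
proof -
  have "(\<Sum>j\<in>V. Q i j * (\<Sum>k\<in>V. Q j k * f k)) = (\<Sum>k\<in>V. (\<Sum>j\<in>V. Q i j * Q j k) * f k)"
    by (simp add: sum_distrib_left sum_distrib_right mult.assoc) (rule sum.swap)
  also have "\<dots> = (\<Sum>k\<in>V. lam * (Q i k * f k) + beta * f k)"
    using assms by (intro sum.cong HOL.refl) (simp add: square ring_distribs mult.assoc)
  finally show ?thesis by (simp add: sum.distrib sum_distrib_left)
qed

text \<open>
  Both sides are row sums of \<open>Q\<^sup>2 - lam Q\<close>.
\<close>

lemma beta_eq: "beta * n = eta * (eta - lam)"
proof -
  obtain i where i: "i \<in> V" using V_nonempty by blast
  have "(\<Sum>j\<in>V. Q i j * (\<Sum>k\<in>V. Q j k * 1)) = lam * (\<Sum>k\<in>V. Q i k * 1) + beta * (\<Sum>k\<in>V. 1)"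
    by (rule Q_Q_apply[OF i])
  moreover have "(\<Sum>j\<in>V. Q i j * (\<Sum>k\<in>V. Q j k * 1)) = (\<Sum>j\<in>V. Q i j) * eta"
    unfolding sum_distrib_right by (intro sum.cong) (auto simp: row_sum)
  ultimately show ?thesis using i by (simp add: row_sum algebra_simps)
qed

lemma multigraph: "multigraph V M"
  using finite_V sym off_diag by (simp add: multigraph_def)

text \<open>
  \<open>M\<^sup>2 = (Q + I)\<^sup>2 = (lam + 2) Q + beta J + I\<close>, and \<open>Q\<close> agrees with \<open>M\<close> off the diagonal.
\<close>

lemma strongly_regular: "strongly_regular_multigraph V M"
proof -
  have M2: "(\<Sum>k\<in>V. M i k * M k j) = lam * Q i j + beta + Q i j + M i j" if "i \<in> V" "j \<in> V" for i j
  proof -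
    have "(\<Sum>k\<in>V. M i k * M k j) = (\<Sum>k\<in>V. Q i k * M k j) + M i j"
      using that(1) by (rule sum_M_mult)
    also have "(\<Sum>k\<in>V. Q i k * M k j) = (\<Sum>k\<in>V. Q i k * Q k j + (if k = j then Q i j else 0))"
      using that by (intro sum.cong) (auto simp: diag)
    also have "\<dots> = lam * Q i j + beta + Q i j"
      using that finite_V by (simp add: sum.distrib square)
    finally show ?thesis .
  qed
  show ?thesis unfolding strongly_regular_multigraph_def
  proof (intro conjI exI ballI impI)
    show "multigraph V M" by (rule multigraph)
    show "(\<Sum>k\<in>V. M i k * M k j) = (lam + 2) * M i j + beta" if "i \<in> V" "j \<in> V" "i \<noteq> j" for i j
      using M2[OF that(1,2)] that by (simp add: algebra_simps)
    show "(\<Sum>k\<in>V. M i k * M k i) = - lam + beta - 1" if "i \<in> V" for i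
      using M2[OF that that] that by (simp add: diag)
    show "(\<Sum>k\<in>V. M i k) = eta + 1" if "i \<in> V" for i
      using sum_M_mult[OF that, of "\<lambda>_. 1"] that by (simp add: row_sum)
  qed
qed

text \<open>
  Every eigenvector of \<open>Q\<close> with eigenvalue other than \<open>eta\<close> has sum zero, where \<open>Q\<^sup>2 = lam Q\<close>. That
  all three values occur is seen from \<open>e = e\<^sub>v - e\<^sub>w\<close>: the vector \<open>Q e\<close> has eigenvalue \<open>lam\<close> and
  \<open>Q e - lam e\<close> lies in the kernel. Both have the entry \<open>Q u v - Q u w \<noteq> 0\<close> at \<open>u\<close>.
\<close>

lemma spectrum:
  assumes uvw: "u \<in> V" "v \<in> V" "w \<in> V" "u \<noteq> v" "u \<noteq> w" "Q u v \<noteq> Q u w"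
  shows "graph_spectrum V M = {1 + lam, 1, 1 + eta}"
proof -
  have spec: "graph_spectrum V M = {\<mu>. \<exists>x. (\<exists>i\<in>V. x i \<noteq> 0) \<and> (\<forall>i\<in>V. (\<Sum>j\<in>V. Q i j * x j) = (\<mu> - 1) * x i)}"
  proof -
    have "(\<Sum>j\<in>V. M i j * x j) = \<mu> * x i \<longleftrightarrow> (\<Sum>j\<in>V. Q i j * x j) = (\<mu> - 1) * x i" if "i \<in> V" for i x \<mu>
      using sum_M_mult[OF that, of x] by (simp add: algebra_simps)
    then show ?thesis unfolding graph_spectrum_def by (intro Collect_cong ex_cong1 conj_cong HOL.refl ball_cong) auto
  qed
  have "\<mu> \<in> {1 + lam, 1, 1 + eta}"
    if nz: "k \<in> V" "x k \<noteq> 0" and ev: "\<And>i. i \<in> V \<Longrightarrow> (\<Sum>j\<in>V. Q i j * x j) = (\<mu> - 1) * x i" for \<mu> x k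
  proof (cases "\<mu> = 1 + eta")
    case False
    have "eta * (\<Sum>j\<in>V. x j) = (\<mu> - 1) * (\<Sum>j\<in>V. x j)"
      using sum_mult_Q[of x] by (simp add: ev sum_distrib_left)
    then have s0: "(\<Sum>j\<in>V. x j) = 0" using False by auto
    have "(\<Sum>j\<in>V. Q k j * (\<Sum>l\<in>V. Q j l * x l)) = (\<Sum>j\<in>V. (\<mu> - 1) * (Q k j * x j))"
      by (intro sum.cong) (auto simp: ev)
    also have "\<dots> = (\<mu> - 1) * ((\<mu> - 1) * x k)"
      using ev[OF nz(1)] by (simp add: sum_distrib_left[symmetric])
    finally have "(\<mu> - 1) * ((\<mu> - 1) * x k) = lam * ((\<mu> - 1) * x k)"
      using Q_Q_apply[OF nz(1), of x] ev[OF nz(1)] s0 by auto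
    then have "\<mu> - 1 = lam \<or> \<mu> - 1 = 0" using nz(2) by (metis mult_cancel_right mult_eq_0_iff)
    then show ?thesis by auto
  qed simp
  moreover have "1 + eta \<in> graph_spectrum V M"
    unfolding spec using V_nonempty row_sum by (intro CollectI exI[of _ "\<lambda>_. 1"]) auto
  moreover have "1 + lam \<in> graph_spectrum V M" "1 \<in> graph_spectrum V M"
  proof -
    define e :: "'v \<Rightarrow> real" where "e = (\<lambda>k. (if k = v then 1 else 0) - (if k = w then 1 else 0))"
    have e: "(\<Sum>k\<in>V. f k * e k) = f v - f w" for f :: "'v \<Rightarrow> real"
    proof -
      have "(\<Sum>k\<in>V. f k * e k) = (\<Sum>k\<in>V. (if k = v then f v else 0) - (if k = w then f w else 0))"
        by (intro sum.cong) (auto simp: e_def)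
      then show ?thesis using uvw finite_V by (simp add: sum_subtractf)
    qed
    have e0: "(\<Sum>k\<in>V. e k) = 0" using e[of "\<lambda>_. 1"] by simp
    have ev: "(\<Sum>j\<in>V. Q i j * (Q j v - Q j w)) = lam * (Q i v - Q i w)" if "i \<in> V" for i
      using Q_Q_apply[OF that, of e] by (simp add: e e0)
    show "1 + lam \<in> graph_spectrum V M" unfolding spec
      using ev uvw by (intro CollectI exI[of _ "\<lambda>i. Q i v - Q i w"]) auto
    have ev0: "(\<Sum>j\<in>V. Q i j * (Q j v - Q j w - lam * e j)) = 0" if "i \<in> V" for i
    proof -
      have "(\<Sum>j\<in>V. Q i j * (Q j v - Q j w - lam * e j))
          = (\<Sum>j\<in>V. Q i j * (Q j v - Q j w)) - lam * (\<Sum>j\<in>V. Q i j * e j)"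
        by (simp add: right_diff_distrib sum_subtractf sum_distrib_left mult.left_commute)
      then show ?thesis by (simp add: ev[OF that] e)
    qed
    have "Q u v - Q u w - lam * e u \<noteq> 0" using uvw by (simp add: e_def)
    then show "1 \<in> graph_spectrum V M" unfolding spec
      using ev0 uvw by (intro CollectI exI[of _ "\<lambda>i. Q i v - Q i w - lam * e i"]) auto
  qed
  ultimately show ?thesis unfolding spec by blast
qed

lemma sum_M: "(\<Sum>i\<in>V. \<Sum>j\<in>V. M i j) = n * (1 + eta)"
proof -
  have "(\<Sum>j\<in>V. M i j) = 1 + eta" if "i \<in> V" for i
    using sum_M_mult[OF that, of "\<lambda>_. 1"] that by (simp add: row_sum)
  then show ?thesis by simp
qed

lemma SD_value_eq:
  assumes "\<And>i. i \<in> V \<Longrightarrow> X i i = 1"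
  shows "SD_value V M X = (n * eta - (\<Sum>i\<in>V. \<Sum>j\<in>V. Q i j * X i j)) / 4"
proof -
  have r: "(\<Sum>j\<in>V. M i j * ((1 - X i j) / 2)) = (eta - (\<Sum>j\<in>V. Q i j * X i j)) / 2" if "i \<in> V" for i
    using sum_M_mult[OF that, of "\<lambda>j. (1 - X i j) / 2"] that assms row_sum[OF that]
    by (simp add: sum_divide_distrib[symmetric] right_diff_distrib sum_subtractf)
  have "SD_value V M X = 1/2 * (\<Sum>i\<in>V. (eta - (\<Sum>j\<in>V. Q i j * X i j)) / 2)"
    unfolding SD_value_def by (intro arg_cong[of _ _ "\<lambda>t. 1/2 * t"] sum.cong HOL.refl) (rule r)
  also have "\<dots> = (n * eta - (\<Sum>i\<in>V. \<Sum>j\<in>V. Q i j * X i j)) / 4"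
    by (simp add: sum_divide_distrib[symmetric] sum_subtractf)
  finally show ?thesis .
qed

text \<open>
  The matrix \<open>R = Q - lam I - c J\<close> vanishes on constants and satisfies \<open>R\<^sup>2 = - lam R\<close>, hence is
  positive semidefinite. Pairing it with \<open>X\<close> gives
  \<open>\<langle>Q, X\<rangle> - lam n \<ge> c \<langle>J, X\<rangle> \<ge> 0\<close>.
\<close>

lemma elliptope_form_ge:
  assumes X: "X \<in> elliptope V"
  shows "lam * n \<le> (\<Sum>i\<in>V. \<Sum>j\<in>V. Q i j * X i j)"
proof -
  define c where "c = (eta - lam) / n"
  have c: "c * n = eta - lam" "beta = eta * c"
    using n_pos beta_eq by (auto simp: c_def field_simps)
  have c0: "0 < c" using n_pos eta_pos lam_neg by (simp add: c_def)
  define R where "R i j = Q i j - lam * (if i = j then 1 else 0) - c" for i j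
  have R2: "(\<Sum>k\<in>V. R k i * R k j) = - lam * R i j" if "i \<in> V" "j \<in> V" for i j
  proof -
    have "(\<Sum>k\<in>V. R k i * R k j)
        = (\<Sum>k\<in>V. Q i k * Q k j - lam * (if k = i then Q i j else 0) - lam * (if k = j then Q i j else 0)
            - c * Q k i - c * Q k j + lam\<^sup>2 * (if k = i then (if i = j then 1 else 0) else 0)
            + lam * c * (if k = i then 1 else 0) + lam * c * (if k = j then 1 else 0) + c * c)"
      using that by (intro sum.cong) (auto simp: R_def sym power2_eq_square algebra_simps)
    also have "\<dots> = lam * Q i j + eta * c - lam * Q i j - lam * Q i j - c * eta - c * eta
        + lam\<^sup>2 * (if i = j then 1 else 0) + lam * c + lam * c + n * (c * c)"
      using that finite_V
      by (simp add: sum.distrib sum_subtractf square column_sum c(2) sum_distrib_left[symmetric] cong: if_cong)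
    also have "n * (c * c) = (eta - lam) * c" using c(1) by (metis mult.assoc mult.commute)
    finally show ?thesis by (simp add: R_def power2_eq_square algebra_simps)
  qed
  have psd: "0 \<le> (\<Sum>i\<in>V. \<Sum>j\<in>V. x i * X i j * x j)" for x using X by (simp add: elliptope_def)
  have "0 \<le> (\<Sum>k\<in>V. \<Sum>i\<in>V. \<Sum>j\<in>V. R k i * X i j * R k j)"
    by (intro sum_nonneg psd)
  also have "\<dots> = (\<Sum>i\<in>V. \<Sum>j\<in>V. \<Sum>k\<in>V. R k i * X i j * R k j)"
    by (subst sum.swap) (rule sum.cong[OF HOL.refl], rule sum.swap)
  also have "\<dots> = (\<Sum>i\<in>V. \<Sum>j\<in>V. X i j * (\<Sum>k\<in>V. R k i * R k j))"
    by (simp add: sum_distrib_left mult_ac)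
  also have "\<dots> = - lam * (\<Sum>i\<in>V. \<Sum>j\<in>V. X i j * R i j)"
    by (simp add: R2 sum_distrib_left sum_negf mult_ac cong: sum.cong)
  finally have nn: "0 \<le> (\<Sum>i\<in>V. \<Sum>j\<in>V. X i j * R i j)"
    using lam_neg by (simp add: zero_le_mult_iff mult_le_0_iff)
  have "(\<Sum>i\<in>V. \<Sum>j\<in>V. X i j * R i j)
      = (\<Sum>i\<in>V. \<Sum>j\<in>V. Q i j * X i j - lam * (if j = i then X i j else 0) - c * X i j)"
    by (intro sum.cong) (auto simp: R_def algebra_simps)
  also have "\<dots> = (\<Sum>i\<in>V. \<Sum>j\<in>V. Q i j * X i j) - lam * n - c * (\<Sum>i\<in>V. \<Sum>j\<in>V. X i j)"
    using X finite_V by (simp add: sum_subtractf sum_distrib_left[symmetric] elliptope_def)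
  finally have "lam * n + c * (\<Sum>i\<in>V. \<Sum>j\<in>V. X i j) \<le> (\<Sum>i\<in>V. \<Sum>j\<in>V. Q i j * X i j)"
    using nn by linarith
  moreover have "0 \<le> (\<Sum>i\<in>V. \<Sum>j\<in>V. X i j)" using psd[of "\<lambda>_. 1"] by simp
  ultimately show ?thesis using mult_nonneg_nonneg[OF less_imp_le[OF c0], of "\<Sum>i\<in>V. \<Sum>j\<in>V. X i j"] by linarith
qed

lemma SD_value_le: "X \<in> elliptope V \<Longrightarrow> SD_value V M X \<le> n * (eta - lam) / 4"
proof -
  assume X: "X \<in> elliptope V"
  then have "SD_value V M X = (n * eta - (\<Sum>i\<in>V. \<Sum>j\<in>V. Q i j * X i j)) / 4"
    by (intro SD_value_eq) (simp add: elliptope_def)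
  then show ?thesis using elliptope_form_ge[OF X] by (simp add: algebra_simps)
qed

text \<open>
  As \<open>G\<^sup>2\<close> is the multiple \<open>- lam / (1 + eta / n)\<close> of \<open>G\<close>, suitably scaled rows of \<open>G\<close> are vectors
  whose Gram matrix is \<open>G\<close> itself.
\<close>

definition gram_vector :: "'v \<Rightarrow> 'v \<Rightarrow> real" where
  "gram_vector i k = sqrt ((1 + eta / n) / - lam) * G i k"

lemma gram_vector: "i \<in> V \<Longrightarrow> j \<in> V \<Longrightarrow> (\<Sum>k\<in>V. gram_vector i k * gram_vector j k) = G i j"
proof -
  assume ij: "i \<in> V" "j \<in> V"
  define s where "s = eta / n"
  have s: "s > 0" "s * n = eta" using eta_pos n_pos by (auto simp: s_def)
  have b: "beta = s * (eta - lam)" using beta_eq n_pos by (simp add: s_def field_simps)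
  have "0 \<le> (1 + s) / - lam" using s lam_neg by (intro divide_nonneg_nonneg) auto
  then have sq: "sqrt ((1 + s) / - lam) * sqrt ((1 + s) / - lam) = (1 + s) / - lam"
    by (metis real_sqrt_mult_self abs_of_nonneg)
  have "(\<Sum>k\<in>V. gram_vector i k * gram_vector j k)
      = (\<Sum>k\<in>V. ((1 + s) / - lam / (1 + s)\<^sup>2) * (s * s - s * Q i k - s * Q k j + Q i k * Q k j))"
  proof (rule sum.cong[OF HOL.refl])
    fix k assume k: "k \<in> V"
    have "gram_vector i k * gram_vector j k
        = (sqrt ((1 + s) / - lam) * sqrt ((1 + s) / - lam)) * (G i k * G j k)"
      by (simp add: gram_vector_def s_def mult_ac)
    also have "G i k * G j k = (s * s - s * Q i k - s * Q k j + Q i k * Q k j) / (1 + s)\<^sup>2"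
    proof -
      have "(s - Q i k) * (s - Q k j) = s * s - s * Q i k - s * Q k j + Q i k * Q k j"
        by (simp add: algebra_simps)
      then show ?thesis
        using ij k by (simp add: G_def s_def[symmetric] sym[of j k] power2_eq_square)
    qed
    finally show "gram_vector i k * gram_vector j k
        = ((1 + s) / - lam / (1 + s)\<^sup>2) * (s * s - s * Q i k - s * Q k j + Q i k * Q k j)"
      unfolding sq by simp
  qed
  also have "\<dots> = ((1 + s) / - lam / (1 + s)\<^sup>2) * (n * (s * s) - s * eta - s * eta + (lam * Q i j + beta))"
    unfolding sum_distrib_left[symmetric] using ij
    by (simp add: sum.distrib sum_subtractf sum_distrib_left[symmetric] square row_sum column_sum)
  also have "n * (s * s) - s * eta - s * eta + (lam * Q i j + beta) = - lam * (s - Q i j)"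
    unfolding b using s(2) by (simp add: algebra_simps) 
  also have "((1 + s) / - lam / (1 + s)\<^sup>2) * (- lam * (s - Q i j)) = G i j"
  proof -
    have "(1 + s) / - lam / (1 + s)\<^sup>2 * (- lam) = 1 / (1 + s)"
      using s lam_neg by (simp add: power2_eq_square)
    then have "(1 + s) / - lam / (1 + s)\<^sup>2 * (- lam * (s - Q i j)) = 1 / (1 + s) * (s - Q i j)"
      by (metis mult.assoc)
    then show ?thesis by (simp add: G_def s_def)
  qed
  finally show ?thesis .
qed

lemma G_diag: "i \<in> V \<Longrightarrow> G i i = 1"
proof -
  have "1 + eta / n > 0" using eta_pos n_pos by (simp add: add_pos_pos)
  then show "i \<in> V \<Longrightarrow> G i i = 1" by (simp add: G_def diag add.commute)
qed

lemma G_mem_elliptope: "G \<in> elliptope V"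
proof -
  have "(\<lambda>i j. \<Sum>k\<in>V. gram_vector i k * gram_vector j k) \<in> elliptope V"
    by (rule gram_mem_elliptope) (simp add: gram_vector G_diag)
  moreover have "G \<in> elliptope V \<longleftrightarrow> (\<lambda>i j. \<Sum>k\<in>V. gram_vector i k * gram_vector j k) \<in> elliptope V"
    by (rule elliptope_cong) (simp add: gram_vector)
  ultimately show ?thesis by simp
qed

lemma SD_value_G: "SD_value V M G = n * (eta - lam) / 4"
proof -
  have s: "1 + eta / n > 0" using eta_pos n_pos by (simp add: add_pos_pos)
  have Q2: "(\<Sum>j\<in>V. Q i j * Q i j) = beta - lam" if "i \<in> V" for i
    using square[OF that that] diag[OF that] that sym by (simp cong: sum.cong)
  have "(\<Sum>j\<in>V. Q i j * G i j) = (eta / n * eta - (beta - lam)) / (1 + eta / n)" if "i \<in> V" for i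
  proof -
    have "(\<Sum>j\<in>V. Q i j * G i j) = (\<Sum>j\<in>V. eta / n * Q i j - Q i j * Q i j) / (1 + eta / n)"
      by (simp add: G_def sum_divide_distrib algebra_simps)
    then show ?thesis
      by (simp add: sum_subtractf sum_distrib_left[symmetric] Q2 that row_sum del: times_divide_eq_left)
  qed
  then have "(\<Sum>i\<in>V. \<Sum>j\<in>V. Q i j * G i j) = n * ((eta / n * eta - (beta - lam)) / (1 + eta / n))"
    by simp
  also have "\<dots> = n * (eta / n * eta - (beta - lam)) / (1 + eta / n)" by simp
  also have "n * (eta / n * eta - (beta - lam)) = eta * eta - beta * n + n * lam"
    using n_pos by (simp add: right_diff_distrib)
  also have "\<dots> = lam * n * (1 + eta / n)"
    unfolding beta_eq using n_pos by (simp add: distrib_left right_diff_distrib)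
  also have "lam * n * (1 + eta / n) / (1 + eta / n) = lam * n" using s by simp
  finally show ?thesis by (simp add: SD_value_eq G_diag algebra_simps)
qed

lemma SD_opt_eq: "SD_opt V M = n * (eta - lam) / 4"
  unfolding SD_opt_def SD_value_G[symmetric] using G_mem_elliptope SD_value_le
  by (intro cSup_eq_maximum) (auto simp: SD_value_G intro!: image_eqI[of _ _ G])

lemma sign_vector_mem_elliptope:
  assumes "\<And>i. i \<in> V \<Longrightarrow> x i * x i = (1::real)"
  shows "(\<lambda>i j. x i * x j) \<in> elliptope V"
  using gram_mem_elliptope[of V "\<lambda>i _. x i" "{()}"] assms by simp

lemma cut_weight_eq_SD_value:
  assumes "S \<subseteq> V"
  shows "cut_weight V M S = SD_value V M (\<lambda>i j. (if i \<in> S then 1 else -1) * (if j \<in> S then 1 else -1))"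
proof -
  let ?a = "\<Sum>i\<in>V. \<Sum>j\<in>V. M i j * of_bool (i \<in> S \<and> j \<notin> S)"
  let ?b = "\<Sum>i\<in>V. \<Sum>j\<in>V. M i j * of_bool (j \<in> S \<and> i \<notin> S)"
  have ab: "?a = ?b" by (subst sum.swap) (intro sum.cong HOL.refl, auto simp: sym)
  have "cut_weight V M S = (1/2) * (?a + ?b)"
    unfolding ab[symmetric] using assms finite_V by (simp add: cut_weight_indicator)
  also have "\<dots> = SD_value V M (\<lambda>i j. (if i \<in> S then 1 else -1) * (if j \<in> S then 1 else -1))"
    unfolding SD_value_def sum.distrib[symmetric]
    by (intro arg_cong[of _ _ "\<lambda>t. 1/2 * t"] HOL.refl sum.cong) auto
  finally show ?thesis .
qed

lemma max_cut_attained: obtains S where "S \<subseteq> V" "max_cut V M = cut_weight V M S"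
proof -
  have "max_cut V M \<in> cut_weight V M ` Pow V"
    unfolding max_cut_def using finite_V by (intro Max_in) auto
  then show ?thesis using that by auto
qed

lemma max_cut_le: "max_cut V M \<le> n * (eta - lam) / 4"
proof -
  obtain S where S: "S \<subseteq> V" "max_cut V M = cut_weight V M S" by (rule max_cut_attained)
  then show ?thesis
    using SD_value_le[OF sign_vector_mem_elliptope[of "\<lambda>i. if i \<in> S then 1 else -1"]]
    by (simp add: cut_weight_eq_SD_value)
qed

text \<open>
  For a sign vector \<open>x\<close> in the \<open>lam\<close>-eigenspace the matrix \<open>x x\<^sup>T\<close> attains the bound of
  \<open>elliptope_form_ge\<close>.
\<close>

lemma max_cut_eq_if_sign_eigenvector:
  assumes S: "S \<subseteq> V" and ev: "\<And>i. i \<in> V \<Longrightarrow>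
      (\<Sum>j\<in>V. Q i j * (if j \<in> S then 1 else -1)) = lam * (if i \<in> S then 1 else -1)"
  shows "max_cut V M = n * (eta - lam) / 4"
proof -
  let ?x = "\<lambda>i. if i \<in> S then 1 else -1 :: real"
  have "(\<Sum>i\<in>V. \<Sum>j\<in>V. Q i j * (?x i * ?x j)) = (\<Sum>i\<in>V. ?x i * (\<Sum>j\<in>V. Q i j * ?x j))"
    by (simp add: sum_distrib_left mult_ac)
  also have "\<dots> = (\<Sum>i\<in>V. lam)" by (intro sum.cong) (auto simp: ev)
  finally have "cut_weight V M S = n * (eta - lam) / 4"
    by (subst cut_weight_eq_SD_value[OF S], subst SD_value_eq) (auto simp: algebra_simps)
  then show ?thesis using cut_weight_le_max_cut[OF finite_V S, of M] max_cut_le by simp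
qed

lemma max_cut_ge_rounding:
  "(1/2) * (\<Sum>i\<in>V. \<Sum>j\<in>V. M i j * (arccos (G i j) / pi)) \<le> max_cut V M"
proof -
  have L: "lin V (gram_vector i) (gram_vector j) = G i j" if "i \<in> V" "j \<in> V" for i j
    using that by (simp add: lin_def gram_vector)
  have eq: "(\<Sum>i\<in>V. \<Sum>j\<in>V. M i j * (arccos (G i j) / pi))
      = (\<Sum>i\<in>V. \<Sum>j\<in>V. M i j * (arccos (lin V (gram_vector i) (gram_vector j)) / pi))"
    by (intro sum.cong HOL.refl) (simp only: L)
  show ?thesis unfolding eq
    by (rule hyperplane_rounding) (simp_all add: finite_V off_diag L G_diag)
qed

text \<open>
  Orthonormal vectors are pairwise at right angles, so that rounding them separates each pair with
  probability one half.
\<close>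

lemma max_cut_ge_half: "n * (1 + eta) / 4 \<le> max_cut V M"
proof -
  define e :: "'v \<Rightarrow> 'v \<Rightarrow> real" where "e i k = (if k = i then 1 else 0)" for i k
  have e: "lin V (e i) (e j) = (if i = j then 1 else 0)" if "i \<in> V" for i j
  proof -
    have "lin V (e i) (e j) = (\<Sum>k\<in>V. if k = i then (if i = j then 1 else 0) else 0)"
      unfolding lin_def by (intro sum.cong) (auto simp: e_def)
    then show ?thesis using that finite_V by simp
  qed
  have "(1/2) * (\<Sum>i\<in>V. \<Sum>j\<in>V. M i j * (arccos (lin V (e i) (e j)) / pi)) \<le> max_cut V M"
    by (rule hyperplane_rounding) (auto simp: finite_V off_diag e)
  also have "(\<Sum>i\<in>V. \<Sum>j\<in>V. M i j * (arccos (lin V (e i) (e j)) / pi)) = (\<Sum>i\<in>V. \<Sum>j\<in>V. M i j) / 2"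
    unfolding sum_divide_distrib by (intro sum.cong HOL.refl) (auto simp: e arccos_0)
  finally show ?thesis by (simp add: sum_M)
qed

lemma max_cut_integral:
  assumes "\<And>i j. i \<in> V \<Longrightarrow> j \<in> V \<Longrightarrow> Q i j \<in> \<int>"
  shows "max_cut V M \<in> \<int>"
proof -
  obtain S where S: "S \<subseteq> V" "max_cut V M = cut_weight V M S" by (rule max_cut_attained)
  then show ?thesis unfolding cut_weight_def using assms
    by (auto intro!: Ints_sum)
qed

end

section \<open>The Picard lattice and its reflections\<close>

abbreviation hyp_sum :: "nat \<Rightarrow> (pic_basis \<Rightarrow> 'r::comm_ring_1) \<Rightarrow> 'r" where
  "hyp_sum a D \<equiv> \<Sum>i = 1..a - 1. D (Hyp i)"

abbreviation exc_sum :: "nat \<Rightarrow> nat \<Rightarrow> (pic_basis \<Rightarrow> 'r::comm_ring_1) \<Rightarrow> 'r" where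
  "exc_sum b c D \<equiv> \<Sum>j = 1..b + c. D (Exc j)"

lemma pic_form_alt:
  "pic_form a b c D D' = (of_nat c - 1) * hyp_sum a D * hyp_sum a D'
     - (\<Sum>i = 1..a - 1. D (Hyp i) * D' (Hyp i)) - (\<Sum>j = 1..b + c. D (Exc j) * D' (Exc j))"
proof -
  have "(\<Sum>j = 1..a - 1. (of_nat c - 1 - (if i = j then 1 else 0)) * D (Hyp i) * D' (Hyp j))
      = (of_nat c - 1) * (D (Hyp i) * hyp_sum a D') - D (Hyp i) * D' (Hyp i)"
    if "i \<in> {1..a - 1}" for i
  proof -
    have "(\<Sum>j = 1..a - 1. (of_nat c - 1 - (if i = j then 1 else 0)) * D (Hyp i) * D' (Hyp j))
        = (\<Sum>j = 1..a - 1. (of_nat c - 1) * (D (Hyp i) * D' (Hyp j))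
            - (if j = i then D (Hyp i) * D' (Hyp i) else 0))"
      by (intro sum.cong) (auto simp: algebra_simps)
    then show ?thesis using that by (simp add: sum_subtractf sum_distrib_left)
  qed
  then have "(\<Sum>i = 1..a - 1. \<Sum>j = 1..a - 1. (of_nat c - 1 - (if i = j then 1 else 0)) * D (Hyp i) * D' (Hyp j))
      = (\<Sum>i = 1..a - 1. (of_nat c - 1) * (D (Hyp i) * hyp_sum a D') - D (Hyp i) * D' (Hyp i))"
    by (intro sum.cong) auto
  also have "\<dots> = (of_nat c - 1) * hyp_sum a D * hyp_sum a D' - (\<Sum>i = 1..a - 1. D (Hyp i) * D' (Hyp i))"
    by (simp add: sum_subtractf sum_distrib_left[symmetric] sum_distrib_right[symmetric] mult.assoc)
  finally show ?thesis unfolding pic_form_def by simp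
qed

lemma pic_form_commute: "pic_form a b c D D' = pic_form a b c D' D"
  by (simp add: pic_form_alt mult.commute mult.left_commute)

lemma pic_form_add_left:
  fixes D D' F :: "pic_basis \<Rightarrow> 'a::comm_ring_1"
  shows "pic_form a b c (\<lambda>x. D x + t * D' x) F = pic_form a b c D F + t * pic_form a b c D' F"
proof -
  have s: "(\<Sum>i\<in>I. (f i + t * g i) * h i) = (\<Sum>i\<in>I. f i * h i) + t * (\<Sum>i\<in>I. g i * h i)"
    for I :: "nat set" and f g h :: "nat \<Rightarrow> 'a"
    by (simp add: distrib_right sum.distrib sum_distrib_left mult.assoc)
  have "(\<Sum>i = 1..a - 1. D (Hyp i) + t * D' (Hyp i)) = hyp_sum a D + t * hyp_sum a D'"
    by (simp add: sum.distrib sum_distrib_left)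
  then show ?thesis unfolding pic_form_alt s by (simp add: algebra_simps)
qed

lemma pic_form_add_right:
  "pic_form a b c F (\<lambda>x. D x + t * D' x) = pic_form a b c F D + t * pic_form a b c F D'"
  unfolding pic_form_commute[of a b c F] by (rule pic_form_add_left)

lemma pic_form_scale_left: "pic_form a b c (\<lambda>x. t * D x) F = t * pic_form a b c D F"
  using pic_form_add_left[of a b c "\<lambda>_. 0" t D F] by (simp add: pic_form_alt)

lemma pic_form_scale_right: "pic_form a b c F (\<lambda>x. t * D x) = t * pic_form a b c F D"
  unfolding pic_form_commute[of a b c F] by (rule pic_form_scale_left)

lemma pic_form_of_int:
  "pic_form a b c (\<lambda>x. of_int (D x)) (\<lambda>x. of_int (D' x)) = of_int (pic_form a b c D D')"
  by (simp add: pic_form_alt)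

lemma pic_form_exc_right:
  assumes "1 \<le> j" "j \<le> b + c"
  shows "pic_form a b c D (exc_class j) = - D (Exc j)"
proof -
  have "(\<Sum>k = 1..b + c. D (Exc k) * exc_class j (Exc k)) = (\<Sum>k = 1..b + c. if k = j then D (Exc j) else 0)"
    by (intro sum.cong) (auto simp: exc_class_def)
  also have "\<dots> = D (Exc j)" using assms by simp
  finally show ?thesis by (simp add: pic_form_alt) (simp add: exc_class_def)
qed

lemma pic_form_hyp_right:
  assumes "1 \<le> i" "i \<le> a - 1"
  shows "pic_form a b c D (hyp_class i) = (int c - 1) * hyp_sum a D - D (Hyp i)"
proof -
  have "(\<Sum>k = 1..a - 1. D (Hyp k) * hyp_class i (Hyp k)) = (\<Sum>k = 1..a - 1. if k = i then D (Hyp i) else 0)"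
    by (intro sum.cong) (auto simp: hyp_class_def)
  also have "\<dots> = D (Hyp i)" using assms by simp
  finally have 1: "(\<Sum>k = 1..a - 1. D (Hyp k) * hyp_class i (Hyp k)) = D (Hyp i)" .
  have "hyp_sum a (hyp_class i) = (\<Sum>k = 1..a - 1. if k = i then 1 else 0)"
    by (intro sum.cong) (auto simp: hyp_class_def)
  then have 2: "hyp_sum a (hyp_class i) = 1" using assms by simp
  show ?thesis unfolding pic_form_alt 1 2 by (simp add: hyp_class_def)
qed

lemma pic_form_diff_right:
  "pic_form a b c F (D - D') = pic_form a b c F D - pic_form a b c F D'"
  using pic_form_add_right[of a b c F D "-1" D'] by (simp add: fun_diff_def)

lemma pic_form_sum_right:
  "finite I \<Longrightarrow> pic_form a b c F (\<Sum>i\<in>I. D i) = (\<Sum>i\<in>I. pic_form a b c F (D i))"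
proof (induction I rule: finite_induct)
  case empty
  show ?case by (simp add: pic_form_alt)
next
  case (insert i I)
  then show ?case using pic_form_add_right[of a b c F "D i" 1 "sum D I"] by (simp add: plus_fun_def)
qed

lemma simple_roots_cases:
  assumes "\<alpha> \<in> simple_roots a b c"
  obtains (exc) i where "1 \<le> i" "i \<le> b + c - 1" "\<alpha> = exc_class i - exc_class (i + 1)"
    | (mixed) "\<alpha> = hyp_class 1 - (\<Sum>j = 1..c. exc_class j)"
    | (hyp) i where "1 \<le> i" "i \<le> a - 2" "\<alpha> = hyp_class (i + 1) - hyp_class i"
  using assms unfolding simple_roots_def by blast

lemma pic_form_simple_root:
  shows "1 \<le> i \<Longrightarrow> i \<le> b + c - 1 \<Longrightarrow>
      pic_form a b c D (exc_class i - exc_class (i + 1)) = D (Exc (i + 1)) - D (Exc i)"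
    and "2 \<le> a \<Longrightarrow> pic_form a b c D (hyp_class 1 - (\<Sum>j = 1..c. exc_class j))
      = (int c - 1) * hyp_sum a D - D (Hyp 1) + (\<Sum>j = 1..c. D (Exc j))"
    and "1 \<le> i \<Longrightarrow> i \<le> a - 2 \<Longrightarrow>
      pic_form a b c D (hyp_class (i + 1) - hyp_class i) = D (Hyp i) - D (Hyp (i + 1))"
  by (auto simp: pic_form_diff_right pic_form_exc_right pic_form_hyp_right pic_form_sum_right sum_negf)

lemma sum_fun_apply: "(\<Sum>i\<in>I. f i) x = (\<Sum>i\<in>I. f i x)" for f :: "'i \<Rightarrow> 'x \<Rightarrow> 'r::comm_monoid_add"
  by (induction I rule: infinite_finite_induct) auto

lemma sum_exc_class_apply: "(\<Sum>j = Suc 0..m. exc_class j) x = (case x of Hyp i \<Rightarrow> 0 | Exc j \<Rightarrow> if 1 \<le> j \<and> j \<le> m then 1 else 0)"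
  by (cases x) (simp_all add: sum_fun_apply exc_class_def)

lemma simple_root_self:
  assumes "2 \<le> a" "\<alpha> \<in> simple_roots a b c"
  shows "pic_form a b c \<alpha> \<alpha> = -2"
  using assms(2)
proof (cases rule: simple_roots_cases)
  case (exc i)
  have "pic_form a b c \<alpha> \<alpha> = \<alpha> (Exc (i + 1)) - \<alpha> (Exc i)"
    using pic_form_simple_root(1)[OF exc(1,2)] by (simp add: exc(3))
  then show ?thesis by (simp add: exc(3)) (simp add: exc_class_def)
next
  case mixed
  have "hyp_sum a \<alpha> = (\<Sum>i = 1..a - 1. if i = 1 then 1 else 0)"
    unfolding mixed by (intro sum.cong) (auto simp: sum_exc_class_apply hyp_class_def)
  also have "\<dots> = 1" using assms(1) by simp
  finally have h: "hyp_sum a \<alpha> = 1" .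
  have "(\<Sum>j = 1..c. \<alpha> (Exc j)) = (\<Sum>j = 1..c. -1)"
    unfolding mixed by (intro sum.cong) (auto simp: sum_exc_class_apply hyp_class_def)
  then have e: "(\<Sum>j = 1..c. \<alpha> (Exc j)) = - int c" by simp
  have "pic_form a b c \<alpha> \<alpha> = (int c - 1) * hyp_sum a \<alpha> - \<alpha> (Hyp 1) + (\<Sum>j = 1..c. \<alpha> (Exc j))"
    using pic_form_simple_root(2)[OF assms(1)] by (simp add: mixed)
  also have "\<alpha> (Hyp 1) = 1" by (simp add: mixed sum_exc_class_apply) (simp add: hyp_class_def)
  finally show ?thesis unfolding h e by simp
next
  case (hyp i)
  have "pic_form a b c \<alpha> \<alpha> = \<alpha> (Hyp i) - \<alpha> (Hyp (i + 1))"
    using pic_form_simple_root(3)[OF hyp(1,2)] by (simp add: hyp(3))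
  then show ?thesis by (simp add: hyp(3)) (simp add: hyp_class_def)
qed

lemma pic_form_reflection:
  assumes "2 \<le> a" "\<alpha> \<in> simple_roots a b c"
  shows "pic_form a b c (reflection a b c \<alpha> D) (reflection a b c \<alpha> D') = pic_form a b c D D'"
  unfolding reflection_def pic_form_add_left pic_form_add_right
  using simple_root_self[OF assms] by (simp add: pic_form_commute[of a b c \<alpha> D'])

text \<open>
  The linear functional proportional to the pairing with \<open>K\<close> (see \<open>pic_form_canonical\<close>), normalized
  to be one on the exceptional classes. It vanishes on the simple roots, hence is invariant under the
  Weyl group.
\<close>

definition anticanonical_degree :: "nat \<Rightarrow> nat \<Rightarrow> nat \<Rightarrow> (pic_basis \<Rightarrow> int) \<Rightarrow> int" where
  "anticanonical_degree a b c D = int c * hyp_sum a D + exc_sum b c D"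

lemma canonical_class_apply:
  "canonical_class a b c (Hyp i) = (if 1 \<le> i \<and> i \<le> a - 1 then - int c else 0)"
  "canonical_class a b c (Exc j) = (if 1 \<le> j \<and> j \<le> b + c then int a * int c - int a - int c else 0)"
  by (simp_all add: canonical_class_def hyp_class_def exc_class_def)

lemma pic_form_canonical:
  assumes "1 \<le> a"
  shows "pic_form a b c D (canonical_class a b c) = - (int a * int c - int a - int c) * anticanonical_degree a b c D"
proof -
  have h: "hyp_sum a (canonical_class a b c) = - (int c * (int a - 1))"
    using assms by (simp add: canonical_class_apply of_nat_diff)
  have hh: "(\<Sum>i = 1..a - 1. D (Hyp i) * canonical_class a b c (Hyp i)) = - int c * hyp_sum a D"
    by (simp add: canonical_class_apply sum_distrib_left[symmetric] mult.commute sum_negf)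
  have ee: "(\<Sum>j = 1..b + c. D (Exc j) * canonical_class a b c (Exc j)) = (int a * int c - int a - int c) * exc_sum b c D"
    by (simp add: canonical_class_apply sum_distrib_right[symmetric] mult.commute)
  show ?thesis unfolding pic_form_alt h hh ee anticanonical_degree_def by (simp add: algebra_simps)
qed

lemma canonical_self:
  assumes "1 \<le> a"
  shows "pic_form a b c (canonical_class a b c) (canonical_class a b c)
     = (int b * int c + int a * int c + int a * int b - int a * int b * int c) * (int a * int c - int a - int c)"
proof -
  have "anticanonical_degree a b c (canonical_class a b c)
      = - (int c * (int c * (int a - 1))) + (int b + int c) * (int a * int c - int a - int c)"
    using assms unfolding anticanonical_degree_def by (simp add: canonical_class_apply of_nat_diff)
  also have "\<dots> = - (int b * int c + int a * int c + int a * int b - int a * int b * int c)"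
    by (simp add: algebra_simps)
  finally show ?thesis
    using pic_form_canonical[OF assms, of b c "canonical_class a b c"] by (simp only: minus_mult_minus mult.commute)
qed

lemma anticanonical_degree_reflection:
  assumes "2 \<le> a" "\<alpha> \<in> simple_roots a b c"
  shows "anticanonical_degree a b c (reflection a b c \<alpha> D) = anticanonical_degree a b c D"
proof -
  have "anticanonical_degree a b c \<alpha> = 0"
    using assms(2)
  proof (cases rule: simple_roots_cases)
    case (exc i)
    have "exc_sum b c \<alpha> = (\<Sum>j = 1..b + c. (if j = i then 1 else 0) - (if j = i + 1 then 1 else 0))"
      unfolding exc by (intro sum.cong) (auto simp: exc_class_def)
    also have "\<dots> = 0" using exc by (simp add: sum_subtractf)
    finally show ?thesis by (simp add: anticanonical_degree_def) (simp add: exc exc_class_def)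
  next
    case mixed
    have "exc_sum b c \<alpha> = (\<Sum>j = 1..b + c. if j \<in> {1..c} then -1 else 0)"
      unfolding mixed by (intro sum.cong) (auto simp: sum_exc_class_apply hyp_class_def)
    also have "\<dots> = (\<Sum>j \<in> {1..b + c} \<inter> {1..c}. -1)" by (subst sum.inter_restrict) auto
    also have "\<dots> = - int c" by (simp add: Int_absorb1 min_def)
    finally have e: "exc_sum b c \<alpha> = - int c" .
    have "hyp_sum a \<alpha> = (\<Sum>i = 1..a - 1. if i = 1 then 1 else 0)"
      unfolding mixed by (intro sum.cong) (auto simp: sum_exc_class_apply hyp_class_def)
    also have "\<dots> = 1" using assms(1) by simp
    finally show ?thesis unfolding anticanonical_degree_def e by simp
  next
    case (hyp i)
    have "hyp_sum a \<alpha> = (\<Sum>j = 1..a - 1. (if j = i + 1 then 1 else 0) - (if j = i then 1 else 0))"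
      unfolding hyp by (intro sum.cong) (auto simp: hyp_class_def)
    also have "\<dots> = 0" using hyp by (simp add: sum_subtractf)
    finally show ?thesis by (simp add: anticanonical_degree_def) (simp add: hyp hyp_class_def)
  qed
  moreover have "anticanonical_degree a b c (reflection a b c \<alpha> D)
      = anticanonical_degree a b c D + pic_form a b c D \<alpha> * anticanonical_degree a b c \<alpha>"
    by (simp add: anticanonical_degree_def reflection_def sum.distrib sum_distrib_left algebra_simps)
  ultimately show ?thesis by simp
qed

lemma exc_class_mem_minus_one_divisors: "exc_class (b + c) \<in> minus_one_divisors a b c"
  unfolding minus_one_divisors_def using weyl_group.id by (intro image_eqI[of _ _ id]) auto

lemma reflection_mem_minus_one_divisors:
  assumes "\<alpha> \<in> simple_roots a b c" "D \<in> minus_one_divisors a b c"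
  shows "reflection a b c \<alpha> D \<in> minus_one_divisors a b c"
proof -
  obtain w where "w \<in> weyl_group a b c" "D = w (exc_class (b + c))"
    using assms(2) by (auto simp: minus_one_divisors_def)
  then show ?thesis unfolding minus_one_divisors_def
    using weyl_group.refl[OF assms(1)] by (intro image_eqI[of _ _ "reflection a b c \<alpha> \<circ> w"]) auto
qed

lemma minus_one_divisors_induct [consumes 1, case_names exc reflection]:
  assumes "D \<in> minus_one_divisors a b c"
    and "P (exc_class (b + c))"
    and "\<And>\<alpha> D. \<alpha> \<in> simple_roots a b c \<Longrightarrow> D \<in> minus_one_divisors a b c \<Longrightarrow> P D \<Longrightarrow> P (reflection a b c \<alpha> D)"
  shows "P D"
proof -
  have "P (w (exc_class (b + c))) \<and> w (exc_class (b + c)) \<in> minus_one_divisors a b c"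
    if "w \<in> weyl_group a b c" for w
    using that
    by (induction rule: weyl_group.induct)
      (auto intro: assms(2,3) exc_class_mem_minus_one_divisors reflection_mem_minus_one_divisors)
  then show ?thesis using assms(1) by (auto simp: minus_one_divisors_def)
qed

lemma minus_one_divisor_self:
  assumes "2 \<le> a" "1 \<le> b + c" "D \<in> minus_one_divisors a b c"
  shows "pic_form a b c D D = -1"
  using assms(3)
proof (induction rule: minus_one_divisors_induct)
  case exc
  show ?case using assms(2) by (simp add: pic_form_exc_right) (simp add: exc_class_def)
next
  case (reflection \<alpha> D)
  then show ?case using assms(1) by (simp add: pic_form_reflection)
qed

lemma minus_one_divisor_degree:
  assumes "2 \<le> a" "1 \<le> b + c" "D \<in> minus_one_divisors a b c"
  shows "anticanonical_degree a b c D = 1"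
  using assms(3)
proof (induction rule: minus_one_divisors_induct)
  case exc
  show ?case using assms(2) by (simp add: anticanonical_degree_def exc_class_def)
next
  case (reflection \<alpha> D)
  then show ?case using assms(1) by (simp add: anticanonical_degree_reflection)
qed

lemma pic_form_minus_one_divisor_canonical:
  assumes "2 \<le> a" "1 \<le> b + c" "D \<in> minus_one_divisors a b c"
  shows "pic_form a b c D (canonical_class a b c) = - (int a * int c - int a - int c)"
  using assms by (simp add: pic_form_canonical minus_one_divisor_degree)

abbreviation real_form :: "nat \<Rightarrow> nat \<Rightarrow> nat \<Rightarrow> (pic_basis \<Rightarrow> int) \<Rightarrow> (pic_basis \<Rightarrow> int) \<Rightarrow> real" where
  "real_form a b c U V \<equiv> real_of_int (pic_form a b c U V)"

lemma divisor_mult_eq: "divisor_mult a b c = (\<lambda>U V. if U = V then 0 else real_form a b c U V)"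
  by (simp add: divisor_mult_def fun_eq_iff)

context
  fixes a b c :: nat and \<kappa> \<delta> :: real
  assumes a: "2 \<le> a" and r: "1 \<le> b + c"
  defines "\<kappa> \<equiv> real a * real c - real a - real c" and "\<delta> \<equiv> proj_delta a b c"
  assumes \<delta>: "0 < \<delta>" and \<kappa>: "0 \<le> \<kappa>"
begin

lemma real_form_canonical:
  assumes "D \<in> minus_one_divisors a b c"
  shows "real_form a b c D (canonical_class a b c) = - \<kappa>"
  using pic_form_minus_one_divisor_canonical[OF a r assms] by (simp add: \<kappa>_def)

lemma real_form_canonical_self: "real_form a b c (canonical_class a b c) (canonical_class a b c) = \<delta> * \<kappa>"
  using a by (simp add: canonical_self \<kappa>_def \<delta>_def proj_delta_def)

lemma normalized_projection_orthogonal: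
  assumes "D \<in> minus_one_divisors a b c"
  shows "pic_form a b c (normalized_projection a b c D) (\<lambda>x. real_of_int (canonical_class a b c x)) = 0"
  unfolding normalized_projection_def pic_form_scale_left pic_form_add_left pic_form_of_int
  using \<delta> by (simp add: real_form_canonical assms real_form_canonical_self flip: \<delta>_def)

text \<open>
  Expand the form bilinearly, with \<open>K \<cdot> V = - \<kappa>\<close> for every (-1)-divisor and \<open>K \<cdot> K = \<delta> \<kappa>\<close>.
\<close>

lemma projection_gram_eq:
  assumes "U \<in> minus_one_divisors a b c" "V \<in> minus_one_divisors a b c"
  shows "projection_gram a b c U V = (\<kappa> / \<delta> - real_form a b c U V) / (1 + \<kappa> / \<delta>)"
proof -
  define s where "s = (1 + \<kappa> / \<delta>) powr (- 1 / 2)"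
  have p: "0 < 1 + \<kappa> / \<delta>" using \<kappa> \<delta> by (simp add: add_pos_nonneg)
  have ss: "s * s = 1 / (1 + \<kappa> / \<delta>)"
    using p unfolding s_def by (simp add: powr_add[symmetric] powr_minus_divide)
  have "projection_gram a b c U V = - (s * (s * (real_form a b c U V + 1 / \<delta> * - \<kappa> + 1 / \<delta> * (- \<kappa> + 1 / \<delta> * (\<delta> * \<kappa>)))))"
    unfolding projection_gram_def normalized_projection_def pic_form_scale_left pic_form_scale_right
      pic_form_add_left pic_form_add_right pic_form_of_int
    using pic_form_commute[of a b c "canonical_class a b c" V]
    by (simp add: real_form_canonical assms real_form_canonical_self s_def \<kappa>_def[symmetric] \<delta>_def[symmetric])
  also have "\<dots> = (s * s) * (\<kappa> / \<delta> - real_form a b c U V)"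
    using \<delta> by (simp add: algebra_simps)
  finally show ?thesis by (simp add: ss)
qed

end

section \<open>Subsets of a fixed size\<close>

definition ksubsets :: "'x set \<Rightarrow> nat \<Rightarrow> 'x set set" where
  "ksubsets A k = {W. W \<subseteq> A \<and> card W = k}"

lemma finite_ksubsets: "finite A \<Longrightarrow> finite (ksubsets A k)"
  unfolding ksubsets_def by (rule finite_subset[of _ "Pow A"]) auto

lemma card_ksubsets: "finite A \<Longrightarrow> card (ksubsets A k) = card A choose k"
  unfolding ksubsets_def by (rule n_subsets)

text \<open>
  Such a \<open>W\<close> is a \<open>j\<close>-subset of \<open>U\<close> together with a \<open>(k - j)\<close>-subset of the complement.
\<close>

lemma card_ksubsets_split:
  assumes A: "finite A" and U: "U \<subseteq> A"
  shows "card {W \<in> ksubsets A k. card (U \<inter> W) = j} = (if j \<le> k then (card U choose j) * (card (A - U) choose (k - j)) else 0)"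
proof (cases "j \<le> k")
  case True
  have fin: "finite U" "finite (A - U)" using A U finite_subset by auto
  have "bij_betw (\<lambda>(X, Y). X \<union> Y) (ksubsets U j \<times> ksubsets (A - U) (k - j)) {W \<in> ksubsets A k. card (U \<inter> W) = j}"
  proof (rule bij_betw_byWitness[where f' = "\<lambda>W. (U \<inter> W, W - U)"])
    show "\<forall>p\<in>ksubsets U j \<times> ksubsets (A - U) (k - j). (\<lambda>W. (U \<inter> W, W - U)) (case p of (X, Y) \<Rightarrow> X \<union> Y) = p"
      by (auto simp: ksubsets_def)
    show "\<forall>W\<in>{W \<in> ksubsets A k. card (U \<inter> W) = j}. (case (U \<inter> W, W - U) of (X, Y) \<Rightarrow> X \<union> Y) = W"
      by auto
    show "(\<lambda>(X, Y). X \<union> Y) ` (ksubsets U j \<times> ksubsets (A - U) (k - j)) \<subseteq> {W \<in> ksubsets A k. card (U \<inter> W) = j}"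
    proof clarify
      fix X Y assume "X \<in> ksubsets U j" "Y \<in> ksubsets (A - U) (k - j)"
      then have XY: "X \<subseteq> U" "Y \<subseteq> A - U" "card X = j" "card Y = k - j" by (auto simp: ksubsets_def)
      then have "finite X" "finite Y" using fin by (blast intro: finite_subset)+
      moreover have "X \<inter> Y = {}" "U \<inter> (X \<union> Y) = X" using XY by auto
      ultimately show "X \<union> Y \<in> ksubsets A k \<and> card (U \<inter> (X \<union> Y)) = j"
        using XY U True by (auto simp: ksubsets_def card_Un_disjoint)
    qed
    show "(\<lambda>W. (U \<inter> W, W - U)) ` {W \<in> ksubsets A k. card (U \<inter> W) = j} \<subseteq> ksubsets U j \<times> ksubsets (A - U) (k - j)"
    proof (rule image_subsetI)
      fix W assume "W \<in> {W \<in> ksubsets A k. card (U \<inter> W) = j}"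
      then have W: "W \<in> ksubsets A k" "j = card (U \<inter> W)" by auto
      then have "finite W" using A finite_subset by (auto simp: ksubsets_def)
      then have "card (W - U) = card W - card (U \<inter> W)"
        by (metis Diff_Int_distrib2 Int_commute card_Diff_subset_Int finite_Int)
      then show "(U \<inter> W, W - U) \<in> ksubsets U j \<times> ksubsets (A - U) (k - j)"
        using W by (auto simp: ksubsets_def)
    qed
  qed
  then have "card {W \<in> ksubsets A k. card (U \<inter> W) = j} = card (ksubsets U j \<times> ksubsets (A - U) (k - j))"
    by (simp add: bij_betw_same_card)
  then show ?thesis using True fin by (simp add: card_cartesian_product card_ksubsets)
next
  case False
  have "card (U \<inter> W) \<le> k" if "W \<in> ksubsets A k" for W
    using that A finite_subset card_mono[of W "U \<inter> W"] by (auto simp: ksubsets_def)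
  then have e: "{W \<in> ksubsets A k. card (U \<inter> W) = j} = {}" using False by auto
  show ?thesis unfolding e using False by simp
qed

lemma sum_ksubsets_by_overlap:
  fixes F :: "nat \<Rightarrow> real"
  assumes A: "finite A" and U: "U \<subseteq> A"
  shows "(\<Sum>W\<in>ksubsets A k. F (card (U \<inter> W)))
      = (\<Sum>j\<le>k. real (card U choose j) * real (card (A - U) choose (k - j)) * F j)"
proof -
  have sub: "(\<lambda>W. card (U \<inter> W)) ` ksubsets A k \<subseteq> {..k}"
    using A finite_subset by (fastforce simp: ksubsets_def intro!: card_mono)
  have "(\<Sum>W\<in>ksubsets A k. F (card (U \<inter> W)))
      = (\<Sum>j\<le>k. \<Sum>W\<in>{W \<in> ksubsets A k. card (U \<inter> W) = j}. F (card (U \<inter> W)))"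
    by (rule sum.group[symmetric]) (use A sub in \<open>auto simp: finite_ksubsets\<close>)
  also have "\<dots> = (\<Sum>j\<le>k. real (card {W \<in> ksubsets A k. card (U \<inter> W) = j}) * F j)"
    by (intro sum.cong HOL.refl) simp
  also have "\<dots> = (\<Sum>j\<le>k. real (card U choose j) * real (card (A - U) choose (k - j)) * F j)"
    by (intro sum.cong HOL.refl) (simp add: card_ksubsets_split[OF A U])
  finally show ?thesis .
qed

lemma card_ksubsets_containing:
  assumes A: "finite A" and U: "U \<subseteq> A" and k: "card U \<le> k"
  shows "card {W \<in> ksubsets A k. U \<subseteq> W} = (card A - card U) choose (k - card U)"
proof -
  have fU: "finite U" using A U finite_subset by auto
  have "{W \<in> ksubsets A k. U \<subseteq> W} = {W \<in> ksubsets A k. card (U \<inter> W) = card U}"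
    using fU by (auto simp: Int_absorb2 card_subset_eq) (metis Int_lower1 card_subset_eq inf.absorb_iff2 in_mono inf_commute)
  then show ?thesis using card_ksubsets_split[OF A U, of k "card U"] k card_Diff_subset[OF fU U] by simp
qed

lemma real_card_Int: "finite U \<Longrightarrow> real (card (U \<inter> W)) = (\<Sum>x\<in>U. of_bool (x \<in> W))"
  by (simp add: sum.inter_filter[symmetric] of_bool_def card_eq_sum Int_def del: sum_constant flip: sum.inter_restrict)

lemma sum_ksubsets_point:
  assumes "finite A" "x \<in> A" "1 \<le> k"
  shows "(\<Sum>W\<in>ksubsets A k. of_bool (x \<in> W) :: real) = real ((card A - 1) choose (k - 1))"
proof -
  have "(\<Sum>W\<in>ksubsets A k. of_bool (x \<in> W) :: real) = real (card {W \<in> ksubsets A k. {x} \<subseteq> W})"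
    using assms(1) by (simp add: finite_ksubsets of_bool_def sum.If_cases Int_def)
  then show ?thesis using card_ksubsets_containing[of A "{x}" k] assms by simp
qed

lemma sum_ksubsets_pair:
  assumes "finite A" "x \<in> A" "y \<in> A" "x \<noteq> y" "2 \<le> k"
  shows "(\<Sum>W\<in>ksubsets A k. of_bool (x \<in> W) * of_bool (y \<in> W) :: real) = real ((card A - 2) choose (k - 2))"
proof -
  have "(\<Sum>W\<in>ksubsets A k. of_bool (x \<in> W) * of_bool (y \<in> W) :: real)
      = (\<Sum>W\<in>ksubsets A k. of_bool ({x, y} \<subseteq> W))"
    by (intro sum.cong) auto
  also have "\<dots> = real (card {W \<in> ksubsets A k. {x, y} \<subseteq> W})"
    using assms(1) by (simp add: finite_ksubsets of_bool_def sum.If_cases Int_def)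
  finally show ?thesis using card_ksubsets_containing[of A "{x, y}" k] assms by (simp add: numeral_2_eq_2)
qed

lemma sum_ksubsets_overlap:
  assumes "finite A" "U \<subseteq> A" "1 \<le> k"
  shows "(\<Sum>W\<in>ksubsets A k. real (card (U \<inter> W))) = real (card U) * real ((card A - 1) choose (k - 1))"
proof -
  have fU: "finite U" using assms finite_subset by auto
  have "(\<Sum>W\<in>ksubsets A k. real (card (U \<inter> W))) = (\<Sum>x\<in>U. \<Sum>W\<in>ksubsets A k. of_bool (x \<in> W))"
    unfolding real_card_Int[OF fU] by (rule sum.swap)
  also have "\<dots> = (\<Sum>x\<in>U. real ((card A - 1) choose (k - 1)))"
    using assms by (intro sum.cong HOL.refl sum_ksubsets_point) auto
  finally show ?thesis by simp
qed

lemma sum_ksubsets_point_overlap: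
  assumes "finite A" "U \<subseteq> A" "x \<in> A" "2 \<le> k"
  shows "(\<Sum>W\<in>ksubsets A k. of_bool (x \<in> W) * real (card (U \<inter> W)))
    = of_bool (x \<in> U) * (real ((card A - 1) choose (k - 1)) - real ((card A - 2) choose (k - 2)))
      + real (card U) * real ((card A - 2) choose (k - 2))" (is "?L = of_bool _ * (?C1 - ?C2) + _")
proof -
  have fU: "finite U" using assms finite_subset by auto
  have "?L = (\<Sum>W\<in>ksubsets A k. \<Sum>y\<in>U. of_bool (x \<in> W) * of_bool (y \<in> W))"
    unfolding real_card_Int[OF fU] by (simp only: sum_distrib_left)
  also have "\<dots> = (\<Sum>y\<in>U. \<Sum>W\<in>ksubsets A k. of_bool (x \<in> W) * of_bool (y \<in> W))"
    by (rule sum.swap)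
  also have "\<dots> = (\<Sum>y\<in>U. ?C2 + (if y = x then ?C1 - ?C2 else 0))"
  proof (intro sum.cong HOL.refl)
    fix y assume y: "y \<in> U"
    show "(\<Sum>W\<in>ksubsets A k. of_bool (x \<in> W) * of_bool (y \<in> W) :: real) = ?C2 + (if y = x then ?C1 - ?C2 else 0)"
    proof (cases "y = x")
      case True
      have "(\<Sum>W\<in>ksubsets A k. of_bool (x \<in> W) * of_bool (y \<in> W) :: real) = (\<Sum>W\<in>ksubsets A k. of_bool (x \<in> W))"
        by (intro sum.cong) (auto simp: True)
      then show ?thesis using sum_ksubsets_point[of A x k] assms True by simp
    next
      case False
      then show ?thesis using sum_ksubsets_pair[of A x y k] assms y by auto
    qed
  qed
  finally show ?thesis using fU by (simp add: sum.distrib)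
qed

lemma sum_ksubsets_overlap_overlap:
  assumes "finite A" "U \<subseteq> A" "U' \<subseteq> A" "2 \<le> k"
  shows "(\<Sum>W\<in>ksubsets A k. real (card (U \<inter> W)) * real (card (U' \<inter> W)))
    = real (card (U \<inter> U')) * (real ((card A - 1) choose (k - 1)) - real ((card A - 2) choose (k - 2)))
      + real (card U) * real (card U') * real ((card A - 2) choose (k - 2))" (is "?L = _ * (?C1 - ?C2) + _")
proof -
  have fU: "finite U" using assms finite_subset by auto
  have "?L = (\<Sum>W\<in>ksubsets A k. \<Sum>x\<in>U. of_bool (x \<in> W) * real (card (U' \<inter> W)))"
    unfolding real_card_Int[OF fU] by (simp only: sum_distrib_right)
  also have "\<dots> = (\<Sum>x\<in>U. \<Sum>W\<in>ksubsets A k. of_bool (x \<in> W) * real (card (U' \<inter> W)))"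
    by (rule sum.swap)
  also have "\<dots> = (\<Sum>x\<in>U. of_bool (x \<in> U') * (?C1 - ?C2) + real (card U') * ?C2)"
    using assms by (intro sum.cong HOL.refl sum_ksubsets_point_overlap) auto
  also have "\<dots> = (\<Sum>x\<in>U. of_bool (x \<in> U')) * (?C1 - ?C2) + real (card U) * (real (card U') * ?C2)"
    by (simp only: sum.distrib sum_distrib_right sum_constant)
  also have "(\<Sum>x\<in>U. of_bool (x \<in> U') :: real) = real (card (U \<inter> U'))"
    by (rule real_card_Int[OF fU, symmetric])
  finally show ?thesis by simp
qed

text \<open>
  This is the end of the descent by adjacent transpositions: as long as \<open>U\<close> is not the final segment
  of its size, some element can be moved up by one.
\<close>

lemma upper_segment_unless_shiftable:
  assumes "U \<subseteq> {1..N}" "\<And>i. i \<in> U \<Longrightarrow> i < N \<Longrightarrow> i + 1 \<in> U"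
  shows "U = {N + 1 - card U..N}"
proof (cases "U = {}")
  case False
  have fU: "finite U" using assms(1) finite_subset by auto
  define m where "m = Min U"
  have m: "m \<in> U" "\<And>x. x \<in> U \<Longrightarrow> m \<le> x" using fU False by (auto simp: m_def)
  have up: "m + d \<in> U" if "m + d \<le> N" for d
    using that
  proof (induction d)
    case (Suc d)
    then show ?case using assms(2)[of "m + d"] by simp
  qed (use m in simp)
  have "x \<in> U" if "m \<le> x" "x \<le> N" for x using up[of "x - m"] that by simp
  then have "U = {m..N}" using m assms(1) by auto
  moreover have "m \<le> N" "1 \<le> m" using m assms(1) by auto
  ultimately show ?thesis by auto
qed simp

definition shift :: "nat \<Rightarrow> nat set \<Rightarrow> nat set" where
  "shift i U = Transposition.transpose i (i + 1) ` U"

lemma mem_shift: "x \<in> shift i U \<longleftrightarrow> (if x = i then i + 1 \<in> U else if x = i + 1 then i \<in> U else x \<in> U)"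
proof -
  have "x \<in> shift i U \<longleftrightarrow> Transposition.transpose i (i + 1) x \<in> U"
  proof
    assume "x \<in> shift i U"
    then show "Transposition.transpose i (i + 1) x \<in> U" by (auto simp: shift_def)
  next
    assume "Transposition.transpose i (i + 1) x \<in> U"
    then have "Transposition.transpose i (i + 1) (Transposition.transpose i (i + 1) x) \<in> shift i U"
      unfolding shift_def by (rule imageI)
    then show "x \<in> shift i U" by simp
  qed
  then show ?thesis by (simp add: Transposition.transpose_def)
qed

lemma card_shift: "card (shift i U) = card U"
  unfolding shift_def by (intro card_image) simp

lemma shift_shift: "shift i (shift i U) = U"
  by (auto simp: mem_shift split: if_splits)

lemma shift_subset: "U \<subseteq> {1..N} \<Longrightarrow> 1 \<le> i \<Longrightarrow> i < N \<Longrightarrow> shift i U \<subseteq> {1..N}"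
  by (auto simp: subset_iff mem_shift split: if_splits)

lemma sum_shift_less:
  assumes U: "U \<subseteq> {1..N}" and i: "i \<in> U" "i < N" "i + 1 \<notin> U"
  shows "(\<Sum>x\<in>shift i U. N + 1 - x) < (\<Sum>x\<in>U. N + 1 - x)"
proof -
  have fin: "finite U" using U finite_subset by auto
  have sh: "shift i U = insert (i + 1) (U - {i})" using i by (auto simp: mem_shift split: if_splits)
  have "(\<Sum>x\<in>shift i U. N + 1 - x) = (N + 1 - (i + 1)) + (\<Sum>x\<in>U - {i}. N + 1 - x)"
    unfolding sh using i fin by (intro sum.insert) auto
  also have "\<dots> < (N + 1 - i) + (\<Sum>x\<in>U - {i}. N + 1 - x)" using i by simp
  also have "\<dots> = (\<Sum>x\<in>U. N + 1 - x)" using fin i by (simp add: sum.remove)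
  finally show ?thesis .
qed

section \<open>Type A: subsets and transpositions\<close>

text \<open>
  The diagram \<open>T\<close> with arms \<open>s + 1\<close>, \<open>1\<close>, \<open>c\<close>. There are \<open>r\<close> exceptional and \<open>s\<close> hyperplane classes,
  numbered together as \<open>N\<close> points: \<open>j \<le> r\<close> stands for \<open>E\<^sub>j\<close> and \<open>r + i\<close> for \<open>H\<^sub>i\<close>. The equations for
  \<open>r\<close> and \<open>N\<close> are hypotheses so that both can be treated as atoms.
\<close>

locale type_A =
  fixes s c r N :: nat
  assumes c: "3 \<le> c" and s: "1 \<le> s" "s < c" and r: "r = 1 + c" and N: "N = r + s"
begin

abbreviation points :: "nat set" where "points \<equiv> {1..N}"
abbreviation verts :: "nat set set" where "verts \<equiv> ksubsets points (s + 1)"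
abbreviation mods :: "(pic_basis \<Rightarrow> int) set" where "mods \<equiv> minus_one_divisors (s + 1) 1 c"

text \<open>
  The number of hyperplane classes occurring in the divisor of \<open>U\<close>; they are the \<open>H\<^sub>i\<close> with
  \<open>r + i\<close> outside \<open>U\<close>.
\<close>

definition twist :: "nat set \<Rightarrow> int" where
  "twist U = (\<Sum>i = 1..s. 1 - of_bool (r + i \<in> U))"

definition divisor :: "nat set \<Rightarrow> pic_basis \<Rightarrow> int" where
  "divisor U x = (case x of
      Hyp i \<Rightarrow> if 1 \<le> i \<and> i \<le> s then 1 - of_bool (r + i \<in> U) else 0
    | Exc j \<Rightarrow> if 1 \<le> j \<and> j \<le> r then of_bool (j \<in> U) - twist U else 0)"

lemma sum_points: "(\<Sum>x\<in>points. f x) = (\<Sum>j = 1..r. f j) + (\<Sum>i = 1..s. f (r + i))"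
  for f :: "nat \<Rightarrow> int"
proof -
  have "points = {1..r} \<union> (\<lambda>i. r + i) ` {1..s}"
  proof (intro set_eqI iffI)
    fix x assume "x \<in> points"
    then show "x \<in> {1..r} \<union> (\<lambda>i. r + i) ` {1..s}"
      by (cases "x \<le> r") (auto simp: N intro!: image_eqI[of _ _ "x - r"])
  qed (auto simp: N r)
  then have "(\<Sum>x\<in>points. f x) = (\<Sum>j = 1..r. f j) + sum f ((\<lambda>i. r + i) ` {1..s})"
    by (simp only:) (rule sum.union_disjoint, auto)
  moreover have "sum f ((\<lambda>i. r + i) ` {1..s}) = (\<Sum>i = 1..s. f (r + i))"
    by (subst sum.reindex) (auto simp: inj_on_def)
  ultimately show ?thesis by simp
qed

lemma card_eq_sum_points: "U \<subseteq> points \<Longrightarrow> int (card U) = (\<Sum>x\<in>points. of_bool (x \<in> U))"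
  by (simp add: of_bool_def sum.If_cases Int_absorb1)

lemma hyp_sum_divisor: "hyp_sum (s + 1) (divisor U) = twist U"
  unfolding twist_def by (intro sum.cong) (auto simp: divisor_def)

lemma exc_bool_sum:
  assumes "U \<in> verts"
  shows "(\<Sum>j = 1..r. of_bool (j \<in> U) :: int) = twist U + 1"
proof -
  have "int (s + 1) = (\<Sum>j = 1..r. of_bool (j \<in> U)) + (\<Sum>i = 1..s. of_bool (r + i \<in> U))"
    using assms card_eq_sum_points[of U] unfolding sum_points by (auto simp: ksubsets_def)
  moreover have "twist U = int s - (\<Sum>i = 1..s. of_bool (r + i \<in> U))"
    unfolding twist_def by (subst sum_subtractf, rule arg_cong2[of _ _ _ _ "(-)"]) (simp, rule HOL.refl)
  ultimately show ?thesis by simp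
qed

lemma pic_form_divisor:
  assumes U: "U \<in> verts" and U': "U' \<in> verts"
  shows "pic_form (s + 1) 1 c (divisor U) (divisor U') = int s - int (card (U \<inter> U'))"
proof -
  define H where "H = (\<Sum>i = 1..s. of_bool (r + i \<in> U) * of_bool (r + i \<in> U') :: int)"
  define E where "E = (\<Sum>j = 1..r. of_bool (j \<in> U) * of_bool (j \<in> U') :: int)"
  have "int (card (U \<inter> U')) = (\<Sum>x\<in>points. of_bool (x \<in> U \<inter> U'))"
    using U by (intro card_eq_sum_points) (auto simp: ksubsets_def)
  also have "\<dots> = E + H" unfolding sum_points E_def H_def by (intro arg_cong2[of _ _ _ _ "(+)"] sum.cong) auto
  finally have card: "int (card (U \<inter> U')) = E + H" .
  have "(\<Sum>i = 1..s + 1 - 1. divisor U (Hyp i) * divisor U' (Hyp i))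
      = (\<Sum>i = 1..s. (1 - of_bool (r + i \<in> U)) + (1 - of_bool (r + i \<in> U')) - 1
          + of_bool (r + i \<in> U) * of_bool (r + i \<in> U'))"
    by (intro sum.cong) (auto simp: divisor_def)
  also have "\<dots> = twist U + twist U' - int s + H"
    unfolding H_def twist_def by (simp only: sum.distrib sum_subtractf) simp
  finally have h: "(\<Sum>i = 1..s + 1 - 1. divisor U (Hyp i) * divisor U' (Hyp i)) = twist U + twist U' - int s + H" .
  have "(\<Sum>j = 1..r. divisor U (Exc j) * divisor U' (Exc j))
      = (\<Sum>j = 1..r. of_bool (j \<in> U) * of_bool (j \<in> U') - twist U' * of_bool (j \<in> U)
          - twist U * of_bool (j \<in> U') + twist U * twist U')"
    by (intro sum.cong) (auto simp: divisor_def algebra_simps)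
  also have "\<dots> = E - twist U' * (\<Sum>j = 1..r. of_bool (j \<in> U))
      - twist U * (\<Sum>j = 1..r. of_bool (j \<in> U')) + int r * (twist U * twist U')"
    unfolding E_def by (simp only: sum.distrib sum_subtractf sum_distrib_left sum_constant card_atLeastAtMost) simp
  also have "\<dots> = E - twist U' * (twist U + 1) - twist U * (twist U' + 1) + int r * (twist U * twist U')"
    by (simp only: exc_bool_sum[OF U] exc_bool_sum[OF U'])
  finally have e: "(\<Sum>j = 1..r. divisor U (Exc j) * divisor U' (Exc j))
      = E - twist U' * (twist U + 1) - twist U * (twist U' + 1) + int r * (twist U * twist U')" .
  show ?thesis
    unfolding pic_form_alt r[symmetric] hyp_sum_divisor h e card by (simp add: r algebra_simps)
qed

text \<open>
  The simple roots in the order in which they act as transpositions of neighbouring points; the root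
  with number \<open>r\<close> joins the exceptional to the hyperplane classes.
\<close>

definition root :: "nat \<Rightarrow> pic_basis \<Rightarrow> int" where
  "root i = (if i < r then exc_class i - exc_class (i + 1)
     else if i = r then hyp_class 1 - (\<Sum>j = 1..c. exc_class j)
     else hyp_class (i - r + 1) - hyp_class (i - r))"

lemma simple_roots_eq: "simple_roots (s + 1) 1 c = root ` {1..<N}"
proof (intro set_eqI iffI)
  fix \<alpha> assume "\<alpha> \<in> simple_roots (s + 1) 1 c"
  then show "\<alpha> \<in> root ` {1..<N}"
  proof (cases rule: simple_roots_cases)
    case (exc i)
    then have "i < r" "i < N" by (simp_all add: r N)
    then show ?thesis using exc by (intro image_eqI[of _ _ i]) (auto simp: root_def)
  next
    case mixed
    then have "\<alpha> = root r" by (simp add: root_def)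
    moreover have "1 \<le> r" "r < N" using s by (simp_all add: r N)
    ultimately show ?thesis by auto
  next
    case (hyp i)
    then show ?thesis using s by (intro image_eqI[of _ _ "r + i"]) (auto simp: root_def N)
  qed
next
  fix \<alpha> assume "\<alpha> \<in> root ` {1..<N}"
  then obtain i where i: "1 \<le> i" "i < N" "\<alpha> = root i" by auto
  consider "i < r" | "i = r" | "r < i" by linarith
  then show "\<alpha> \<in> simple_roots (s + 1) 1 c"
  proof cases
    case 1
    then have "1 \<le> i \<and> i \<le> 1 + c - 1 \<and> \<alpha> = exc_class i - exc_class (i + 1)"
    proof -
      have "i \<le> 1 + c - 1" using 1 by (simp add: r)
      then show ?thesis using i 1 by (simp add: root_def)
    qed
    then show ?thesis unfolding simple_roots_def by blast
  next
    case 2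
    then show ?thesis using i by (simp add: root_def simple_roots_def)
  next
    case 3
    then have "1 \<le> i - r \<and> i - r \<le> s + 1 - 2 \<and> \<alpha> = hyp_class (i - r + 1) - hyp_class (i - r)"
      using i by (auto simp: root_def N)
    then show ?thesis unfolding simple_roots_def by blast
  qed
qed

lemma pic_form_root:
  assumes "U \<in> verts" "1 \<le> i" "i < N"
  shows "pic_form (s + 1) 1 c (divisor U) (root i) = of_bool (i + 1 \<in> U) - of_bool (i \<in> U)"
proof -
  consider "i < r" | "i = r" | "r < i" by linarith
  then show ?thesis
  proof cases
    case 1
    then have "i \<le> 1 + c - 1" "i + 1 \<le> r" by (simp_all add: r)
    then show ?thesis using assms 1 pic_form_simple_root(1)[of i 1 c "s + 1" "divisor U"]
      by (simp add: root_def) (simp add: divisor_def)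
  next
    case 2
    have cr: "c \<le> r" by (simp add: r)
    have e: "(\<Sum>j = 1..c. divisor U (Exc j)) = (\<Sum>j = 1..c. of_bool (j \<in> U)) - int c * twist U"
    proof -
      have "(\<Sum>j = 1..c. divisor U (Exc j)) = (\<Sum>j = 1..c. of_bool (j \<in> U) - twist U)"
        using cr by (intro sum.cong) (auto simp: divisor_def)
      then show ?thesis by (simp only: sum_subtractf sum_constant card_atLeastAtMost) simp
    qed
    have b: "(\<Sum>j = 1..c. of_bool (j \<in> U) :: int) + of_bool (r \<in> U) = twist U + 1"
    proof -
      have "{1..r} = insert r {1..c}" "r \<notin> {1..c}" by (auto simp: r)
      then show ?thesis using exc_bool_sum[OF assms(1)] by (simp add: add.commute del: sum_of_bool_eq)
    qed
    have "pic_form (s + 1) 1 c (divisor U) (root i)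
        = (int c - 1) * twist U - divisor U (Hyp 1) + (\<Sum>j = 1..c. divisor U (Exc j))"
      using pic_form_simple_root(2)[of "s + 1" 1 c "divisor U"] s 2
      unfolding hyp_sum_divisor by (simp add: root_def)
    also have "divisor U (Hyp 1) = 1 - of_bool (r + 1 \<in> U)" using s by (simp add: divisor_def)
    finally show ?thesis unfolding e using b 2 by (simp add: algebra_simps)
  next
    case 3
    then obtain k where k: "i = r + k" "1 \<le> k" by (metis less_imp_add_positive Suc_leI One_nat_def)
    then show ?thesis using assms pic_form_simple_root(3)[of k "s + 1" 1 c "divisor U"]
      by (simp add: root_def divisor_def N)
  qed
qed

lemma shift_verts: "U \<in> verts \<Longrightarrow> 1 \<le> i \<Longrightarrow> i < N \<Longrightarrow> shift i U \<in> verts"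
  using shift_subset[of U N i] by (simp add: ksubsets_def card_shift)

lemma twist_shift:
  assumes "1 \<le> i" "i < N"
  shows "twist (shift i U) = twist U + (if i = r then of_bool (i + 1 \<in> U) - of_bool (i \<in> U) else 0)"
proof -
  let ?t = "\<lambda>x. of_bool (x \<in> U) :: int"
  have "twist (shift i U) = (\<Sum>k = 1..s. (1 - ?t (r + k))
     + (if k = 1 then (if i = r then ?t (i + 1) - ?t i else 0) else 0)
     + (if k = i - r then (if r < i then ?t i - ?t (i + 1) else 0) else 0)
     + (if k = i - r + 1 then (if r < i then ?t (i + 1) - ?t i else 0) else 0))"
    unfolding twist_def using assms(2) by (intro sum.cong HOL.refl) (auto simp: mem_shift N)
  also have "\<dots> = twist U + (if i = r then of_bool (i + 1 \<in> U) - of_bool (i \<in> U) else 0)"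
    unfolding sum.distrib twist_def[symmetric] using s assms N by (auto simp: sum.delta)
  finally show ?thesis .
qed

lemma reflection_root:
  assumes "U \<in> verts" "1 \<le> i" "i < N"
  shows "reflection (s + 1) 1 c (root i) (divisor U) = divisor (shift i U)"
proof
  fix x
  have i: "i < r + s" using assms(3) N by simp
  have "divisor U x + (of_bool (i + 1 \<in> U) - of_bool (i \<in> U)) * root i x = divisor (shift i U) x"
  proof (cases x)
    case (Hyp k)
    have "root i (Hyp k) = (if i = r \<and> k = 1 then 1 else if r < i \<and> k = i - r + 1 then 1
        else if r < i \<and> k = i - r then -1 else 0)"
      by (simp add: root_def sum_exc_class_apply) (simp add: hyp_class_def exc_class_def)
    then show ?thesis using Hyp i s by (auto simp: divisor_def mem_shift)
  next
    case (Exc j)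
    have "root i (Exc j) = (if i < r \<and> j = i then 1 else if i < r \<and> j = i + 1 then -1
        else if i = r \<and> 1 \<le> j \<and> j < r then -1 else 0)"
      by (simp add: root_def sum_exc_class_apply) (auto simp: hyp_class_def exc_class_def r)
    then show ?thesis using Exc assms(2) by (auto simp: divisor_def mem_shift twist_shift[OF assms(2,3)])
  qed
  then show "reflection (s + 1) 1 c (root i) (divisor U) x = divisor (shift i U) x"
    by (simp only: reflection_def pic_form_root[OF assms])
qed

lemma divisor_start: "divisor {r..N} = exc_class r"
proof -
  have t: "twist {r..N} = 0" unfolding twist_def by (intro sum.neutral) (auto simp: N)
  have "1 \<le> r" "r \<le> N" "\<And>i. i \<le> s \<Longrightarrow> r + i \<le> N" by (simp_all add: r N)
  then show ?thesis
    by (intro ext) (auto simp: divisor_def t exc_class_def split: pic_basis.split)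
qed

lemma start_verts: "{r..N} \<in> verts" by (auto simp: ksubsets_def N r)

text \<open>
  Moving points up one by one leads from \<open>U\<close> to the final segment \<open>{r..N}\<close>, which is the class \<open>E\<^sub>r\<close>.
  Reflections are involutions, so the path can be reversed.
\<close>

lemma divisor_mem: "U \<in> verts \<Longrightarrow> divisor U \<in> mods"
proof (induction "\<Sum>x\<in>U. N + 1 - x" arbitrary: U rule: less_induct)
  case less
  show ?case
  proof (cases "\<exists>i\<in>U. i < N \<and> i + 1 \<notin> U")
    case False
    then have "U = {N + 1 - card U..N}"
      using less.prems by (intro upper_segment_unless_shiftable) (auto simp: ksubsets_def)
    moreover have "N + 1 - card U = r" using less.prems by (simp add: ksubsets_def N)
    ultimately have "U = {r..N}" by simp
    then show ?thesis using exc_class_mem_minus_one_divisors[of 1 c "s + 1"] divisor_start by (simp add: r)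
  next
    case True
    then obtain i where i: "i \<in> U" "i < N" "i + 1 \<notin> U" by blast
    have U: "U \<subseteq> points" and i1: "1 \<le> i" using less.prems i by (auto simp: ksubsets_def)
    have "divisor (shift i U) \<in> mods"
      using less.hyps[OF sum_shift_less[OF U i]] shift_verts[OF less.prems i1 i(2)] by blast
    moreover have "root i \<in> simple_roots (s + 1) 1 c" unfolding simple_roots_eq using i i1 by auto
    ultimately have "reflection (s + 1) 1 c (root i) (divisor (shift i U)) \<in> mods"
      by (intro reflection_mem_minus_one_divisors)
    then show ?thesis
      using reflection_root[OF shift_verts[OF less.prems i1 i(2)] i1 i(2)] by (simp add: shift_shift)
  qed
qed

lemma mods_eq: "mods = divisor ` verts"
proof (intro set_eqI iffI)
  fix D assume "D \<in> mods"
  then show "D \<in> divisor ` verts"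
  proof (induction rule: minus_one_divisors_induct)
    case exc
    show ?case using divisor_start start_verts unfolding r[symmetric] by (metis image_eqI)
  next
    case (reflection \<alpha> D)
    obtain U where U: "U \<in> verts" "D = divisor U" using reflection by blast
    obtain i where i: "1 \<le> i" "i < N" "\<alpha> = root i"
      using reflection(1) unfolding simple_roots_eq by auto
    have "reflection (s + 1) 1 c \<alpha> D = divisor (shift i U)"
      unfolding U i by (rule reflection_root[OF U(1) i(1,2)])
    then show ?case using shift_verts[OF U(1) i(1,2)] by blast
  qed
next
  fix D assume "D \<in> divisor ` verts"
  then show "D \<in> mods" using divisor_mem by auto
qed

text \<open>
  The intersection form recovers \<open>|U \<inter> U'|\<close>, and this is \<open>|U|\<close> only if \<open>U = U'\<close>.
\<close>

lemma inj_divisor: "inj_on divisor verts"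
proof (rule inj_onI)
  fix U U' assume U: "U \<in> verts" "U' \<in> verts" and eq: "divisor U = divisor U'"
  have "int s - int (card (U \<inter> U')) = int s - int (card (U \<inter> U))"
    using pic_form_divisor[OF U] pic_form_divisor[OF U(1) U(1)] eq by simp
  then have "card (U \<inter> U') = card U" by simp
  moreover have "finite U" "finite U'" "card U = card U'"
    using U finite_subset by (auto simp: ksubsets_def)
  ultimately show "U = U'"
    by (metis Int_lower1 Int_lower2 card_subset_eq)
qed

lemma sum_mods: "(\<Sum>D\<in>mods. f D) = (\<Sum>U\<in>verts. f (divisor U))" for f :: "_ \<Rightarrow> real"
  unfolding mods_eq by (subst sum.reindex[OF inj_divisor]) simp

end

text \<open>
  The hypothesis on \<open>eta\<close> identifies \<open>eta / |V|\<close> with \<open>\<kappa> / \<delta>\<close>, so that the Gram matrix of the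
  projection is the matrix \<open>G\<close> of the locale.
\<close>

lemma optimal_projection:
  assumes F: "two_eigenvalue_form (minus_one_divisors a b c) (real_form a b c) lam eta beta"
    and a: "2 \<le> a" and bc: "1 \<le> b + c"
    and \<delta>: "0 < proj_delta a b c" and \<kappa>: "0 \<le> real a * real c - real a - real c"
    and eta: "eta * proj_delta a b c = (real a * real c - real a - real c) * real (card (minus_one_divisors a b c))"
  shows "(\<forall>V\<in>minus_one_divisors a b c.
            pic_form a b c (normalized_projection a b c V) (\<lambda>x. real_of_int (canonical_class a b c x)) = 0) \<and>
         projection_gram a b c \<in> elliptope (minus_one_divisors a b c) \<and>
         SD_value (minus_one_divisors a b c) (divisor_mult a b c) (projection_gram a b c)
           = SD_opt (minus_one_divisors a b c) (divisor_mult a b c)"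
proof -
  interpret F: two_eigenvalue_form "minus_one_divisors a b c" "real_form a b c" lam eta beta by (rule F)
  have "(real a * real c - real a - real c) / proj_delta a b c = eta / F.n"
    using eta \<delta> F.n_pos by (simp add: frac_eq_eq)
  then have G: "projection_gram a b c U V = F.G U V"
    if "U \<in> minus_one_divisors a b c" "V \<in> minus_one_divisors a b c" for U V
    using projection_gram_eq[OF a bc \<delta> \<kappa> that] by (simp only: F.G_def)
  show ?thesis
  proof (intro conjI ballI)
    fix V assume "V \<in> minus_one_divisors a b c"
    then show "pic_form a b c (normalized_projection a b c V) (\<lambda>x. real_of_int (canonical_class a b c x)) = 0"
      by (rule normalized_projection_orthogonal[OF a bc \<delta> \<kappa>])
  next
    have "projection_gram a b c \<in> elliptope (minus_one_divisors a b c)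
        \<longleftrightarrow> F.G \<in> elliptope (minus_one_divisors a b c)"
      by (rule elliptope_cong) (rule G)
    then show "projection_gram a b c \<in> elliptope (minus_one_divisors a b c)"
      using F.G_mem_elliptope by simp
    have "SD_value (minus_one_divisors a b c) M (projection_gram a b c) = SD_value (minus_one_divisors a b c) M F.G" for M
      by (rule SD_value_cong) (rule G)
    then show "SD_value (minus_one_divisors a b c) (divisor_mult a b c) (projection_gram a b c)
           = SD_opt (minus_one_divisors a b c) (divisor_mult a b c)"
      unfolding divisor_mult_eq F.SD_opt_eq using F.SD_value_G by simp
  qed
qed

lemma cut_between_rounding:
  assumes F: "two_eigenvalue_form (minus_one_divisors a b c) (real_form a b c) lam eta beta"
    and l: "l \<le> (1/2) * (\<Sum>U\<in>minus_one_divisors a b c. \<Sum>V\<in>minus_one_divisors a b c.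
        divisor_mult a b c U V * (arccos (two_eigenvalue_form.G (minus_one_divisors a b c) (real_form a b c) eta U V) / pi))"
    and u: "u = real (card (minus_one_divisors a b c)) * (eta - lam) / 4"
  shows "cut_between a b c l u"
proof -
  interpret F: two_eigenvalue_form "minus_one_divisors a b c" "real_form a b c" lam eta beta by (rule F)
  have "m_cut a b c \<in> \<int>" unfolding divisor_mult_eq by (rule F.max_cut_integral) (rule Ints_of_int)
  then obtain z where z: "m_cut a b c = of_int z" by (rule Ints_cases)
  have "l \<le> m_cut a b c" using l F.max_cut_ge_rounding unfolding divisor_mult_eq by linarith
  moreover have "m_cut a b c \<le> u" unfolding u divisor_mult_eq by (rule F.max_cut_le)
  ultimately show ?thesis unfolding cut_between_def z by (simp add: ceiling_le_iff le_floor_iff)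
qed

context type_A
begin

text \<open>
  The numbers of vertices (\<open>K0\<close>), of vertices through one point (\<open>K1\<close>) and through two points (\<open>K2\<close>)
  are rational multiples of \<open>X\<close>. All identities between binomial coefficients in this section thereby
  become identities between rational functions of \<open>c\<close> and \<open>s\<close>.
\<close>

definition X :: real where "X = real (c + s - 1 choose s)"

definition lam :: real where "lam = - X"
definition eta :: real where "eta = X * real (c + s) * (real s * (real c - 1) - 1) / (real (s + 1) * real c)"

abbreviation K0 :: real where "K0 \<equiv> real (N choose (s + 1))"
abbreviation K1 :: real where "K1 \<equiv> real (N - 1 choose s)"
abbreviation K2 :: real where "K2 \<equiv> real (N - 2 choose (s - 1))"

lemma X_pos: "0 < X"
  using c by (simp add: X_def zero_less_binomial_iff)

lemma K1_eq: "K1 = X * real (c + s) / real c"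
proof -
  have "(c + s - s) * (c + s choose s) = (c + s) * ((c + s) - 1 choose s)"
    by (rule binomial_absorb_comp)
  then have "real c * real (c + s choose s) = real (c + s) * X"
    unfolding X_def by (simp only: of_nat_mult[symmetric] diff_add_inverse2)
  moreover have "N - 1 = c + s" by (simp add: N r)
  ultimately show ?thesis using c by (simp add: field_simps)
qed

lemma K0_eq: "K0 = X * real (c + s + 1) * real (c + s) / (real (s + 1) * real c)"
proof -
  have "Suc s * (N choose Suc s) = N * (N - 1 choose s)"
    by (rule binomial_absorption)
  then have "real (s + 1) * K0 = real N * K1" by (simp only: of_nat_mult[symmetric] Suc_eq_plus1)
  moreover have "real N = real (c + s + 1)" by (simp add: N r)
  ultimately have "real (s + 1) * K0 = X * real (c + s + 1) * real (c + s) / real c"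
    unfolding K1_eq by (simp add: mult_ac)
  moreover have "K = B / (A * C)" if "A * K = B / C" "A \<noteq> 0" for A B C K :: real
    using that by (metis divide_divide_eq_left mult.commute nonzero_mult_div_cancel_left)
  ultimately show ?thesis by (metis of_nat_0_eq_iff add_is_0 one_neq_zero)
qed

lemma K2_eq: "K2 = X * real s / real c"
proof -
  let ?m = "c + s - 1"
  have "Suc (s - 1) * (?m choose Suc (s - 1)) = ?m * (?m - 1 choose (s - 1))"
    by (rule binomial_absorption)
  moreover have "(?m - (s - 1)) * (?m choose (s - 1)) = ?m * (?m - 1 choose (s - 1))"
    by (rule binomial_absorb_comp)
  moreover have "Suc (s - 1) = s" "?m - (s - 1) = c" "N - 2 = ?m" using s by (simp_all add: N r)
  ultimately have "s * (?m choose s) = c * (N - 2 choose (s - 1))" by simp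
  then have "real s * X = real c * K2" unfolding X_def by (simp only: of_nat_mult[symmetric])
  then show ?thesis using c by (simp add: field_simps)
qed

lemma c_pos: "0 < real c" using c by simp

lemma eta_eq: "real s * K0 - real (s + 1) * K1 = eta"
proof -
  have "real s * K0 - real (s + 1) * K1
      = X * real (c + s) * (real s * real (c + s + 1) - real (s + 1) * real (s + 1)) / (real (s + 1) * real c)"
    unfolding K0_eq K1_eq using c_pos by (simp add: divide_simps) (simp add: algebra_simps)
  also have "real s * real (c + s + 1) - real (s + 1) * real (s + 1) = real s * (real c - 1) - 1"
    by (simp add: algebra_simps)
  finally show ?thesis by (simp add: eta_def)
qed

lemma lam_eq: "K1 - K2 = - lam"
  unfolding K1_eq K2_eq lam_def using c_pos by (simp add: divide_simps) (simp add: algebra_simps)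

definition beta :: real where
  "beta = (real s)\<^sup>2 * K0 - 2 * real s * real (s + 1) * K1 + (real (s + 1))\<^sup>2 * K2 - lam * real s"

abbreviation q :: "nat set \<Rightarrow> nat set \<Rightarrow> real" where
  "q U W \<equiv> real s - real (card (U \<inter> W))"

lemma verts_props: "U \<in> verts \<Longrightarrow> U \<subseteq> points \<and> card U = s + 1 \<and> finite U"
  using finite_subset by (auto simp: ksubsets_def)

lemma card_verts: "card verts = N choose (s + 1)"
  by (simp add: card_ksubsets)

lemma row_sum_q: "U \<in> verts \<Longrightarrow> (\<Sum>W\<in>verts. q U W) = eta"
  using sum_ksubsets_overlap[of points U "s + 1"] verts_props[of U] card_verts
  by (simp add: sum_subtractf eta_eq[symmetric])

text \<open>
  Double counting: \<open>|U \<inter> W| |U' \<inter> W|\<close> counts pairs of points in \<open>W\<close>, and summing over \<open>W\<close> it only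
  matters whether the two points coincide.
\<close>

lemma square_q:
  assumes U: "U \<in> verts" "U' \<in> verts"
  shows "(\<Sum>W\<in>verts. q U W * q W U') = lam * q U U' + beta"
proof -
  have UU: "U \<subseteq> points" "U' \<subseteq> points" "card U = s + 1" "card U' = s + 1" using U verts_props by auto
  have "(\<Sum>W\<in>verts. q U W * q W U') = (\<Sum>W\<in>verts. (real s)\<^sup>2 - real s * real (card (U \<inter> W))
      - real s * real (card (U' \<inter> W)) + real (card (U \<inter> W)) * real (card (U' \<inter> W)))"
    by (intro sum.cong HOL.refl) (simp add: Int_commute power2_eq_square algebra_simps)
  also have "\<dots> = (real s)\<^sup>2 * K0 - real s * (real (s + 1) * K1) - real s * (real (s + 1) * K1)
      + (real (card (U \<inter> U')) * (K1 - K2) + real (s + 1) * real (s + 1) * K2)"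
  proof -
    have e: "card points = N" "s + 1 - 1 = s" "s + 1 - 2 = s - 1" by simp_all
    have c1: "(\<Sum>W\<in>verts. real (card (V \<inter> W))) = real (s + 1) * K1" if "V \<subseteq> points" "card V = s + 1" for V
      using sum_ksubsets_overlap[of points V "s + 1"] that unfolding e by simp
    have c2: "(\<Sum>W\<in>verts. real (card (U \<inter> W)) * real (card (U' \<inter> W)))
        = real (card (U \<inter> U')) * (K1 - K2) + real (s + 1) * real (s + 1) * K2"
      using sum_ksubsets_overlap_overlap[of points U U' "s + 1"] UU s unfolding e by simp
    show ?thesis
      unfolding sum.distrib sum_subtractf sum_distrib_left[symmetric] c1[OF UU(1,3)] c1[OF UU(2,4)] c2
      by (simp add: card_ksubsets)
  qed
  also have "\<dots> = lam * q U U' + beta"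
    unfolding lam_eq beta_def by (simp add: power2_eq_square algebra_simps)
  finally show ?thesis .
qed

lemma real_form_divisor: "U \<in> verts \<Longrightarrow> U' \<in> verts \<Longrightarrow> real_form (s + 1) 1 c (divisor U) (divisor U') = q U U'"
  using pic_form_divisor[of U U'] by simp

lemma overlap_le:
  assumes "U \<in> verts" "U' \<in> verts" "U \<noteq> U'"
  shows "card (U \<inter> U') \<le> s"
proof -
  have "U \<inter> U' \<subset> U"
    using assms verts_props card_subset_eq[of U' U] by (metis Int_lower1 Int_lower2 inf.absorb_iff2 psubsetI)
  then have "card (U \<inter> U') < card U" using assms verts_props psubset_card_mono by blast
  then show ?thesis using assms verts_props by force
qed

lemma sc_ge: "1 < real s * (real c - 1)"
proof -
  have "1 < 1 * (real c - 1)" using c by simp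
  also have "\<dots> \<le> real s * (real c - 1)" using s c by (intro mult_right_mono) auto
  finally show ?thesis .
qed

lemma form: "two_eigenvalue_form mods (real_form (s + 1) 1 c) lam eta beta"
proof
  show "finite mods" unfolding mods_eq by (simp add: finite_ksubsets)
  show "mods \<noteq> {}" using exc_class_mem_minus_one_divisors by blast
  fix D D' assume D: "D \<in> mods"
  obtain U where U: "U \<in> verts" "D = divisor U" using D mods_eq by auto
  show "real_form (s + 1) 1 c D D = -1" using real_form_divisor[OF U(1) U(1)] U verts_props[of U] by simp
  show "(\<Sum>D'\<in>mods. real_form (s + 1) 1 c D D') = eta"
    unfolding sum_mods U(2) row_sum_q[OF U(1), symmetric] by (intro sum.cong HOL.refl real_form_divisor U)
  assume D': "D' \<in> mods"
  obtain U' where U': "U' \<in> verts" "D' = divisor U'" using D' mods_eq by auto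
  show "real_form (s + 1) 1 c D D' = real_form (s + 1) 1 c D' D" by (simp only: pic_form_commute)
  show "0 \<le> real_form (s + 1) 1 c D D'" if "D \<noteq> D'"
    using overlap_le[OF U(1) U'(1)] that unfolding U U' real_form_divisor[OF U(1) U'(1)] by auto
  show "(\<Sum>E\<in>mods. real_form (s + 1) 1 c D E * real_form (s + 1) 1 c E D') = lam * real_form (s + 1) 1 c D D' + beta"
  proof -
    have "(\<Sum>E\<in>mods. real_form (s + 1) 1 c D E * real_form (s + 1) 1 c E D') = (\<Sum>W\<in>verts. q U W * q W U')"
      unfolding sum_mods U(2) U'(2) using U U' by (intro sum.cong HOL.refl) (simp only: real_form_divisor)
    then show ?thesis using square_q[OF U(1) U'(1)] real_form_divisor[OF U(1) U'(1)] U U' by simp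
  qed
next
  show "lam < 0" using X_pos by (simp add: lam_def)
  show "0 < eta" unfolding eta_def using X_pos c_pos sc_ge by (intro divide_pos_pos mult_pos_pos) auto
qed

sublocale F: two_eigenvalue_form mods "real_form (s + 1) 1 c" lam eta beta by (rule form)

lemma card_mods: "real (card mods) = K0"
  unfolding mods_eq card_image[OF inj_divisor] card_verts ..

lemma lambda_A_eq: "lambda_A r s = lam"
proof -
  have "r + s - 2 = c + s - 1" "r - 2 = c + s - 1 - s" using c by (simp_all add: r)
  then show ?thesis unfolding lambda_A_def lam_def X_def
    using binomial_symmetric[of s "c + s - 1"] c by simp
qed

lemma eta_A_eq: "eta_A r s = eta"
proof -
  let ?m = "c + s - 1"
  have sym: "?m choose (r - 3) = ?m choose (s + 1)" "?m choose (r - 2) = ?m choose s" "?m choose (r - 1) = ?m choose (s - 1)"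
    using binomial_symmetric[of "r - 3" ?m] binomial_symmetric[of "r - 2" ?m] binomial_symmetric[of "r - 1" ?m] c s
    by (simp_all add: r)
  have m: "r + s - 2 = ?m" by (simp add: r)
  have P1: "N - 1 choose s = (?m choose s) + (?m choose (s - 1))"
    using s choose_reduce_nat[of "N - 1" s] c by (simp add: N r add.commute)
  have P0: "N choose (s + 1) = (N - 1 choose (s + 1)) + (N - 1 choose s)"
    using choose_reduce_nat[of N "s + 1"] c by (simp add: N r add.commute)
  have P2: "N - 1 choose (s + 1) = (?m choose (s + 1)) + (?m choose s)"
    using choose_reduce_nat[of "N - 1" "s + 1"] c by (simp add: N r add.commute)
  show ?thesis unfolding eta_A_def m sym eta_eq[symmetric] P0 P1 P2
    by (simp add: algebra_simps)
qed

lemma spectrum_values: "has_spectrum_values (s + 1) 1 c (lambda_A r s) (eta_A r s)"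
proof -
  \<comment> \<open>Vertices at distance one and two from \<open>A\<close>, with intersection numbers 0 and 1.\<close>
  define A B C where "A = {1..s + 1}" and "B = insert (s + 2) {1..s}" and "C = {s + 2, s + 3} \<union> {1..s - 1}"
  have v: "A \<in> verts" "B \<in> verts" "C \<in> verts"
  proof -
    have N4: "s + 4 \<le> N" using c by (simp add: N r)
    have "card C = card {s + 2, s + 3} + card {1..s - 1}"
      unfolding C_def by (rule card_Un_disjoint) auto
    then have cC: "card C = s + 1" using s by simp
    have "A \<subseteq> points" "B \<subseteq> points" "C \<subseteq> points"
      unfolding A_def B_def C_def using N4 by auto
    then show "A \<in> verts" "B \<in> verts" "C \<in> verts"
      using cC by (simp_all add: ksubsets_def) (simp_all add: A_def B_def)
  qed
  have "A \<inter> B = {1..s}" unfolding A_def B_def by auto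
  moreover have "A \<inter> C = {1..s - 1}" unfolding A_def C_def by auto
  ultimately have cards: "card (A \<inter> B) = s" "card (A \<inter> C) = s - 1" by simp_all
  have cA: "card A = s + 1" by (simp add: A_def)
  have ne: "A \<noteq> B" "A \<noteq> C"
  proof -
    show "A \<noteq> B"
    proof
      assume "A = B"
      then show False using cards(1) cA by simp
    qed
    show "A \<noteq> C"
    proof
      assume "A = C"
      then show False using cards(2) cA by simp
    qed
  qed
  have "graph_spectrum mods F.M = {1 + lam, 1, 1 + eta}"
  proof (rule F.spectrum)
    show "divisor A \<in> mods" "divisor B \<in> mods" "divisor C \<in> mods" using v mods_eq by auto
    show "divisor A \<noteq> divisor B" "divisor A \<noteq> divisor C"
      using ne v by (simp_all add: inj_on_eq_iff[OF inj_divisor])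
    show "real_form (s + 1) 1 c (divisor A) (divisor B) \<noteq> real_form (s + 1) 1 c (divisor A) (divisor C)"
      unfolding real_form_divisor[OF v(1,2)] real_form_divisor[OF v(1,3)] cards using s by simp
  qed
  then show ?thesis unfolding has_spectrum_values_def divisor_mult_eq lambda_A_eq eta_A_eq
    using F.lam_neg F.eta_pos by simp
qed

lemma card_eta_lam: "eta - lam = X * real s * (real (c + s + 1) * (real c - 1)) / (real (s + 1) * real c)"
  unfolding eta_def lam_def using c_pos by (simp add: divide_simps) (simp add: algebra_simps)

lemma upper_A_eq: "upper_A r s = real (card mods) * (eta - lam) / 4"
proof -
  let ?m = "c + s - 1"
  have 1: "N choose (r - 1) = N choose (s + 1)"
    using binomial_symmetric[of "r - 1" N] by (simp add: N r)
  have 2: "?m choose (r - 3) = ?m choose (s + 1)"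
    using binomial_symmetric[of "r - 3" ?m] c s by (simp add: r)
  have 3: "real (s + 1) * real (?m choose (s + 1)) = real (c - 1) * X"
  proof -
    have "Suc s * (?m choose Suc s) = ?m * (?m - 1 choose s)" by (rule binomial_absorption)
    moreover have "(?m - s) * (?m choose s) = ?m * (?m - 1 choose s)" by (rule binomial_absorb_comp)
    ultimately have "(s + 1) * (?m choose (s + 1)) = (c - 1) * (?m choose s)" by simp
    then show ?thesis unfolding X_def by (simp only: of_nat_mult[symmetric])
  qed
  have 4: "real (s + 1 choose 2) = real (s + 1) * real s / 2"
    by (simp add: choose_two real_of_nat_div algebra_simps)
  have 5: "real (?m choose (s + 1)) = (real c - 1) * X / real (s + 1)"
    using 3 c by (simp add: field_simps of_nat_diff)
  have rs: "r + s = N" "N - 2 = ?m" "real (r - 1) = real c" "real N = real (c + s + 1)" by (simp_all add: N r)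
  show ?thesis
    unfolding upper_A_def rs 1 2 4 5 card_mods card_eta_lam using c_pos
    by (simp add: divide_simps)
qed

text \<open>
  Group the vertices \<open>W\<close> by the distance \<open>k + 1 = |U - W|\<close>. Then \<open>q U W = k\<close>, and the cosine of the
  angle is \<open>1 - N (k + 1) / ((s + 1) c)\<close>.
\<close>

lemma sum_arccos_A:
  assumes U: "U \<in> verts"
  shows "(\<Sum>W\<in>verts. (if U = W then 0 else q U W) * (arccos ((eta / K0 - q U W) / (1 + eta / K0)) / pi))
    = (\<Sum>k = 0..s. real (s + 1 choose (k + 1)) * real (c choose (k + 1)) * real k *
        arccos (1 - real (r + s) * real (k + 1) / (real (s + 1) * real c))) / pi"
proof -
  have UU: "U \<subseteq> points" "card U = s + 1" "finite U" using U verts_props by auto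
  define T where "T d = arccos (1 - real N * real d / (real (s + 1) * real c)) / pi" for d :: nat
  define F where "F j = (if j = s + 1 then 0 else real s - real j) * T (s + 1 - j)" for j :: nat
  have cU: "card (points - U) = c" using UU by (simp add: card_Diff_subset N r)
  have K0: "0 < K0" "eta / K0 = (real s * (real c - 1) - 1) / real N"
    using X_pos c_pos unfolding K0_eq eta_def by (simp_all add: N r)
  have G: "(eta / K0 - (real s - real j)) / (1 + eta / K0) = 1 - real N * real (s + 1 - j) / (real (s + 1) * real c)"
    if "j \<le> s + 1" for j
  proof -
    define D where "D = real (s + 1) * real c / real N"
    have D: "D \<noteq> 0" using c_pos by (simp add: D_def N r)
    have one: "1 + eta / K0 = D"
      unfolding K0(2) D_def by (simp add: N r field_simps)
    have num: "eta / K0 - (real s - real j) = D - real (s + 1 - j)"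
      using that unfolding one[symmetric] by (simp add: of_nat_diff)
    have "(D - real (s + 1 - j)) / D = 1 - real (s + 1 - j) / D"
      using D by (simp add: diff_divide_distrib)
    also have "real (s + 1 - j) / D = real N * real (s + 1 - j) / (real (s + 1) * real c)"
      by (simp add: D_def mult.commute)
    finally show ?thesis unfolding num one .
  qed
  have "(\<Sum>W\<in>verts. (if U = W then 0 else q U W) * (arccos ((eta / K0 - q U W) / (1 + eta / K0)) / pi))
      = (\<Sum>W\<in>verts. F (card (U \<inter> W)))"
  proof (intro sum.cong HOL.refl)
    fix W assume W: "W \<in> verts"
    have le: "card (U \<inter> W) \<le> s + 1" using UU card_mono[of U "U \<inter> W"] by simp
    have iff: "U = W \<longleftrightarrow> card (U \<inter> W) = s + 1"
    proof
      assume "card (U \<inter> W) = s + 1"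
      then show "U = W" using overlap_le[OF U W] by (cases "U = W") auto
    qed (use UU in auto)
    show "(if U = W then 0 else q U W) * (arccos ((eta / K0 - q U W) / (1 + eta / K0)) / pi) = F (card (U \<inter> W))"
      unfolding G[OF le] iff F_def T_def by simp
  qed
  also have "\<dots> = (\<Sum>j\<le>s + 1. real (s + 1 choose j) * real (c choose (s + 1 - j)) * F j)"
    using sum_ksubsets_by_overlap[OF _ UU(1), of F "s + 1"] UU cU by simp
  also have "\<dots> = (\<Sum>j\<le>s. real (s + 1 choose j) * real (c choose (s + 1 - j)) * F j)"
    by (simp add: F_def)
  also have "\<dots> = (\<Sum>k\<le>s. real (s + 1 choose (s - k)) * real (c choose (s + 1 - (s - k))) * F (s - k))"
    by (rule sum.nat_diff_reindex[symmetric, where n = "Suc s", simplified lessThan_Suc_atMost, simplified])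
  also have "\<dots> = (\<Sum>k\<le>s. real (s + 1 choose (k + 1)) * real (c choose (k + 1)) * real k * T (k + 1))"
  proof (intro sum.cong HOL.refl)
    fix k assume "k \<in> {..s}"
    then have k: "k \<le> s" by simp
    have "s + 1 choose (s - k) = s + 1 choose (k + 1)"
      using binomial_symmetric[of "s - k" "s + 1"] k by (simp add: Suc_diff_le)
    moreover have "s + 1 - (s - k) = k + 1" "real s - real (s - k) = real k" "s - k \<noteq> s + 1" using k by auto
    ultimately show "real (s + 1 choose (s - k)) * real (c choose (s + 1 - (s - k))) * F (s - k)
        = real (s + 1 choose (k + 1)) * real (c choose (k + 1)) * real k * T (k + 1)"
      unfolding F_def by simp
  qed
  finally show ?thesis unfolding T_def N
    by (simp add: sum_divide_distrib atMost_atLeast0 mult.assoc)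
qed

lemma cut_between_A: "cut_between (s + 1) 1 c (lower_A r s) (upper_A r s)"
proof (rule cut_between_rounding[OF form _ upper_A_eq])
  have "(\<Sum>U\<in>mods. \<Sum>V\<in>mods. divisor_mult (s + 1) 1 c U V * (arccos (F.G U V) / pi))
      = (\<Sum>U\<in>verts. \<Sum>W\<in>verts. (if U = W then 0 else q U W) * (arccos ((eta / K0 - q U W) / (1 + eta / K0)) / pi))"
    unfolding sum_mods divisor_mult_eq F.G_def card_mods
    by (intro sum.cong HOL.refl) (simp only: real_form_divisor inj_on_eq_iff[OF inj_divisor])
  also have "\<dots> = K0 * ((\<Sum>k = 0..s. real (s + 1 choose (k + 1)) * real (c choose (k + 1)) * real k *
        arccos (1 - real (r + s) * real (k + 1) / (real (s + 1) * real c))) / pi)"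
    (is "_ = K0 * ?R")
  proof -
    have "(\<Sum>U\<in>verts. \<Sum>W\<in>verts. (if U = W then 0 else q U W) * (arccos ((eta / K0 - q U W) / (1 + eta / K0)) / pi))
        = (\<Sum>U\<in>verts. ?R)"
      by (intro sum.cong HOL.refl sum_arccos_A)
    then show ?thesis by (simp only: sum_constant card_verts)
  qed
  finally have eq: "(\<Sum>U\<in>mods. \<Sum>V\<in>mods. divisor_mult (s + 1) 1 c U V * (arccos (F.G U V) / pi)) = \<dots>" .
  have "N choose (r - 1) = N choose (s + 1)" "r - 1 = c"
    using binomial_symmetric[of "r - 1" N] by (simp_all add: N r)
  then show "lower_A r s \<le> (1/2) * (\<Sum>U\<in>mods. \<Sum>V\<in>mods. divisor_mult (s + 1) 1 c U V * (arccos (F.G U V) / pi))"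
    unfolding eq lower_A_def by (simp add: N)
qed

lemma optimal_A:
  "(\<forall>V\<in>mods. pic_form (s + 1) 1 c (normalized_projection (s + 1) 1 c V) (\<lambda>x. real_of_int (canonical_class (s + 1) 1 c x)) = 0) \<and>
   projection_gram (s + 1) 1 c \<in> elliptope mods \<and>
   SD_value mods (divisor_mult (s + 1) 1 c) (projection_gram (s + 1) 1 c) = SD_opt mods (divisor_mult (s + 1) 1 c)"
proof (rule optimal_projection[OF form])
  have d: "proj_delta (s + 1) 1 c = real (c + s + 1)" by (simp add: proj_delta_def algebra_simps)
  have k: "real (s + 1) * real c - real (s + 1) - real c = real s * (real c - 1) - 1" by (simp add: algebra_simps)
  show "0 < proj_delta (s + 1) 1 c" unfolding d by simp
  show "0 \<le> real (s + 1) * real c - real (s + 1) - real c" unfolding k using sc_ge by simp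
  show "eta * proj_delta (s + 1) 1 c = (real (s + 1) * real c - real (s + 1) - real c) * real (card mods)"
    unfolding d k card_mods K0_eq eta_def by (simp add: mult_ac)
qed (use s c in auto)

text \<open>
  The cut by membership of the point 1. Since \<open>N = 2 (s + 1)\<close>, half of all vertices contain it,
  and the corresponding sign vector is a coordinate function in the \<open>lam\<close>-eigenspace.
\<close>

lemma max_cut_A_eq_upper:
  assumes "c = s + 1"
  shows "m_cut (s + 1) 1 c = upper_A r s"
proof -
  define S where "S = divisor ` {W \<in> verts. 1 \<in> W}"
  have pt: "1 \<in> points" by (simp add: N r)
  have mem: "divisor W \<in> S \<longleftrightarrow> 1 \<in> W" if "W \<in> verts" for W
    using that inj_divisor by (auto simp: S_def inj_on_eq_iff)
  have "max_cut mods F.M = F.n * (eta - lam) / 4"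
  proof (rule F.max_cut_eq_if_sign_eigenvector)
    show "S \<subseteq> mods" using mods_eq by (auto simp: S_def)
    fix D assume "D \<in> mods"
    then obtain U where U: "U \<in> verts" "D = divisor U" using mods_eq by auto
    have UU: "U \<subseteq> points" "card U = s + 1" using U verts_props by auto
    have "(\<Sum>E\<in>mods. real_form (s + 1) 1 c D E * (if E \<in> S then 1 else -1))
        = (\<Sum>W\<in>verts. q U W * (if divisor W \<in> S then 1 else -1))"
      unfolding sum_mods U(2) using U(1) by (intro sum.cong HOL.refl) (simp only: real_form_divisor)
    also have "\<dots> = (\<Sum>W\<in>verts. 2 * real s * of_bool (1 \<in> W) - 2 * (of_bool (1 \<in> W) * real (card (U \<inter> W))) - q U W)"
      by (intro sum.cong HOL.refl) (simp add: mem algebra_simps)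
    also have "\<dots> = 2 * real s * K1 - 2 * (of_bool (1 \<in> U) * (K1 - K2) + real (s + 1) * K2) - eta"
    proof -
      have e: "card points = N" "s + 1 - 1 = s" "s + 1 - 2 = s - 1" by simp_all
      have c1: "(\<Sum>W\<in>verts. of_bool (1 \<in> W)) = K1"
        using sum_ksubsets_point[of points 1 "s + 1"] pt unfolding e by simp
      have c2: "(\<Sum>W\<in>verts. of_bool (1 \<in> W) * real (card (U \<inter> W)))
          = of_bool (1 \<in> U) * (K1 - K2) + real (s + 1) * K2"
        using sum_ksubsets_point_overlap[of points U 1 "s + 1"] pt UU s unfolding e by simp
      show ?thesis
        unfolding sum_subtractf sum_distrib_left[symmetric] c1 c2 row_sum_q[OF U(1), unfolded sum_subtractf] ..
    qed
    also have "\<dots> = lam * (2 * of_bool (1 \<in> U) - 1)"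
    proof -
      have "2 * real s * K1 - 2 * (real (s + 1) * K2) - eta = - lam"
        unfolding K1_eq K2_eq eta_def lam_def using assms
        by (simp add: divide_simps) (simp add: algebra_simps)
      then show ?thesis unfolding lam_eq by (simp add: algebra_simps)
    qed
    finally show "(\<Sum>E\<in>mods. real_form (s + 1) 1 c D E * (if E \<in> S then 1 else -1)) = lam * (if D \<in> S then 1 else -1)"
      using mem[OF U(1)] U(2) by simp
  qed
  then show ?thesis unfolding upper_A_eq divisor_mult_eq by simp
qed

text \<open>
  Half of the total weight is the fraction \<open>(1 + eta) / (eta - lam)\<close> of the upper bound, and
  \<open>- lam / (eta - lam) \<le> 6 / N\<close>. The last estimate amounts to \<open>(s + 1) c \<le> 6 s (c - 1)\<close>.
\<close>

lemma ratio_bounds: "1 - 6 / real N \<le> m_cut (s + 1) 1 c / upper_A r s" "m_cut (s + 1) 1 c / upper_A r s \<le> 1"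
proof -
  have u: "0 < upper_A r s"
    unfolding upper_A_eq using F.n_pos F.eta_pos F.lam_neg by (intro divide_pos_pos mult_pos_pos) auto
  show "m_cut (s + 1) 1 c / upper_A r s \<le> 1"
    using F.max_cut_le u unfolding divisor_mult_eq upper_A_eq by (simp add: divide_le_eq_1)
  have e: "real N * X \<le> 6 * (eta - lam)"
  proof -
    have "(real s + 1) * real c \<le> 6 * (real s * (real c - 1))"
    proof -
      \<comment> \<open>With \<open>s c \<ge> c\<close> and \<open>s c \<ge> 3 s\<close>, even \<open>3 s c\<close> dominates \<open>c + 6 s\<close>.\<close>
      have "1 * real c \<le> real s * real c" using s by (intro mult_right_mono) auto
      moreover have "real s * 3 \<le> real s * real c" using c by (intro mult_left_mono) auto
      ultimately show ?thesis by (simp add: algebra_simps)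
    qed
    then have "X * ((real s + 1) * real c) \<le> X * (6 * (real s * (real c - 1)))"
      using X_pos by (intro mult_left_mono) auto
    then show ?thesis unfolding card_eta_lam using c_pos by (simp add: N r divide_simps) (simp add: algebra_simps)
  qed
  have half: "real (card mods) * (1 + eta) / 4 \<le> m_cut (s + 1) 1 c"
    unfolding divisor_mult_eq by (rule F.max_cut_ge_half)
  have Np: "0 < real N" by (simp add: N r)
  have d: "0 < eta - lam" using F.eta_pos F.lam_neg by simp
  have "1 - 6 / real N \<le> (1 + eta) / (eta - lam)"
  proof -
    have "X / (eta - lam) \<le> 6 / real N" using e d Np by (simp add: divide_simps mult.commute)
    moreover have "1 - X / (eta - lam) \<le> (1 + eta) / (eta - lam)"
      using d by (simp add: divide_simps lam_def)
    ultimately show ?thesis by linarith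
  qed
  also have "(1 + eta) / (eta - lam) = real (card mods) * (1 + eta) / 4 / upper_A r s"
    unfolding upper_A_eq using F.n_pos by simp
  also have "\<dots> \<le> m_cut (s + 1) 1 c / upper_A r s"
    using half u by (intro divide_right_mono) auto
  finally show "1 - 6 / real N \<le> m_cut (s + 1) 1 c / upper_A r s" .
qed

lemma card_mods_le: "card mods \<le> 2 ^ N"
proof -
  have "card mods = N choose (s + 1)" unfolding mods_eq card_image[OF inj_divisor] card_verts ..
  then show ?thesis using binomial_le_pow2 by simp
qed

end

section \<open>Type D: subsets of odd size\<close>

lemma card_sym_diff:
  assumes "finite S" "finite T"
  shows "card (sym_diff S T) + 2 * card (S \<inter> T) = card S + card T"
proof -
  have "card (sym_diff S T) = card (S - T) + card (T - S)"
    using assms by (intro card_Un_disjoint) auto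
  moreover have "card (S - T) + card (S \<inter> T) = card S"
    using card_Int_Diff[OF assms(1), of T] by simp
  moreover have "card (T - S) + card (S \<inter> T) = card T"
    using card_Int_Diff[OF assms(2), of S] by (simp add: Int_commute)
  ultimately show ?thesis by simp
qed

lemma sym_diff_sym_diff: "sym_diff S (sym_diff S T) = T"
  by auto

text \<open>
  The divisor of a set \<open>S\<close> of size \<open>2 k + 1\<close> is \<open>k (H - \<Sum>E\<^sub>j) + \<Sum>\<^bsub>j \<in> S\<^esub> E\<^sub>j\<close>. In terms of half-spin
  weights, \<open>S\<close> records the positions of one of the two signs.
\<close>

locale type_D =
  fixes n r :: nat
  assumes n: "3 \<le> n" and r: "r = 2 + n"
begin

lemma n_le_r: "n \<le> r" and r_ge: "5 \<le> r"
  using n by (simp_all add: r)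

abbreviation points :: "nat set" where "points \<equiv> {1..r}"
definition verts :: "nat set set" where "verts = {S. S \<subseteq> points \<and> odd (card S)}"
abbreviation mods :: "(pic_basis \<Rightarrow> int) set" where "mods \<equiv> minus_one_divisors 2 2 n"

definition level :: "nat set \<Rightarrow> int" where "level S = int (card S div 2)"

definition divisor :: "nat set \<Rightarrow> pic_basis \<Rightarrow> int" where
  "divisor S x = (case x of
      Hyp i \<Rightarrow> if i = 1 then level S else 0
    | Exc j \<Rightarrow> if 1 \<le> j \<and> j \<le> r then of_bool (j \<in> S) - level S else 0)"

lemma vertsD: "S \<in> verts \<Longrightarrow> S \<subseteq> points" "S \<in> verts \<Longrightarrow> odd (card S)" "S \<in> verts \<Longrightarrow> finite S"
  using finite_subset by (auto simp: verts_def)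

lemma int_card_verts: "S \<in> verts \<Longrightarrow> int (card S) = 2 * level S + 1"
  using vertsD(2)[of S] by (auto simp: level_def elim: oddE)

lemma card_eq_sum_points: "S \<subseteq> points \<Longrightarrow> int (card S) = (\<Sum>x\<in>points. of_bool (x \<in> S))"
  by (simp add: of_bool_def sum.If_cases Int_absorb1)

lemma pic_form_divisor:
  assumes S: "S \<in> verts" and T: "T \<in> verts"
  shows "pic_form 2 2 n (divisor S) (divisor T) = level S + level T - int (card (S \<inter> T))"
proof -
  have "(\<Sum>j\<in>points. divisor S (Exc j) * divisor T (Exc j))
      = (\<Sum>j\<in>points. of_bool (j \<in> S \<inter> T) - level T * of_bool (j \<in> S) - level S * of_bool (j \<in> T) + level S * level T)"
    by (intro sum.cong) (auto simp: divisor_def algebra_simps)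
  also have "\<dots> = int (card (S \<inter> T)) - level T * int (card S) - level S * int (card T) + int r * (level S * level T)"
  proof -
    have "int (card (S \<inter> T)) = (\<Sum>x\<in>points. of_bool (x \<in> S \<inter> T))"
      using vertsD[OF S] by (intro card_eq_sum_points) auto
    then show ?thesis
      unfolding card_eq_sum_points[OF vertsD(1)[OF S]] card_eq_sum_points[OF vertsD(1)[OF T]]
      by (simp only: sum.distrib sum_subtractf sum_distrib_left sum_constant card_atLeastAtMost) simp
  qed
  finally have e: "(\<Sum>j\<in>points. divisor S (Exc j) * divisor T (Exc j))
      = int (card (S \<inter> T)) - level T * int (card S) - level S * int (card T) + int r * (level S * level T)" .
  have h: "divisor U (Hyp 1) = level U" for U by (simp add: divisor_def)
  have i: "{1..2 - 1} = {1::nat}" by auto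
  have ir: "int r = int n + 2" by (simp add: r)
  show ?thesis
    unfolding pic_form_alt r[symmetric] e i int_card_verts[OF S] int_card_verts[OF T] ir
    by (simp add: h[unfolded One_nat_def] algebra_simps)
qed

text \<open>
  The reflection in the root \<open>H - E\<^sub>1 - \<dots> - E\<^sub>n\<close> changes the last two signs of a half-spin weight when
  they agree.
\<close>

definition flip :: "nat set \<Rightarrow> nat set" where
  "flip S = {x. if (x = n + 1 \<or> x = n + 2) \<and> (n + 1 \<in> S \<longleftrightarrow> n + 2 \<in> S) then x \<notin> S else x \<in> S}"

lemma mem_flip: "x \<in> flip S \<longleftrightarrow>
    (if (x = n + 1 \<or> x = n + 2) \<and> (n + 1 \<in> S \<longleftrightarrow> n + 2 \<in> S) then x \<notin> S else x \<in> S)"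
  by (simp add: flip_def)

lemma flip_flip: "flip (flip S) = S"
proof (rule set_eqI)
  fix x
  show "x \<in> flip (flip S) \<longleftrightarrow> x \<in> S"
    by (cases "n + 1 \<in> S"; cases "n + 2 \<in> S"; cases "x = n + 1"; cases "x = n + 2") (simp_all add: mem_flip)
qed

lemma flip_subset: "S \<subseteq> points \<Longrightarrow> flip S \<subseteq> points"
  by (auto simp: mem_flip subset_iff r split: if_splits)

lemma sum_points_split: "(\<Sum>x\<in>points. f x) = (\<Sum>x = 1..n. f x) + f (n + 1) + f (n + 2)" for f :: "nat \<Rightarrow> int"
  by (simp add: r numeral_2_eq_2)

lemma card_flip:
  assumes "S \<subseteq> points"
  shows "int (card (flip S)) = int (card S) + 2 * (1 - of_bool (n + 1 \<in> S) - of_bool (n + 2 \<in> S))"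
proof -
  have "(\<Sum>x = 1..n. of_bool (x \<in> flip S)) = (\<Sum>x = 1..n. of_bool (x \<in> S) :: int)"
    by (intro sum.cong HOL.refl) (auto simp: mem_flip)
  then show ?thesis
    unfolding card_eq_sum_points[OF assms] card_eq_sum_points[OF flip_subset[OF assms]] sum_points_split
    by (auto simp: mem_flip)
qed

lemma flip_verts: "S \<in> verts \<Longrightarrow> flip S \<in> verts"
proof -
  assume S: "S \<in> verts"
  have "odd (int (card (flip S)))"
    unfolding card_flip[OF vertsD(1)[OF S]] using vertsD(2)[OF S] by simp
  then show ?thesis using flip_subset[OF vertsD(1)[OF S]] by (simp add: verts_def)
qed

lemma level_flip:
  assumes S: "S \<in> verts"
  shows "level (flip S) = level S + (1 - of_bool (n + 1 \<in> S) - of_bool (n + 2 \<in> S))"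
  using int_card_verts[OF S] int_card_verts[OF flip_verts[OF S]] card_flip[OF vertsD(1)[OF S]] by simp

lemma shift_verts: "S \<in> verts \<Longrightarrow> 1 \<le> i \<Longrightarrow> i < r \<Longrightarrow> shift i S \<in> verts"
  using shift_subset[of S r i] by (simp add: verts_def card_shift)

lemma level_shift: "level (shift i S) = level S"
  by (simp add: level_def card_shift)

lemma reflection_exc:
  assumes "1 \<le> i" "i < r"
  shows "reflection 2 2 n (exc_class i - exc_class (i + 1)) (divisor S) = divisor (shift i S)"
proof
  fix x
  have "pic_form 2 2 n (divisor S) (exc_class i - exc_class (i + 1)) = of_bool (i + 1 \<in> S) - of_bool (i \<in> S)"
  proof -
    have "i \<le> 2 + n - 1" using assms by (simp add: r)
    then show ?thesis
      using assms pic_form_simple_root(1)[of i 2 n 2 "divisor S"] by (simp add: divisor_def)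
  qed
  moreover have "divisor S x + (of_bool (i + 1 \<in> S) - of_bool (i \<in> S)) * (exc_class i - exc_class (i + 1)) x
      = divisor (shift i S) x"
    using assms by (cases x) (auto simp: divisor_def exc_class_def mem_shift level_shift)
  ultimately show "reflection 2 2 n (exc_class i - exc_class (i + 1)) (divisor S) x = divisor (shift i S) x"
    by (simp only: reflection_def)
qed

lemma reflection_mixed:
  assumes S: "S \<in> verts"
  shows "reflection 2 2 n (hyp_class 1 - (\<Sum>j = 1..n. exc_class j)) (divisor S) = divisor (flip S)"
proof
  fix x
  define t where "t = 1 - of_bool (n + 1 \<in> S) - (of_bool (n + 2 \<in> S) :: int)"
  have "(\<Sum>j = 1..n. divisor S (Exc j)) = (\<Sum>j = 1..n. of_bool (j \<in> S) - level S)"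
    using n_le_r by (intro sum.cong) (auto simp: divisor_def)
  also have "\<dots> = (\<Sum>j = 1..n. of_bool (j \<in> S)) - int n * level S"
    by (simp only: sum_subtractf sum_constant card_atLeastAtMost) simp
  also have "(\<Sum>j = 1..n. of_bool (j \<in> S)) = int (card S) - of_bool (n + 1 \<in> S) - of_bool (n + 2 \<in> S)"
    unfolding card_eq_sum_points[OF vertsD(1)[OF S]] sum_points_split by simp
  finally have e: "(\<Sum>j = 1..n. divisor S (Exc j)) = 2 * level S + t - int n * level S"
    unfolding int_card_verts[OF S] t_def by simp
  have h: "hyp_sum 2 (divisor S) = level S" "divisor S (Hyp 1) = level S"
    by (simp_all add: divisor_def)
  have "pic_form 2 2 n (divisor S) (hyp_class 1 - (\<Sum>j = 1..n. exc_class j)) = t"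
    unfolding pic_form_simple_root(2)[OF order.refl] h e by (simp add: algebra_simps)
  moreover have "divisor S x + t * (hyp_class 1 - (\<Sum>j = 1..n. exc_class j)) x = divisor (flip S) x"
  proof (cases x)
    case (Hyp i)
    have "(hyp_class 1 - (\<Sum>j = 1..n. exc_class j)) (Hyp i) = (if i = 1 then 1 else 0)"
      by (simp add: sum_exc_class_apply) (simp add: hyp_class_def)
    then show ?thesis unfolding Hyp by (simp add: divisor_def level_flip[OF S] t_def)
  next
    case (Exc j)
    have "(hyp_class 1 - (\<Sum>j = 1..n. exc_class j)) (Exc j) = (if 1 \<le> j \<and> j \<le> n then -1 else 0)"
      by (simp add: sum_exc_class_apply) (simp add: hyp_class_def)
    moreover have "1 \<le> j \<and> j \<le> r \<longleftrightarrow> (1 \<le> j \<and> j \<le> n) \<or> j = n + 1 \<or> j = n + 2" by (auto simp: r)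
    ultimately show ?thesis unfolding Exc by (auto simp: divisor_def level_flip[OF S] t_def mem_flip)
  qed
  ultimately show "reflection 2 2 n (hyp_class 1 - (\<Sum>j = 1..n. exc_class j)) (divisor S) x = divisor (flip S) x"
    by (simp only: reflection_def)
qed

lemma divisor_start: "divisor {r} = exc_class (2 + n)"
  unfolding r[symmetric] using r_ge
  by (intro ext) (auto simp: divisor_def exc_class_def level_def split: pic_basis.split)

lemma start_verts: "{r} \<in> verts" using r_ge by (simp add: verts_def)

text \<open>
  A shift moves an element up by one. When no shift applies, \<open>S\<close> is a final segment, and \<open>flip\<close>
  removes its two largest points unless it is \<open>{r}\<close>. The weight \<open>\<Sum>x\<in>S. r + 1 - x\<close> decreases in both
  cases.
\<close>

lemma divisor_mem: "S \<in> verts \<Longrightarrow> divisor S \<in> mods"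
proof (induction "\<Sum>x\<in>S. r + 1 - x" arbitrary: S rule: less_induct)
  case less
  have S: "S \<subseteq> points" "finite S" using vertsD[OF less.prems] by auto
  show ?case
  proof (cases "\<exists>i\<in>S. i < r \<and> i + 1 \<notin> S")
    case True
    then obtain i where i: "i \<in> S" "i < r" "i + 1 \<notin> S" by blast
    have i1: "1 \<le> i" using S i by auto
    have "divisor (shift i S) \<in> mods"
      using less.hyps[OF sum_shift_less[OF S(1) i]] shift_verts[OF less.prems i1 i(2)] by blast
    moreover have "exc_class i - exc_class (i + 1) \<in> simple_roots 2 2 n"
      unfolding simple_roots_def using i1 i(2) r by auto
    ultimately have "reflection 2 2 n (exc_class i - exc_class (i + 1)) (divisor (shift i S)) \<in> mods"
      by (intro reflection_mem_minus_one_divisors)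
    then show ?thesis using reflection_exc[OF i1 i(2)] by (simp add: shift_shift)
  next
    case False
    then have seg: "S = {r + 1 - card S..r}"
      using S by (intro upper_segment_unless_shiftable) auto
    show ?thesis
    proof (cases "card S = 1")
      case True
      then have "S = {r}" using seg by simp
      then show ?thesis using exc_class_mem_minus_one_divisors[of 2 n 2] divisor_start by simp
    next
      case False
      have "card S \<noteq> 2" "card S \<noteq> 0" using vertsD(2)[OF less.prems] by (metis even_numeral, metis even_zero)
      then have "3 \<le> card S" using False by linarith
      then have mem: "n + 1 \<in> S" "n + 2 \<in> S" by (subst seg, simp add: r)+
      then have fl: "flip S = S - {n + 1, n + 2}" 
        by (intro set_eqI) (auto simp: mem_flip split: if_splits)
      have "(\<Sum>x\<in>flip S. r + 1 - x) < (\<Sum>x\<in>S. r + 1 - x)"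
      proof (rule sum_strict_mono2)
        show "n + 1 \<in> S - flip S" using mem by (simp add: fl)
      qed (use S in \<open>auto simp: fl r\<close>)
      then have "divisor (flip S) \<in> mods"
        using less.hyps flip_verts[OF less.prems] by blast
      moreover have "hyp_class 1 - (\<Sum>j = 1..n. exc_class j) \<in> simple_roots 2 2 n"
        unfolding simple_roots_def by simp
      ultimately have "reflection 2 2 n (hyp_class 1 - (\<Sum>j = 1..n. exc_class j)) (divisor (flip S)) \<in> mods"
        by (intro reflection_mem_minus_one_divisors)
      then show ?thesis using reflection_mixed[OF flip_verts[OF less.prems]] by (simp only: flip_flip)
    qed
  qed
qed

lemma mods_eq: "mods = divisor ` verts"
proof (intro set_eqI iffI)
  fix D assume "D \<in> mods"
  then show "D \<in> divisor ` verts"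
  proof (induction rule: minus_one_divisors_induct)
    case exc
    show ?case using divisor_start start_verts by (metis image_eqI)
  next
    case (reflection \<alpha> D)
    obtain S where S: "S \<in> verts" "D = divisor S" using reflection by blast
    show ?case using reflection(1)
    proof (cases rule: simple_roots_cases)
      case (exc i)
      then have i: "1 \<le> i" "i < r" by (simp_all add: r)
      have "reflection 2 2 n \<alpha> D = divisor (shift i S)"
        unfolding exc(3) S(2) by (rule reflection_exc[OF i])
      then show ?thesis using shift_verts[OF S(1) i] by blast
    next
      case mixed
      have "reflection 2 2 n \<alpha> D = divisor (flip S)"
        unfolding mixed S(2) by (rule reflection_mixed[OF S(1)])
      then show ?thesis using flip_verts[OF S(1)] by blast
    next
      case (hyp i)
      then show ?thesis by simp
    qed
  qed
next
  fix D assume "D \<in> divisor ` verts"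
  then show "D \<in> mods" using divisor_mem by auto
qed

text \<open>
  The coordinates of a half-spin weight, scaled to \<open>\<plusminus>1\<close>.
\<close>

definition sgn_at :: "nat \<Rightarrow> nat set \<Rightarrow> real" where
  "sgn_at x S = (if x \<in> S then -1 else 1)"

definition ip :: "nat set \<Rightarrow> nat set \<Rightarrow> real" where
  "ip S T = (\<Sum>x\<in>points. sgn_at x S * sgn_at x T)"

abbreviation q :: "nat set \<Rightarrow> nat set \<Rightarrow> real" where
  "q S T \<equiv> real r / 4 - 1 - ip S T / 4"

lemma ip_eq:
  assumes "S \<subseteq> points" "T \<subseteq> points"
  shows "ip S T = real r - 2 * real (card (sym_diff S T))"
proof -
  have "ip S T = (\<Sum>x\<in>points. 1 - 2 * of_bool (x \<in> sym_diff S T))"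
    unfolding ip_def by (intro sum.cong) (auto simp: sgn_at_def)
  also have "\<dots> = real r - 2 * (\<Sum>x\<in>points. of_bool (x \<in> sym_diff S T))"
    by (simp add: sum_subtractf sum_distrib_left[symmetric] del: sum_of_bool_eq sum_mult_of_bool_eq Un_iff Diff_iff)
  also have "(\<Sum>x\<in>points. of_bool (x \<in> sym_diff S T) :: real) = real (card (sym_diff S T))"
  proof -
    have "(\<Sum>x\<in>points. of_bool (x \<in> U) :: real) = real (card U)" if "U \<subseteq> points" for U
      using that by (simp add: of_bool_def sum.If_cases Int_absorb1)
    moreover have "sym_diff S T \<subseteq> points" using assms by auto
    ultimately show ?thesis by blast
  qed
  finally show ?thesis .
qed

lemma q_eq:
  assumes "S \<in> verts" "T \<in> verts"
  shows "q S T = real (card (sym_diff S T)) / 2 - 1"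
  using ip_eq[OF vertsD(1)[OF assms(1)] vertsD(1)[OF assms(2)]] by (simp add: field_simps)

lemma real_form_divisor:
  assumes S: "S \<in> verts" and T: "T \<in> verts"
  shows "real_form 2 2 n (divisor S) (divisor T) = q S T"
proof -
  have "int (card (sym_diff S T)) + 2 * int (card (S \<inter> T)) = (2 * level S + 1) + (2 * level T + 1)"
    using card_sym_diff[OF vertsD(3)[OF S] vertsD(3)[OF T]] int_card_verts[OF S] int_card_verts[OF T]
    by linarith
  then have "2 * (level S + level T - int (card (S \<inter> T))) = int (card (sym_diff S T)) - 2"
    by (simp add: algebra_simps)
  then have "2 * real_of_int (level S + level T - int (card (S \<inter> T))) = real (card (sym_diff S T)) - 2"
    by (metis of_int_diff of_int_mult of_int_numeral of_int_of_nat_eq)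
  then show ?thesis unfolding pic_form_divisor[OF S T] q_eq[OF S T] by simp
qed

lemma even_sym_diff: "S \<in> verts \<Longrightarrow> T \<in> verts \<Longrightarrow> even (card (sym_diff S T))"
  using card_sym_diff[OF vertsD(3) vertsD(3), of S T] vertsD(2)[of S] vertsD(2)[of T]
  by (metis even_add even_mult_iff even_numeral)

lemma inj_divisor: "inj_on divisor verts"
proof (rule inj_onI)
  fix S T assume ST: "S \<in> verts" "T \<in> verts" and eq: "divisor S = divisor T"
  have "q S T = q S S" using real_form_divisor[OF ST] real_form_divisor[OF ST(1) ST(1)] eq by simp
  then have "card (sym_diff S T) = 0" unfolding q_eq[OF ST] q_eq[OF ST(1) ST(1)] by simp
  moreover have "finite (sym_diff S T)" using vertsD(3) ST by auto
  ultimately have "sym_diff S T = {}" by simp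
  then show "S = T" by auto
qed

lemma sum_mods: "(\<Sum>D\<in>mods. f D) = (\<Sum>U\<in>verts. f (divisor U))" for f :: "_ \<Rightarrow> real"
  unfolding mods_eq by (subst sum.reindex[OF inj_divisor]) simp

lemma finite_verts: "finite verts"
  unfolding verts_def by (rule finite_subset[of _ "Pow points"]) auto

lemma bij_sym_diff_verts:
  assumes P: "P \<subseteq> points"
  shows "bij_betw (sym_diff P) {W. W \<subseteq> points \<and> (odd (card W) \<longleftrightarrow> b)} {W. W \<subseteq> points \<and> (odd (card W) \<longleftrightarrow> (b \<noteq> odd (card P)))}"
proof (rule bij_betw_byWitness[where f' = "sym_diff P"])
  have fP: "finite P" using P finite_subset by auto
  have odd: "odd (card (sym_diff P W)) \<longleftrightarrow> (odd (card W) \<noteq> odd (card P))" if "W \<subseteq> points" for W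
  proof -
    have "finite W" using that finite_subset by auto
    then show ?thesis using card_sym_diff[OF fP, of W] by (metis even_add even_mult_iff even_numeral)
  qed
  show "sym_diff P ` {W. W \<subseteq> points \<and> (odd (card W) \<longleftrightarrow> b)} \<subseteq> {W. W \<subseteq> points \<and> (odd (card W) \<longleftrightarrow> (b \<noteq> odd (card P)))}"
    "sym_diff P ` {W. W \<subseteq> points \<and> (odd (card W) \<longleftrightarrow> (b \<noteq> odd (card P)))} \<subseteq> {W. W \<subseteq> points \<and> (odd (card W) \<longleftrightarrow> b)}"
    using odd P by auto
qed (unfold sym_diff_sym_diff, simp_all)

lemma verts_alt: "verts = {W. W \<subseteq> points \<and> (odd (card W) \<longleftrightarrow> True)}"
  by (simp add: verts_def)

text \<open>
  The symmetric difference with \<open>{1}\<close> matches the odd with the even subsets.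
\<close>

lemma card_verts: "card verts = 2 ^ (r - 1)"
proof -
  let ?E = "{W. W \<subseteq> points \<and> (odd (card W) \<longleftrightarrow> False)}"
  have "bij_betw (sym_diff {1}) verts ?E"
    using bij_sym_diff_verts[of "{1}" True] r_ge by (simp add: verts_alt)
  then have "card verts = card ?E" by (rule bij_betw_same_card)
  moreover have "card (Pow points) = card verts + card ?E"
  proof -
    have "Pow points = verts \<union> ?E" by (auto simp: verts_def)
    moreover have "finite ?E" by (rule finite_subset[of _ "Pow points"]) auto
    ultimately show ?thesis using finite_verts by (simp only:) (rule card_Un_disjoint, auto simp: verts_def)
  qed
  ultimately have "2 * card verts = 2 ^ r" by (simp add: card_Pow)
  also have "(2::nat) ^ r = 2 * 2 ^ (r - 1)" by (simp add: r flip: power_Suc)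
  finally show ?thesis by simp
qed

text \<open>
  Taking the symmetric difference with a set of even size permutes the vertices. With a two-element set
  that contains exactly one of the relevant coordinates this proves the orthogonality relations below.
\<close>

lemma sum_verts_flip:
  assumes P: "P \<subseteq> points" "even (card P)" and f: "\<And>W. f (sym_diff P W) = - f W"
  shows "(\<Sum>W\<in>verts. f W) = (0::real)"
proof -
  have "bij_betw (sym_diff P) verts verts"
    using bij_sym_diff_verts[OF P(1), of True] P(2) by (simp add: verts_alt)
  then have "(\<Sum>W\<in>verts. f W) = (\<Sum>W\<in>verts. f (sym_diff P W))"
    by (rule sum.reindex_bij_betw[symmetric])
  then show ?thesis by (simp add: f sum_negf)
qed

lemma sgn_at_sym_diff: "sgn_at x (sym_diff P W) = (if x \<in> P then - sgn_at x W else sgn_at x W)"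
  by (auto simp: sgn_at_def)

lemma sum_sgn_at: "x \<in> points \<Longrightarrow> (\<Sum>W\<in>verts. sgn_at x W) = 0"
proof -
  assume x: "x \<in> points"
  have "\<exists>y. y \<in> points \<and> y \<noteq> x" by (rule exI[of _ "if x = 1 then 2 else 1"]) (auto simp: r)
  then obtain y where y: "y \<in> points" "y \<noteq> x" by blast
  show ?thesis
    by (rule sum_verts_flip[of "{x, y}"]) (use x y in \<open>auto simp: sgn_at_sym_diff simp del: Un_iff Diff_iff\<close>)
qed

lemma sum_sgn_at_pair:
  assumes "x \<in> points" "y \<in> points"
  shows "(\<Sum>W\<in>verts. sgn_at x W * sgn_at y W) = (if x = y then 2 ^ (r - 1) else 0)"
proof (cases "x = y")
  case True
  have "(\<Sum>W\<in>verts. sgn_at x W * sgn_at y W) = (\<Sum>W\<in>verts. 1)"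
    unfolding True by (intro sum.cong) (auto simp: sgn_at_def)
  then show ?thesis using True by (simp add: card_verts)
next
  case False
  have "card (points - {x, y}) > 0" using assms False n by (simp add: card_Diff_subset r)
  then have "points - {x, y} \<noteq> {}" by (metis card.empty less_irrefl)
  then obtain z where z: "z \<in> points" "z \<noteq> x" "z \<noteq> y" by blast
  have "(\<Sum>W\<in>verts. sgn_at x W * sgn_at y W) = 0"
    by (rule sum_verts_flip[of "{x, z}"]) (use assms False z in \<open>auto simp: sgn_at_sym_diff simp del: Un_iff Diff_iff\<close>)
  then show ?thesis using False by simp
qed

abbreviation m :: real where "m \<equiv> 2 ^ (r - 1)"

lemma sum_sgn_ip:
  assumes "x \<in> points"
  shows "(\<Sum>W\<in>verts. sgn_at x W * ip S W) = m * sgn_at x S"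
proof -
  have "(\<Sum>W\<in>verts. sgn_at x W * ip S W) = (\<Sum>W\<in>verts. \<Sum>y\<in>points. sgn_at y S * (sgn_at x W * sgn_at y W))"
    unfolding ip_def sum_distrib_left by (simp only: mult_ac)
  also have "\<dots> = (\<Sum>y\<in>points. sgn_at y S * (\<Sum>W\<in>verts. sgn_at x W * sgn_at y W))"
    unfolding sum_distrib_left by (rule sum.swap)
  also have "\<dots> = (\<Sum>y\<in>points. if y = x then m * sgn_at x S else 0)"
    using assms by (intro sum.cong HOL.refl) (simp add: sum_sgn_at_pair)
  also have "\<dots> = m * sgn_at x S" using assms by simp
  finally show ?thesis .
qed

lemma sum_ip: "(\<Sum>W\<in>verts. ip S W) = 0"
proof -
  have "(\<Sum>W\<in>verts. ip S W) = (\<Sum>y\<in>points. sgn_at y S * (\<Sum>W\<in>verts. sgn_at y W))"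
    unfolding ip_def sum_distrib_left by (rule sum.swap)
  also have "\<dots> = (\<Sum>y\<in>points. 0)" by (intro sum.cong HOL.refl) (simp add: sum_sgn_at)
  finally show ?thesis by simp
qed

lemma sum_ip_ip: "(\<Sum>W\<in>verts. ip S W * ip T W) = m * ip S T"
proof -
  have "(\<Sum>W\<in>verts. ip S W * ip T W) = (\<Sum>W\<in>verts. \<Sum>x\<in>points. sgn_at x S * (sgn_at x W * ip T W))"
    unfolding ip_def[of S] sum_distrib_right by (simp only: mult_ac)
  also have "\<dots> = (\<Sum>x\<in>points. sgn_at x S * (\<Sum>W\<in>verts. sgn_at x W * ip T W))"
    unfolding sum_distrib_left by (rule sum.swap)
  also have "\<dots> = (\<Sum>x\<in>points. sgn_at x S * (m * sgn_at x T))"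
    by (intro sum.cong HOL.refl) (simp only: sum_sgn_ip)
  also have "\<dots> = m * ip S T"
    unfolding ip_def sum_distrib_left by (intro sum.cong HOL.refl) (simp only: mult_ac)
  finally show ?thesis .
qed

lemma ip_commute: "ip S T = ip T S"
  by (simp add: ip_def mult.commute)

definition lam :: real where "lam = - m / 4"
definition eta :: real where "eta = m * (real r / 4 - 1)"
definition beta :: real where "beta = m * (real r / 4 - 1)\<^sup>2 + m / 4 * (real r / 4 - 1)"

lemma row_sum_q: "(\<Sum>W\<in>verts. q S W) = eta"
proof -
  define c where "c = real r / 4 - 1"
  have "(\<Sum>W\<in>verts. c - ip S W / 4) = real (card verts) * c - (\<Sum>W\<in>verts. ip S W) / 4"
    by (simp add: sum_subtractf sum_divide_distrib)
  then show ?thesis by (simp add: sum_ip card_verts eta_def c_def)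
qed

lemma square_q: "(\<Sum>W\<in>verts. q S W * q W T) = lam * q S T + beta"
proof -
  let ?c = "real r / 4 - 1"
  have "(\<Sum>W\<in>verts. q S W * q W T) = (\<Sum>W\<in>verts. ?c\<^sup>2 - ?c / 4 * ip S W - ?c / 4 * ip T W + 1 / 16 * (ip S W * ip T W))"
  proof (intro sum.cong HOL.refl)
    fix W
    have "(c - a / 4) * (c - b / 4) = c\<^sup>2 - c / 4 * a - c / 4 * b + 1 / 16 * (a * b)" for a b c :: real
      by (simp add: power2_eq_square algebra_simps)
    then show "q S W * q W T = ?c\<^sup>2 - ?c / 4 * ip S W - ?c / 4 * ip T W + 1 / 16 * (ip S W * ip T W)"
      by (simp only: ip_commute[of W T])
  qed
  also have "\<dots> = m * ?c\<^sup>2 + 1 / 16 * (m * ip S T)"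
    unfolding sum.distrib sum_subtractf sum_distrib_left[symmetric] sum_ip sum_ip_ip by (simp add: card_verts)
  also have "\<dots> = lam * q S T + beta"
    by (simp add: lam_def beta_def field_simps)
  finally show ?thesis .
qed

lemma q_diag: "S \<in> verts \<Longrightarrow> q S S = -1"
  using q_eq[of S S] by simp

lemma q_nonneg:
  assumes "S \<in> verts" "T \<in> verts" "S \<noteq> T"
  shows "0 \<le> q S T"
proof -
  have "sym_diff S T \<noteq> {}" using assms by auto
  moreover have "finite (sym_diff S T)" using assms vertsD(3) by auto
  ultimately have "card (sym_diff S T) \<noteq> 0" by simp
  moreover have "card (sym_diff S T) \<noteq> 1" using even_sym_diff[OF assms(1,2)] by auto
  ultimately have "2 \<le> card (sym_diff S T)" by linarith
  then show ?thesis unfolding q_eq[OF assms(1,2)] by simp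
qed

lemma form: "two_eigenvalue_form mods (real_form 2 2 n) lam eta beta"
proof
  show "finite mods" unfolding mods_eq using finite_verts by simp
  show "mods \<noteq> {}" using exc_class_mem_minus_one_divisors by blast
  fix D D' assume D: "D \<in> mods"
  obtain S where S: "S \<in> verts" "D = divisor S" using D mods_eq by auto
  show "real_form 2 2 n D D = -1" using real_form_divisor[OF S(1) S(1)] q_diag[OF S(1)] S by simp
  show "(\<Sum>D'\<in>mods. real_form 2 2 n D D') = eta"
    unfolding sum_mods S(2) row_sum_q[of S, symmetric] by (intro sum.cong HOL.refl real_form_divisor S)
  assume D': "D' \<in> mods"
  obtain T where T: "T \<in> verts" "D' = divisor T" using D' mods_eq by auto
  show "real_form 2 2 n D D' = real_form 2 2 n D' D" by (simp only: pic_form_commute)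
  show "0 \<le> real_form 2 2 n D D'" if "D \<noteq> D'"
    using q_nonneg[OF S(1) T(1)] that unfolding S(2) T(2) real_form_divisor[OF S(1) T(1)] by auto
  show "(\<Sum>E\<in>mods. real_form 2 2 n D E * real_form 2 2 n E D') = lam * real_form 2 2 n D D' + beta"
  proof -
    have "(\<Sum>E\<in>mods. real_form 2 2 n D E * real_form 2 2 n E D') = (\<Sum>W\<in>verts. q S W * q W T)"
      unfolding sum_mods S(2) T(2) using S T by (intro sum.cong HOL.refl) (simp only: real_form_divisor)
    then show ?thesis using square_q[of S T] real_form_divisor[OF S(1) T(1)] S T by simp
  qed
next
  show "lam < 0" by (simp add: lam_def)
  show "0 < eta" using r_ge by (simp add: eta_def)
qed

sublocale F: two_eigenvalue_form mods "real_form 2 2 n" lam eta beta by (rule form)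

lemma card_mods: "real (card mods) = m"
  unfolding mods_eq card_image[OF inj_divisor] by (simp add: card_verts)

lemma m_eq: "m = 4 * 2 ^ (r - 3)"
proof -
  have "r - 1 = Suc (Suc (r - 3))" using n by (simp add: r)
  then show ?thesis by simp
qed

lemma lam_eq: "lam = - (2 ^ (r - 3))" unfolding lam_def m_eq by simp
lemma eta_eq: "eta = (real r - 4) * 2 ^ (r - 3)" unfolding eta_def m_eq by (simp add: algebra_simps)

lemma spectrum_values: "has_spectrum_values 2 2 n (- (2 ^ (r - 3))) ((real r - 4) * 2 ^ (r - 3))"
proof -
  \<comment> \<open>Hamming distances two and four from \<open>{1}\<close>, with intersection numbers 0 and 1.\<close>
  have v: "{1} \<in> verts" "{2} \<in> verts" "{2, 3, 4} \<in> verts" using r_ge by (auto simp: verts_def)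
  have qs: "q {1} {2} = 0" "q {1} {2, 3, 4} = 1"
  proof -
    have "sym_diff {1} {2} = {1, 2::nat}" "sym_diff {1} {2, 3, 4} = {1, 2, 3, 4::nat}" by auto
    then show "q {1} {2} = 0" "q {1} {2, 3, 4} = 1"
      unfolding q_eq[OF v(1,2)] q_eq[OF v(1,3)] by simp_all
  qed
  have "graph_spectrum mods F.M = {1 + lam, 1, 1 + eta}"
  proof (rule F.spectrum)
    show "divisor {1} \<in> mods" "divisor {2} \<in> mods" "divisor {2, 3, 4} \<in> mods" using v mods_eq by auto
    show "divisor {1} \<noteq> divisor {2}" "divisor {1} \<noteq> divisor {2, 3, 4}"
      using v by (simp_all add: inj_on_eq_iff[OF inj_divisor])
    show "real_form 2 2 n (divisor {1}) (divisor {2}) \<noteq> real_form 2 2 n (divisor {1}) (divisor {2, 3, 4})"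
      unfolding real_form_divisor[OF v(1,2)] real_form_divisor[OF v(1,3)] qs by simp
  qed
  then show ?thesis unfolding has_spectrum_values_def divisor_mult_eq lam_eq[symmetric] eta_eq[symmetric]
    using F.lam_neg F.eta_pos by simp
qed

lemma upper_D_eq: "upper_D r = real (card mods) * (eta - lam) / 4"
proof -
  have "2 * r - 6 = (r - 3) + (r - 3)" by simp
  then show ?thesis unfolding upper_D_def card_mods lam_eq eta_eq m_eq
    by (simp add: power_add algebra_simps)
qed

text \<open>
  The sign at the point 1 is an eigenvector for \<open>lam\<close> with entries \<open>\<plusminus>1\<close>.
\<close>

lemma max_cut_D_eq_upper: "m_cut 2 2 n = upper_D r"
proof -
  define C where "C = divisor ` {W \<in> verts. 1 \<notin> W}"
  have pt: "1 \<in> points" by (simp add: r)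
  have mem: "(if divisor W \<in> C then 1 else -1) = sgn_at 1 W" if "W \<in> verts" for W
    using that inj_divisor by (auto simp: C_def inj_on_eq_iff sgn_at_def)
  have "max_cut mods F.M = F.n * (eta - lam) / 4"
  proof (rule F.max_cut_eq_if_sign_eigenvector)
    show "C \<subseteq> mods" using mods_eq by (auto simp: C_def)
    fix D assume "D \<in> mods"
    then obtain S where S: "S \<in> verts" "D = divisor S" using mods_eq by auto
    have "(\<Sum>E\<in>mods. real_form 2 2 n D E * (if E \<in> C then 1 else -1)) = (\<Sum>W\<in>verts. q S W * sgn_at 1 W)"
      unfolding sum_mods S(2) using S(1) by (intro sum.cong HOL.refl) (simp only: real_form_divisor mem)
    also have "\<dots> = (\<Sum>W\<in>verts. (real r / 4 - 1) * sgn_at 1 W - 1 / 4 * (sgn_at 1 W * ip S W))"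
      by (intro sum.cong HOL.refl) (simp add: algebra_simps)
    also have "\<dots> = lam * sgn_at 1 S"
      unfolding sum_subtractf sum_distrib_left[symmetric] sum_sgn_at[OF pt] sum_sgn_ip[OF pt]
      by (simp add: lam_def)
    finally show "(\<Sum>E\<in>mods. real_form 2 2 n D E * (if E \<in> C then 1 else -1)) = lam * (if D \<in> C then 1 else -1)"
      using mem[OF S(1)] S(2) by simp
  qed
  then show ?thesis unfolding upper_D_eq divisor_mult_eq by simp
qed

lemma sum_verts_by_distance:
  fixes H :: "nat \<Rightarrow> real"
  assumes S: "S \<in> verts"
  shows "(\<Sum>W\<in>verts. H (card (sym_diff S W)))
      = H 0 + (\<Sum>k = 0..r div 2 - 1. real (r choose (2 * (k + 1))) * H (2 * (k + 1)))"
proof -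
  let ?E = "{W. W \<subseteq> points \<and> (odd (card W) \<longleftrightarrow> False)}"
  have finE: "finite ?E" by (rule finite_subset[of _ "Pow points"]) auto
  have "bij_betw (sym_diff S) ?E verts"
    using bij_sym_diff_verts[OF vertsD(1)[OF S], of False] vertsD(2)[OF S] by (simp add: verts_alt)
  then have "(\<Sum>W\<in>verts. H (card (sym_diff S W))) = (\<Sum>W\<in>?E. H (card (sym_diff S (sym_diff S W))))"
    by (rule sum.reindex_bij_betw[symmetric])
  also have "\<dots> = (\<Sum>W\<in>?E. H (card W))" by (simp only: sym_diff_sym_diff)
  also have "\<dots> = (\<Sum>j\<in>{j. j \<le> r \<and> even j}. \<Sum>W\<in>{W \<in> ?E. card W = j}. H (card W))"
  proof (rule sum.group[symmetric, OF finE])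
    show "card ` ?E \<subseteq> {j. j \<le> r \<and> even j}"
      using card_mono[of points] by auto
  qed simp
  also have "\<dots> = (\<Sum>j\<in>{j. j \<le> r \<and> even j}. real (r choose j) * H j)"
  proof (intro sum.cong HOL.refl)
    fix j assume "j \<in> {j. j \<le> r \<and> even j}"
    then have "{W \<in> ?E. card W = j} = {W. W \<subseteq> points \<and> card W = j}" by auto
    then show "(\<Sum>W\<in>{W \<in> ?E. card W = j}. H (card W)) = real (r choose j) * H j"
      using n_subsets[of points j] by simp
  qed
  also have "{j. j \<le> r \<and> even j} = insert 0 ((\<lambda>k. 2 * (k + 1)) ` {0..r div 2 - 1})"
  proof (intro set_eqI iffI)
    fix j assume j: "j \<in> {j. j \<le> r \<and> even j}"
    show "j \<in> insert 0 ((\<lambda>k. 2 * (k + 1)) ` {0..r div 2 - 1})"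
    proof (cases "j = 0")
      case False
      then have "j = 2 * ((j div 2 - 1) + 1)" "j div 2 - 1 \<in> {0..r div 2 - 1}" using j by auto
      then show ?thesis by blast
    qed simp
  qed (use n in \<open>auto simp: r\<close>)
  also have "(\<Sum>j\<in>insert 0 ((\<lambda>k. 2 * (k + 1)) ` {0..r div 2 - 1}). real (r choose j) * H j)
      = H 0 + (\<Sum>k = 0..r div 2 - 1. real (r choose (2 * (k + 1))) * H (2 * (k + 1)))"
    by (subst sum.insert) (auto simp: sum.reindex inj_on_def)
  finally show ?thesis .
qed

lemma cut_between_D: "cut_between 2 2 n (lower_D r) (upper_D r)"
proof (rule cut_between_rounding[OF form _ upper_D_eq])
  define H where "H h = (if h = 0 then 0 else (real h / 2 - 1) * (arccos (1 - 2 * real h / real r) / pi))" for h :: nat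
  let ?R = "\<Sum>k = 0..r div 2 - 1. real (r choose (2 * (k + 1))) * real k * arccos (1 - 4 * real (k + 1) / real r)"
  have r0: "0 < real r" by (simp add: r)
  have summand: "divisor_mult 2 2 n (divisor S) (divisor W) * (arccos (F.G (divisor S) (divisor W)) / pi) = H (card (sym_diff S W))"
    if S: "S \<in> verts" and W: "W \<in> verts" for S W
  proof -
    have eq: "divisor S = divisor W \<longleftrightarrow> card (sym_diff S W) = 0"
    proof -
      have "finite (sym_diff S W)" using S W vertsD(3) by auto
      then have "card (sym_diff S W) = 0 \<longleftrightarrow> sym_diff S W = {}" by simp
      also have "\<dots> \<longleftrightarrow> S = W" by auto
      finally show ?thesis using S W by (simp add: inj_on_eq_iff[OF inj_divisor])
    qed
    have "F.G (divisor S) (divisor W) = 1 - 2 * real (card (sym_diff S W)) / real r"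
      unfolding F.G_def card_mods real_form_divisor[OF S W] q_eq[OF S W]
      using r0 by (simp add: eta_def field_simps)
    then show ?thesis
      unfolding divisor_mult_eq real_form_divisor[OF S W] q_eq[OF S W] H_def eq by simp
  qed
  have "(\<Sum>U\<in>mods. \<Sum>V\<in>mods. divisor_mult 2 2 n U V * (arccos (F.G U V) / pi))
      = (\<Sum>S\<in>verts. \<Sum>W\<in>verts. H (card (sym_diff S W)))"
    unfolding sum_mods by (intro sum.cong HOL.refl summand)
  also have "\<dots> = (\<Sum>S\<in>verts. H 0 + (\<Sum>k = 0..r div 2 - 1. real (r choose (2 * (k + 1))) * H (2 * (k + 1))))"
    by (intro sum.cong HOL.refl sum_verts_by_distance)
  also have "\<dots> = (\<Sum>S\<in>verts. ?R / pi)"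
  proof (rule sum.cong[OF HOL.refl])
    have "H 0 = 0" by (simp add: H_def)
    moreover have "H (2 * (k + 1)) = real k * (arccos (1 - 4 * real (k + 1) / real r) / pi)" for k
    proof -
      have "real (2 * (k + 1)) / 2 - 1 = real k" "2 * real (2 * (k + 1)) = 4 * real (k + 1)" by (simp_all add: field_simps)
      then show ?thesis by (simp only: H_def) simp
    qed
    ultimately show "H 0 + (\<Sum>k = 0..r div 2 - 1. real (r choose (2 * (k + 1))) * H (2 * (k + 1))) = ?R / pi"
      by (simp only: sum_divide_distrib) (simp add: mult.assoc)
  qed
  finally have eq: "(\<Sum>U\<in>mods. \<Sum>V\<in>mods. divisor_mult 2 2 n U V * (arccos (F.G U V) / pi)) = m * (?R / pi)"
    by (simp add: card_verts)
  have "m = 2 * 2 ^ (r - 2)" by (simp add: r flip: power_Suc)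
  then show "lower_D r \<le> (1/2) * (\<Sum>U\<in>mods. \<Sum>V\<in>mods. divisor_mult 2 2 n U V * (arccos (F.G U V) / pi))"
    unfolding eq lower_D_def by simp
qed

lemma optimal_D:
  "(\<forall>V\<in>mods. pic_form 2 2 n (normalized_projection 2 2 n V) (\<lambda>x. real_of_int (canonical_class 2 2 n x)) = 0) \<and>
   projection_gram 2 2 n \<in> elliptope mods \<and>
   SD_value mods (divisor_mult 2 2 n) (projection_gram 2 2 n) = SD_opt mods (divisor_mult 2 2 n)"
proof (rule optimal_projection[OF form])
  have d: "proj_delta 2 2 n = 4" by (simp add: proj_delta_def)
  show "0 < proj_delta 2 2 n" unfolding d by simp
  show "0 \<le> real 2 * real n - real 2 - real n" using n by simp
  show "eta * proj_delta 2 2 n = (real 2 * real n - real 2 - real n) * real (card mods)"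
    unfolding d card_mods eta_def by (simp add: r algebra_simps)
qed simp_all

end

section \<open>Exceptional types: lists of lines\<close>

lemma reflection_reflection:
  assumes "2 \<le> a" "\<alpha> \<in> simple_roots a b c"
  shows "reflection a b c \<alpha> (reflection a b c \<alpha> D) = D"
proof
  fix x
  have "pic_form a b c (reflection a b c \<alpha> D) \<alpha> = - pic_form a b c D \<alpha>"
    unfolding reflection_def pic_form_add_left using simple_root_self[OF assms] by simp
  then show "reflection a b c \<alpha> (reflection a b c \<alpha> D) x = D x"
    by (simp add: reflection_def[of a b c \<alpha> "reflection a b c \<alpha> D"]) (simp add: reflection_def)
qed

text \<open>
  Properties of pairs that are invariant under simultaneous reflection may be checked when the first
  divisor is \<open>E\<^sub>r\<close>, because the Weyl group acts transitively.
\<close>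

lemma minus_one_divisors_pair_induct [consumes 3, case_names exc reflection]:
  assumes a: "2 \<le> a" and UV: "U \<in> minus_one_divisors a b c" "V \<in> minus_one_divisors a b c"
    and exc: "\<And>V. V \<in> minus_one_divisors a b c \<Longrightarrow> P (exc_class (b + c)) V"
    and step: "\<And>\<alpha> U V. \<alpha> \<in> simple_roots a b c \<Longrightarrow> U \<in> minus_one_divisors a b c \<Longrightarrow>
      V \<in> minus_one_divisors a b c \<Longrightarrow> P U V \<Longrightarrow> P (reflection a b c \<alpha> U) (reflection a b c \<alpha> V)"
  shows "P U V"
proof -
  have "\<forall>V\<in>minus_one_divisors a b c. P U V" using UV(1)
  proof (induction rule: minus_one_divisors_induct)
    case exc
    then show ?case using assms(4) by blast
  next
    case (reflection \<alpha> U)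
    show ?case
    proof
      fix V assume V: "V \<in> minus_one_divisors a b c"
      have "P (reflection a b c \<alpha> U) (reflection a b c \<alpha> (reflection a b c \<alpha> V))"
        using reflection reflection_mem_minus_one_divisors[OF reflection(1) V] by (intro step) auto
      then show "P (reflection a b c \<alpha> U) V" by (simp only: reflection_reflection[OF a reflection(1)])
    qed
  qed
  then show ?thesis using UV(2) by blast
qed

lemma bij_reflection:
  assumes "2 \<le> a" "\<alpha> \<in> simple_roots a b c"
  shows "bij_betw (reflection a b c \<alpha>) (minus_one_divisors a b c) (minus_one_divisors a b c)"
  using assms reflection_reflection reflection_mem_minus_one_divisors
  by (intro bij_betw_byWitness[where f' = "reflection a b c \<alpha>"]) auto

lemma sum_minus_one_divisors_reflection:
  assumes "2 \<le> a" "\<alpha> \<in> simple_roots a b c"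
  shows "(\<Sum>W\<in>minus_one_divisors a b c. f (reflection a b c \<alpha> W)) = (\<Sum>W\<in>minus_one_divisors a b c. f W)"
  by (rule sum.reindex_bij_betw[OF bij_reflection[OF assms]])

lemma row_sum_transitive:
  assumes a: "2 \<le> a" and U: "U \<in> minus_one_divisors a b c"
  shows "(\<Sum>W\<in>minus_one_divisors a b c. h (pic_form a b c U W))
    = (\<Sum>W\<in>minus_one_divisors a b c. h (pic_form a b c (exc_class (b + c)) W))"
  using U
proof (induction rule: minus_one_divisors_induct)
  case (reflection \<alpha> U)
  have "(\<Sum>W\<in>minus_one_divisors a b c. h (pic_form a b c (reflection a b c \<alpha> U) W))
      = (\<Sum>W\<in>minus_one_divisors a b c. h (pic_form a b c (reflection a b c \<alpha> U) (reflection a b c \<alpha> W)))"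
    using sum_minus_one_divisors_reflection[OF a reflection(1), where f = "\<lambda>W. h (pic_form a b c (reflection a b c \<alpha> U) W)"]
    by simp
  then show ?case using reflection(3) by (simp add: pic_form_reflection[OF a reflection(1)])
qed simp

lemma pic_form_weighted_sum_left:
  assumes "finite I"
  shows "(\<Sum>i\<in>I. t i * pic_form a b c (D i) F) = pic_form a b c (\<lambda>x. \<Sum>i\<in>I. t i * D i x) F"
proof -
  have "(\<Sum>i\<in>I. t i * pic_form a b c (D i) F) = (\<Sum>i\<in>I. pic_form a b c F (\<lambda>x. t i * D i x))"
    by (simp only: pic_form_scale_right pic_form_commute[of a b c F])
  also have "\<dots> = pic_form a b c F (\<Sum>i\<in>I. (\<lambda>x. t i * D i x))"
    by (rule pic_form_sum_right[OF assms, symmetric])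
  also have "(\<Sum>i\<in>I. (\<lambda>x. t i * D i x)) = (\<lambda>x. \<Sum>i\<in>I. t i * D i x)"
    by (rule ext) (rule sum_fun_apply)
  finally show ?thesis by (simp only: pic_form_commute)
qed

text \<open>
  Classes on a blow-up of the projective plane: a list \<open>[d, m\<^sub>1, \<dots>, m\<^sub>r]\<close> stands for
  \<open>d H + \<Sum> m\<^sub>j E\<^sub>j\<close>.
\<close>

definition class_of_list :: "nat \<Rightarrow> int list \<Rightarrow> pic_basis \<Rightarrow> int" where
  "class_of_list r l x = (case x of
      Hyp i \<Rightarrow> if i = 1 then l ! 0 else 0
    | Exc j \<Rightarrow> if 1 \<le> j \<and> j \<le> r then l ! j else 0)"

fun swap_at :: "nat \<Rightarrow> int list \<Rightarrow> int list" where
  "swap_at 0 (x # y # zs) = y # x # zs"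
| "swap_at (Suc i) (x # xs) = x # swap_at i xs"
| "swap_at _ xs = xs"

fun cremona :: "int list \<Rightarrow> int list" where
  "cremona (d # x # y # z # zs) = (let k = d + x + y + z in (d + k) # (x - k) # (y - k) # (z - k) # zs)"
| "cremona xs = xs"

text \<open>
  The simple reflections on lists: number \<open>0\<close> is the quadratic Cremona transformation at the first three
  points, number \<open>i > 0\<close> exchanges the coefficients \<open>i\<close> and \<open>i + 1\<close>.
\<close>

definition act :: "nat \<Rightarrow> int list \<Rightarrow> int list" where
  "act i l = (if i = 0 then cremona l else swap_at i l)"

text \<open>
  Each list is one reflection away from an earlier one. For a list of classes that begins with \<open>E\<^sub>r\<close>
  this certifies that all of them lie in the orbit.
\<close>

fun chained :: "nat \<Rightarrow> int list list \<Rightarrow> int list list \<Rightarrow> bool" where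
  "chained r known [] \<longleftrightarrow> True"
| "chained r known (l # ls) \<longleftrightarrow> list_ex (\<lambda>i. act i l \<in> set known) [0..<r] \<and> chained r (l # known) ls"

lemma nth_swap_at:
  "i + 1 < length l \<Longrightarrow> swap_at i l ! j = (if j = i then l ! (i + 1) else if j = i + 1 then l ! i else l ! j)"
proof (induction i l arbitrary: j rule: swap_at.induct)
  case (1 x y zs)
  then show ?case by (cases j; cases "j - 1") auto
next
  case (2 i x xs)
  then show ?case by (cases j) auto
qed auto

text \<open>
  A finite certificate for the orbit of \<open>E\<^sub>r\<close>. The hypotheses \<open>closed\<close> and \<open>chain\<close> give the two
  inclusions between the orbit and \<open>L\<close>. The entry \<open>- l ! r\<close> is the intersection number with \<open>E\<^sub>r\<close>, so
  \<open>moments\<close> says that \<open>\<Sum>\<^sub>W (E\<^sub>r \<cdot> W) W = lam E\<^sub>r + mu K\<close>, and \<open>total\<close> that the row sum is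
  \<open>|V| / \<delta>\<close> with \<open>\<delta> = 6 - b\<close>.
\<close>

locale line_list =
  fixes b r :: nat and L :: "int list list" and lam mu :: int
  assumes r: "r = b + 3" and b: "1 \<le> b" "b < 6"
    and len: "list_all (\<lambda>l. length l = r + 1) L"
    and distinct: "distinct L"
    and start: "L \<noteq> []" "hd L = replicate r 0 @ [1]"
    and closed: "list_all (\<lambda>l. list_all (\<lambda>i. act i l \<in> set L) [0..<r]) L"
    and chain: "chained r [hd L] (tl L)"
    and nonneg: "list_all (\<lambda>l. l ! r \<le> 0) (tl L)"
    and moments: "list_all (\<lambda>x. sum_list (map (\<lambda>l. - (l ! r) * l ! x) L)
        = lam * (if x = r then 1 else 0) + mu * (if x = 0 then -3 else 1)) [0..<r + 1]"
    and total: "int (6 - b) * sum_list (map (\<lambda>l. - (l ! r)) L) = int (length L)"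
    and lam: "lam < 0"
begin

abbreviation mods :: "(pic_basis \<Rightarrow> int) set" where "mods \<equiv> minus_one_divisors 2 b 3"
abbreviation cls :: "int list \<Rightarrow> pic_basis \<Rightarrow> int" where "cls \<equiv> class_of_list r"

lemma length_mem: "l \<in> set L \<Longrightarrow> length l = r + 1"
  using len by (simp add: list_all_iff)

lemma reflection_swap:
  assumes "1 \<le> i" "i < r" "length l = r + 1"
  shows "reflection 2 b 3 (exc_class i - exc_class (i + 1)) (cls l) = cls (swap_at i l)"
proof
  fix x
  have "i \<le> b + 3 - 1" using assms r by simp
  then have "pic_form 2 b 3 (cls l) (exc_class i - exc_class (i + 1)) = l ! (i + 1) - l ! i"
    using assms pic_form_simple_root(1)[of i b 3 2 "cls l"] by (simp add: class_of_list_def)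
  moreover have "cls l x + (l ! (i + 1) - l ! i) * (exc_class i - exc_class (i + 1)) x = cls (swap_at i l) x"
    using assms by (cases x) (auto simp: class_of_list_def exc_class_def nth_swap_at)
  ultimately show "reflection 2 b 3 (exc_class i - exc_class (i + 1)) (cls l) x = cls (swap_at i l) x"
    by (simp only: reflection_def)
qed

lemma reflection_cremona:
  assumes "length l = r + 1"
  shows "reflection 2 b 3 (hyp_class 1 - (\<Sum>j = 1..3. exc_class j)) (cls l) = cls (cremona l)"
proof
  fix p
  obtain d x y z zs where l: "l = d # x # y # z # zs"
    using assms r by (auto simp: length_Suc_conv numeral_3_eq_3)
  have r3: "3 \<le> r" using r by simp
  have one_three: "{1..3} = {1, 2, 3::nat}" by auto
  have "pic_form 2 b 3 (cls l) (hyp_class 1 - (\<Sum>j = 1..3. exc_class j))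
      = 2 * cls l (Hyp 1) - cls l (Hyp 1) + (cls l (Exc 1) + cls l (Exc 2) + cls l (Exc 3))"
    using pic_form_simple_root(2)[of 2 b 3 "cls l"] unfolding one_three by simp
  then have f: "pic_form 2 b 3 (cls l) (hyp_class 1 - (\<Sum>j = 1..3. exc_class j)) = d + x + y + z"
    using r3 by (simp add: class_of_list_def l numeral_2_eq_2 numeral_3_eq_3)
  have "cls l p + (d + x + y + z) * (hyp_class 1 - (\<Sum>j = 1..3. exc_class j)) p = cls (cremona l) p"
  proof (cases p)
    case (Hyp i)
    have "(hyp_class 1 - (\<Sum>j = 1..3. exc_class j)) (Hyp i) = (if i = 1 then 1 else 0)"
      by (simp add: sum_exc_class_apply) (simp add: hyp_class_def)
    then show ?thesis unfolding Hyp by (simp add: class_of_list_def l Let_def)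
  next
    case (Exc j)
    have e: "(hyp_class 1 - (\<Sum>j = 1..3. exc_class j)) (Exc j) = (if 1 \<le> j \<and> j \<le> 3 then -1 else 0)"
      by (simp add: sum_exc_class_apply) (simp add: hyp_class_def)
    consider "j = 0" | "j = 1" | "j = 2" | "j = 3" | k where "j = Suc (Suc (Suc (Suc k)))"
      by (metis One_nat_def Suc_1 numeral_3_eq_3 not0_implies_Suc)
    then show ?thesis unfolding Exc e using r3
      by cases (simp_all add: class_of_list_def l Let_def numeral_2_eq_2 numeral_3_eq_3)
  qed
  then show "reflection 2 b 3 (hyp_class 1 - (\<Sum>j = 1..3. exc_class j)) (cls l) p = cls (cremona l) p"
    by (simp only: reflection_def f)
qed

lemma reflection_act:
  assumes "i < r"
  obtains \<alpha> where "\<alpha> \<in> simple_roots 2 b 3" "\<And>l. length l = r + 1 \<Longrightarrow> reflection 2 b 3 \<alpha> (cls l) = cls (act i l)"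
proof (cases "i = 0")
  case True
  have "hyp_class 1 - (\<Sum>j = 1..3. exc_class j) \<in> simple_roots 2 b 3" unfolding simple_roots_def by simp
  then show ?thesis using that reflection_cremona True by (simp add: act_def)
next
  case False
  then have i: "1 \<le> i" "i < r" "i \<le> b + 3 - 1" using assms r by auto
  then have "exc_class i - exc_class (i + 1) \<in> simple_roots 2 b 3" unfolding simple_roots_def by blast
  then show ?thesis using that reflection_swap[OF i(1,2)] False by (simp add: act_def)
qed

lemma cls_start: "cls (hd L) = exc_class (b + 3)"
proof
  fix x
  show "cls (hd L) x = exc_class (b + 3) x"
    using r by (cases x) (auto simp: start(2) class_of_list_def exc_class_def nth_append)
qed

lemma cls_mem_if_chained:
  assumes "chained r known ls" "\<forall>l\<in>set known. cls l \<in> mods" "\<forall>l\<in>set ls. length l = r + 1"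
  shows "\<forall>l\<in>set ls. cls l \<in> mods"
  using assms
proof (induction ls arbitrary: known)
  case (Cons l ls)
  have "list_ex (\<lambda>i. act i l \<in> set known) [0..<r]" using Cons.prems(1) by (simp only: chained.simps)
  then obtain i where i: "i < r" "act i l \<in> set known" unfolding list_ex_iff by auto
  have "length l = r + 1" using Cons.prems(3) by simp
  then obtain \<alpha> where \<alpha>: "\<alpha> \<in> simple_roots 2 b 3" "reflection 2 b 3 \<alpha> (cls l) = cls (act i l)"
    using reflection_act[OF i(1)] by blast
  have "cls (act i l) \<in> mods" using i(2) Cons.prems(2) by (rule bspec[rotated])
  then have "reflection 2 b 3 \<alpha> (cls (act i l)) \<in> mods"
    by (rule reflection_mem_minus_one_divisors[OF \<alpha>(1)])
  moreover have "reflection 2 b 3 \<alpha> (cls (act i l)) = cls l"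
    unfolding \<alpha>(2)[symmetric] by (rule reflection_reflection[OF order.refl \<alpha>(1)])
  ultimately have "cls l \<in> mods" by simp
  then have known: "\<forall>l\<in>set (l # known). cls l \<in> mods" using Cons.prems(2) by simp
  have "chained r (l # known) ls" using Cons.prems(1) by (simp only: chained.simps)
  moreover have "\<forall>l\<in>set ls. length l = r + 1" using Cons.prems(3) by simp
  ultimately have "\<forall>l\<in>set ls. cls l \<in> mods" by (intro Cons.IH[OF _ known])
  then show ?case using known by simp
qed simp

lemma mods_eq: "mods = cls ` set L"
proof (intro set_eqI iffI)
  fix D assume "D \<in> mods"
  then show "D \<in> cls ` set L"
  proof (induction rule: minus_one_divisors_induct)
    case exc
    show ?case unfolding cls_start[symmetric] using start(1) by (intro imageI hd_in_set)
  next
    case (reflection \<alpha> D)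
    obtain l where l: "l \<in> set L" "D = cls l" using reflection by blast
    have ex: "\<exists>i<r. reflection 2 b 3 \<alpha> (cls l) = cls (act i l)"
      using reflection(1)
    proof (cases rule: simple_roots_cases)
      case (exc i)
      then have "i < r" "1 \<le> i" using r by auto
      then show ?thesis using reflection_swap[of i l] length_mem[OF l(1)] exc(3)
        by (intro exI[of _ i]) (simp add: act_def)
    next
      case mixed
      then show ?thesis using reflection_cremona[OF length_mem[OF l(1)]] r
        by (intro exI[of _ 0]) (simp add: act_def)
    qed simp
    then obtain i where i: "i < r" "reflection 2 b 3 \<alpha> (cls l) = cls (act i l)" by blast
    then have "act i l \<in> set L" using closed l(1) by (simp add: list_all_iff)
    then show ?case unfolding l(2) i(2) by (rule imageI)
  qed
next
  fix D assume "D \<in> cls ` set L"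
  moreover have "\<forall>l\<in>set (tl L). cls l \<in> mods"
  proof (rule cls_mem_if_chained[OF chain])
    show "\<forall>l\<in>set [hd L]. cls l \<in> mods"
      using exc_class_mem_minus_one_divisors[of b 3 2] by (simp add: cls_start)
    show "\<forall>l\<in>set (tl L). length l = r + 1" using length_mem start(1) by (simp add: list.set_sel(2))
  qed
  moreover have "cls (hd L) \<in> mods" using exc_class_mem_minus_one_divisors[of b 3 2] by (simp add: cls_start)
  moreover have "set L = insert (hd L) (set (tl L))" using start(1) by (cases L) auto
  ultimately show "D \<in> mods" by auto
qed

lemma inj_cls: "inj_on cls (set L)"
proof (rule inj_onI)
  fix l l' assume l: "l \<in> set L" "l' \<in> set L" and eq: "cls l = cls l'"
  show "l = l'"
  proof (rule nth_equalityI)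
    show "length l = length l'" using length_mem l by simp
    fix j assume "j < length l"
    then have "j \<le> r" using length_mem[OF l(1)] by simp
    show "l ! j = l' ! j"
    proof (cases "j = 0")
      case True
      then show ?thesis using fun_cong[OF eq, of "Hyp 1"] by (simp add: class_of_list_def)
    next
      case False
      then show ?thesis using fun_cong[OF eq, of "Exc j"] \<open>j \<le> r\<close> by (simp add: class_of_list_def)
    qed
  qed
qed

lemma sum_mods: "(\<Sum>D\<in>mods. f D) = sum_list (map (\<lambda>l. f (cls l)) L)"
  unfolding mods_eq sum.reindex[OF inj_cls] by (simp add: sum.distinct_set_conv_list[OF distinct])

lemma exc_form: "pic_form 2 b 3 (exc_class (b + 3)) (cls l) = - (l ! r)"
proof -
  have "pic_form 2 b 3 (exc_class (b + 3)) (cls l) = - cls l (Exc (b + 3))"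
    unfolding pic_form_commute[of 2 b 3 "exc_class (b + 3)"] by (rule pic_form_exc_right) auto
  then show ?thesis by (simp add: class_of_list_def r)
qed

lemma card_mods: "card mods = length L"
  unfolding mods_eq card_image[OF inj_cls] by (rule distinct_card[OF distinct])

lemma row_sum_list:
  "U \<in> mods \<Longrightarrow> (\<Sum>W\<in>mods. h (pic_form 2 b 3 U W)) = sum_list (map (\<lambda>l. h (- (l ! r))) L)"
  by (subst row_sum_transitive) (simp_all only: sum_mods exc_form)

lemma finite_mods: "finite mods" unfolding mods_eq by simp

lemma moment_class:
  "(\<lambda>x. \<Sum>W\<in>mods. pic_form 2 b 3 (exc_class (b + 3)) W * W x)
     = (\<lambda>x. lam * exc_class (b + 3) x + mu * canonical_class 2 b 3 x)"
proof
  fix x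
  have m: "sum_list (map (\<lambda>l. - (l ! r) * l ! j) L) = lam * (if j = r then 1 else 0) + mu * (if j = 0 then -3 else 1)"
    if "j \<le> r" for j by (rule moments[unfolded list_all_iff, THEN bspec]) (use that in auto)
  have z: "sum_list (map (\<lambda>l. - (l ! r) * 0) L) = 0" by (induction L) auto
  show "(\<Sum>W\<in>mods. pic_form 2 b 3 (exc_class (b + 3)) W * W x) = lam * exc_class (b + 3) x + mu * canonical_class 2 b 3 x"
  proof (cases x)
    case (Hyp i)
    show ?thesis
    proof (cases "i = 1")
      case True
      then show ?thesis unfolding Hyp sum_mods exc_form using m[of 0] r
        by (simp add: class_of_list_def canonical_class_apply exc_class_def)
    next
      case False
      have "canonical_class 2 b 3 (Hyp i) = 0" using False by (auto simp: canonical_class_apply)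
      then show ?thesis unfolding Hyp sum_mods exc_form using z False
        by (simp add: class_of_list_def exc_class_def)
    qed
  next
    case (Exc j)
    show ?thesis
    proof (cases "1 \<le> j \<and> j \<le> r")
      case True
      then show ?thesis unfolding Exc sum_mods exc_form using m[of j] r
        by (simp add: class_of_list_def canonical_class_apply exc_class_def)
    next
      case False
      have "canonical_class 2 b 3 (Exc j) = 0" using False r by (auto simp: canonical_class_apply)
      moreover have "exc_class (b + 3) (Exc j) = 0" using False r by (auto simp: exc_class_def)
      moreover have "cls l (Exc j) = 0" for l using False by (auto simp: class_of_list_def)
      ultimately show ?thesis unfolding Exc sum_mods exc_form using z by simp
    qed
  qed
qed

text \<open>
  By transitivity it is enough to take \<open>U = E\<^sub>r\<close>. Then \<open>moment_class\<close> gives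
  \<open>\<Sum>\<^sub>W (E\<^sub>r \<cdot> W) (W \<cdot> V) = lam (E\<^sub>r \<cdot> V) + mu (K \<cdot> V)\<close>, and \<open>K \<cdot> V = -1\<close>.
\<close>

lemma square_sum:
  assumes U: "U \<in> mods" and V: "V \<in> mods"
  shows "(\<Sum>W\<in>mods. pic_form 2 b 3 U W * pic_form 2 b 3 W V) = lam * pic_form 2 b 3 U V - mu"
  using order.refl U V
proof (induction rule: minus_one_divisors_pair_induct)
  case (exc V)
  have "pic_form 2 b 3 (canonical_class 2 b 3) V = -1"
    using pic_form_minus_one_divisor_canonical[of 2 b 3 V] exc by (simp add: pic_form_commute)
  then show ?case
    unfolding pic_form_weighted_sum_left[OF finite_mods] moment_class pic_form_add_left pic_form_scale_left
    by simp
next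
  case (reflection \<alpha> U V)
  have "(\<Sum>W\<in>mods. pic_form 2 b 3 (reflection 2 b 3 \<alpha> U) W * pic_form 2 b 3 W (reflection 2 b 3 \<alpha> V))
      = (\<Sum>W\<in>mods. pic_form 2 b 3 (reflection 2 b 3 \<alpha> U) (reflection 2 b 3 \<alpha> W)
          * pic_form 2 b 3 (reflection 2 b 3 \<alpha> W) (reflection 2 b 3 \<alpha> V))"
    by (rule sum_minus_one_divisors_reflection[symmetric]) (use reflection(1) in auto)
  then show ?case using reflection by (simp add: pic_form_reflection)
qed

lemma pic_form_nonneg:
  assumes U: "U \<in> mods" and V: "V \<in> mods" and ne: "U \<noteq> V"
  shows "0 \<le> pic_form 2 b 3 U V"
proof -
  have "U \<noteq> V \<longrightarrow> 0 \<le> pic_form 2 b 3 U V" using order.refl U V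
  proof (induction rule: minus_one_divisors_pair_induct)
    case (exc V)
    then obtain l where l: "l \<in> set L" "V = cls l" unfolding mods_eq by blast
    show ?case
    proof
      assume "exc_class (b + 3) \<noteq> V"
      then have "l \<noteq> hd L" using cls_start l by metis
      then have "l \<in> set (tl L)" using l(1) start(1) by (cases L) auto
      then show "0 \<le> pic_form 2 b 3 (exc_class (b + 3)) V" unfolding l(2) exc_form
        using nonneg by (auto simp: list_all_iff)
    qed
  next
    case (reflection \<alpha> U V)
    then show ?case by (auto simp: pic_form_reflection)
  qed
  then show ?thesis using ne by blast
qed

definition eta :: int where "eta = sum_list (map (\<lambda>l. - (l ! r)) L)"

lemma eta_total: "int (6 - b) * eta = int (length L)"
  using total by (simp add: eta_def)

lemma eta_pos: "0 < eta"
proof -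
  have "0 < int (6 - b) * eta" unfolding eta_total using start(1) by simp
  then show ?thesis using b by (simp add: zero_less_mult_iff)
qed

lemma form: "two_eigenvalue_form mods (real_form 2 b 3) (real_of_int lam) (real_of_int eta) (real_of_int (- mu))"
proof
  show "finite mods" by (rule finite_mods)
  show "mods \<noteq> {}" using exc_class_mem_minus_one_divisors by blast
  fix D D' assume D: "D \<in> mods"
  show "real_form 2 b 3 D D = -1" using minus_one_divisor_self[of 2 b 3 D] D by simp
  show "(\<Sum>D'\<in>mods. real_form 2 b 3 D D') = real_of_int eta"
    unfolding of_int_sum[symmetric] eta_def using row_sum_list[OF D, of "\<lambda>t. t"] by simp
  assume D': "D' \<in> mods"
  show "real_form 2 b 3 D D' = real_form 2 b 3 D' D" by (simp only: pic_form_commute)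
  show "0 \<le> real_form 2 b 3 D D'" if "D \<noteq> D'" using pic_form_nonneg[OF D D' that] by simp
  show "(\<Sum>E\<in>mods. real_form 2 b 3 D E * real_form 2 b 3 E D')
      = real_of_int lam * real_form 2 b 3 D D' + real_of_int (- mu)"
  proof -
    have "(\<Sum>E\<in>mods. real_form 2 b 3 D E * real_form 2 b 3 E D')
        = real_of_int (\<Sum>E\<in>mods. pic_form 2 b 3 D E * pic_form 2 b 3 E D')"
      by simp
    then show ?thesis unfolding square_sum[OF D D'] by simp
  qed
next
  show "real_of_int lam < 0" using lam by simp
  show "0 < real_of_int eta" using eta_pos by simp
qed

sublocale F: two_eigenvalue_form mods "real_form 2 b 3" "real_of_int lam" "real_of_int eta" "real_of_int (- mu)"
  by (rule form)

lemma optimal_line_list: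
  "(\<forall>V\<in>mods. pic_form 2 b 3 (normalized_projection 2 b 3 V) (\<lambda>x. real_of_int (canonical_class 2 b 3 x)) = 0) \<and>
   projection_gram 2 b 3 \<in> elliptope mods \<and>
   SD_value mods (divisor_mult 2 b 3) (projection_gram 2 b 3) = SD_opt mods (divisor_mult 2 b 3)"
proof (rule optimal_projection[OF form])
  have d: "proj_delta 2 b 3 = real (6 - b)" using b by (simp add: proj_delta_def of_nat_diff)
  show "0 < proj_delta 2 b 3" unfolding d using b by simp
  show "real_of_int eta * proj_delta 2 b 3 = (real 2 * real 3 - real 2 - real 3) * real (card mods)"
    unfolding d card_mods using arg_cong[OF eta_total, of real_of_int] by (simp add: mult.commute)
qed simp_all

lemma spectrum_values:
  assumes "list_ex (\<lambda>l. l ! r = 0) L" "list_ex (\<lambda>l. l ! r = -1) L"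
  shows "has_spectrum_values 2 b 3 (real_of_int lam) (real_of_int eta)"
proof -
  obtain l l' where l: "l \<in> set L" "l ! r = 0" "l' \<in> set L" "l' ! r = -1"
    using assms by (auto simp: list_ex_iff)
  let ?e = "exc_class (b + 3)"
  have e: "?e \<in> mods" by (rule exc_class_mem_minus_one_divisors)
  have ee: "pic_form 2 b 3 ?e ?e = -1" using minus_one_divisor_self[of 2 b 3, OF _ _ e] by simp
  have v: "cls l \<in> mods" "cls l' \<in> mods" using l mods_eq by auto
  have f: "pic_form 2 b 3 ?e (cls l) = 0" "pic_form 2 b 3 ?e (cls l') = 1" using l by (simp_all add: exc_form)
  have "graph_spectrum mods F.M = {1 + real_of_int lam, 1, 1 + real_of_int eta}"
  proof (rule F.spectrum[OF e v])
    show "?e \<noteq> cls l" "?e \<noteq> cls l'" using ee f by auto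
    show "real_form 2 b 3 ?e (cls l) \<noteq> real_form 2 b 3 ?e (cls l')" using f by simp
  qed
  then show ?thesis unfolding has_spectrum_values_def divisor_mult_eq
    using F.lam_neg F.eta_pos by simp
qed

text \<open>
  Both the weight and the angle of a pair depend only on its intersection number, so by transitivity the
  row of \<open>E\<^sub>r\<close> determines the sum. The number -1 occurs exactly on the diagonal.
\<close>

lemma rounding_sum:
  "(\<Sum>U\<in>mods. \<Sum>V\<in>mods. divisor_mult 2 b 3 U V * (arccos (F.G U V) / pi))
    = real (length L) * sum_list (map (\<lambda>t. (if t = -1 then 0 else real_of_int t)
        * (arccos ((1 / real (6 - b) - real_of_int t) / (1 + 1 / real (6 - b))) / pi)) (map (\<lambda>l. - (l ! r)) L))"
    (is "_ = _ * sum_list (map ?h _)")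
proof -
  have ratio: "real_of_int eta / F.n = 1 / real (6 - b)"
    unfolding card_mods using arg_cong[OF eta_total, of real_of_int] b eta_pos start(1)
    by (simp add: divide_simps mult.commute)
  have eq: "U = V \<longleftrightarrow> pic_form 2 b 3 U V = -1" if "U \<in> mods" "V \<in> mods" for U V
  proof
    assume "pic_form 2 b 3 U V = -1"
    then show "U = V" using pic_form_nonneg[OF that] by (cases "U = V") auto
  next
    assume "U = V"
    then show "pic_form 2 b 3 U V = -1" using minus_one_divisor_self[of 2 b 3 V] that by simp
  qed
  have "divisor_mult 2 b 3 U V * (arccos (F.G U V) / pi) = ?h (pic_form 2 b 3 U V)"
    if "U \<in> mods" "V \<in> mods" for U V
    unfolding F.G_def ratio divisor_mult_eq using eq[OF that] by simp
  then have "(\<Sum>U\<in>mods. \<Sum>V\<in>mods. divisor_mult 2 b 3 U V * (arccos (F.G U V) / pi))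
      = (\<Sum>U\<in>mods. \<Sum>V\<in>mods. ?h (pic_form 2 b 3 U V))"
    by (intro sum.cong HOL.refl) auto
  also have "\<dots> = (\<Sum>U\<in>mods. sum_list (map (\<lambda>l. ?h (- (l ! r))) L))"
    by (rule sum.cong[OF HOL.refl], rule row_sum_list[of _ ?h])
  finally show ?thesis by (simp add: card_mods comp_def)
qed

end

definition lines_E6 :: "int list list" where
  "lines_E6 = [
     [0, 0, 0, 0, 0, 0, 1], [0, 0, 0, 0, 0, 1, 0], [0, 0, 0, 0, 1, 0, 0], [0, 0, 0, 1, 0, 0, 0],
     [1, -1, -1, 0, 0, 0, 0], [0, 0, 1, 0, 0, 0, 0], [1, -1, 0, -1, 0, 0, 0], [0, 1, 0, 0, 0, 0, 0],
     [1, 0, -1, -1, 0, 0, 0], [1, -1, 0, 0, -1, 0, 0], [1, 0, -1, 0, -1, 0, 0], [1, -1, 0, 0, 0, -1, 0],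
     [1, 0, 0, -1, -1, 0, 0], [1, 0, -1, 0, 0, -1, 0], [1, -1, 0, 0, 0, 0, -1], [1, 0, 0, -1, 0, -1, 0],
     [1, 0, -1, 0, 0, 0, -1], [1, 0, 0, 0, -1, -1, 0], [1, 0, 0, -1, 0, 0, -1], [2, -1, -1, -1, -1, -1, 0],
     [1, 0, 0, 0, -1, 0, -1], [2, -1, -1, -1, -1, 0, -1], [1, 0, 0, 0, 0, -1, -1], [2, -1, -1, -1, 0, -1, -1],
     [2, -1, -1, 0, -1, -1, -1], [2, -1, 0, -1, -1, -1, -1], [2, 0, -1, -1, -1, -1, -1]]"

definition lines_E7 :: "int list list" where
  "lines_E7 = [
     [0, 0, 0, 0, 0, 0, 0, 1], [0, 0, 0, 0, 0, 0, 1, 0], [0, 0, 0, 0, 0, 1, 0, 0], [0, 0, 0, 0, 1, 0, 0, 0],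
     [0, 0, 0, 1, 0, 0, 0, 0], [1, -1, -1, 0, 0, 0, 0, 0], [0, 0, 1, 0, 0, 0, 0, 0], [1, -1, 0, -1, 0, 0, 0, 0],
     [0, 1, 0, 0, 0, 0, 0, 0], [1, 0, -1, -1, 0, 0, 0, 0], [1, -1, 0, 0, -1, 0, 0, 0], [1, 0, -1, 0, -1, 0, 0, 0],
     [1, -1, 0, 0, 0, -1, 0, 0], [1, 0, 0, -1, -1, 0, 0, 0], [1, 0, -1, 0, 0, -1, 0, 0], [1, -1, 0, 0, 0, 0, -1, 0],
     [1, 0, 0, -1, 0, -1, 0, 0], [1, 0, -1, 0, 0, 0, -1, 0], [1, -1, 0, 0, 0, 0, 0, -1], [1, 0, 0, 0, -1, -1, 0, 0],
     [1, 0, 0, -1, 0, 0, -1, 0], [1, 0, -1, 0, 0, 0, 0, -1], [2, -1, -1, -1, -1, -1, 0, 0], [1, 0, 0, 0, -1, 0, -1, 0],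
     [1, 0, 0, -1, 0, 0, 0, -1], [2, -1, -1, -1, -1, 0, -1, 0], [1, 0, 0, 0, 0, -1, -1, 0], [1, 0, 0, 0, -1, 0, 0, -1],
     [2, -1, -1, -1, 0, -1, -1, 0], [2, -1, -1, -1, -1, 0, 0, -1], [1, 0, 0, 0, 0, -1, 0, -1], [2, -1, -1, 0, -1, -1, -1, 0],
     [2, -1, -1, -1, 0, -1, 0, -1], [1, 0, 0, 0, 0, 0, -1, -1], [2, -1, 0, -1, -1, -1, -1, 0], [2, -1, -1, 0, -1, -1, 0, -1],
     [2, -1, -1, -1, 0, 0, -1, -1], [2, 0, -1, -1, -1, -1, -1, 0], [2, -1, 0, -1, -1, -1, 0, -1], [2, -1, -1, 0, -1, 0, -1, -1],
     [2, 0, -1, -1, -1, -1, 0, -1], [2, -1, 0, -1, -1, 0, -1, -1], [2, -1, -1, 0, 0, -1, -1, -1], [2, 0, -1, -1, -1, 0, -1, -1],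
     [2, -1, 0, -1, 0, -1, -1, -1], [2, 0, -1, -1, 0, -1, -1, -1], [2, -1, 0, 0, -1, -1, -1, -1], [2, 0, -1, 0, -1, -1, -1, -1],
     [3, -2, -1, -1, -1, -1, -1, -1], [3, -1, -2, -1, -1, -1, -1, -1], [2, 0, 0, -1, -1, -1, -1, -1], [3, -1, -1, -2, -1, -1, -1, -1],
     [3, -1, -1, -1, -2, -1, -1, -1], [3, -1, -1, -1, -1, -2, -1, -1], [3, -1, -1, -1, -1, -1, -2, -1], [3, -1, -1, -1, -1, -1, -1, -2]]"

interpretation E6: line_list 3 6 lines_E6 "- 6" "- 5"
proof
  show "list_all (\<lambda>l. length l = 6 + 1) lines_E6" by code_simp
  show "distinct lines_E6" by code_simp
  show "list_all (\<lambda>l. list_all (\<lambda>i. act i l \<in> set lines_E6) [0..<6]) lines_E6" by code_simp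
  show "chained 6 [hd lines_E6] (tl lines_E6)" by code_simp
  show "list_all (\<lambda>l. l ! 6 \<le> 0) (tl lines_E6)" by code_simp
  show "list_all (\<lambda>x. sum_list (map (\<lambda>l. - (l ! 6) * l ! x) lines_E6)
        = - 6 * (if x = 6 then 1 else 0) + - 5 * (if x = 0 then -3 else 1)) [0..<6 + 1]" by code_simp
  show "int (6 - 3) * sum_list (map (\<lambda>l. - (l ! 6)) lines_E6) = int (length lines_E6)" by code_simp
  show "hd lines_E6 = replicate 6 0 @ [1]" by code_simp
qed (simp_all add: lines_E6_def)

interpretation E7: line_list 4 7 lines_E7 "- 12" "- 20"
proof
  show "list_all (\<lambda>l. length l = 7 + 1) lines_E7" by code_simp
  show "distinct lines_E7" by code_simp
  show "list_all (\<lambda>l. list_all (\<lambda>i. act i l \<in> set lines_E7) [0..<7]) lines_E7" by code_simp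
  show "chained 7 [hd lines_E7] (tl lines_E7)" by code_simp
  show "list_all (\<lambda>l. l ! 7 \<le> 0) (tl lines_E7)" by code_simp
  show "list_all (\<lambda>x. sum_list (map (\<lambda>l. - (l ! 7) * l ! x) lines_E7)
        = - 12 * (if x = 7 then 1 else 0) + - 20 * (if x = 0 then -3 else 1)) [0..<7 + 1]" by code_simp
  show "int (6 - 4) * sum_list (map (\<lambda>l. - (l ! 7)) lines_E7) = int (length lines_E7)" by code_simp
  show "hd lines_E7 = replicate 7 0 @ [1]" by code_simp
qed (simp_all add: lines_E7_def)

lemma lines_E6_heights: "map (\<lambda>l. - (l ! 6)) lines_E6 = [-1, 0, 0, 0, 0, 0, 0, 0, 0, 0, 0, 0, 0, 0, 1, 0, 1, 0, 1, 0, 1, 1, 1, 1, 1, 1, 1]"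
  by code_simp

lemma lines_E7_heights: "map (\<lambda>l. - (l ! 7)) lines_E7 = [-1, 0, 0, 0, 0, 0, 0, 0, 0, 0, 0, 0, 0, 0, 0, 0, 0, 0, 1, 0, 0, 1, 0, 0, 1, 0, 0, 1, 0, 1, 1, 0, 1, 1, 0, 1, 1, 0, 1, 1, 1, 1, 1, 1, 1, 1, 1, 1, 1, 1, 1, 1, 1, 1, 1, 2]"
  by code_simp

lemma eta_E6: "E6.eta = 9" unfolding E6.eta_def lines_E6_heights by simp
lemma eta_E7: "E7.eta = 28" unfolding E7.eta_def lines_E7_heights by simp

lemma length_lines_E6: "length lines_E6 = 27" by code_simp
lemma length_lines_E7: "length lines_E7 = 56" by code_simp

lemma spectrum_E6: "has_spectrum_values 2 3 3 (- 6) 9"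
proof -
  have "list_ex (\<lambda>l. l ! 6 = 0) lines_E6" "list_ex (\<lambda>l. l ! 6 = -1) lines_E6" by code_simp+
  from E6.spectrum_values[OF this] show ?thesis by (simp add: eta_E6)
qed

lemma spectrum_E7: "has_spectrum_values 2 4 3 (- 12) 28"
proof -
  have "list_ex (\<lambda>l. l ! 7 = 0) lines_E7" "list_ex (\<lambda>l. l ! 7 = -1) lines_E7" by code_simp+
  from E7.spectrum_values[OF this] show ?thesis by (simp add: eta_E7)
qed

lemma cut_between_E6: "cut_between 2 3 3 90 101.25"
proof (rule cut_between_rounding[OF E6.form])
  have "arccos ((1 / real (6 - 3) - real_of_int 1) / (1 + 1 / real (6 - 3))) = 2 * pi / 3"
    by simp
  then show "90 \<le> 1 / 2 * (\<Sum>U\<in>E6.mods. \<Sum>V\<in>E6.mods. divisor_mult 2 3 3 U V * (arccos (E6.F.G U V) / pi))"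
    unfolding E6.rounding_sum lines_E6_heights length_lines_E6 by simp
  show "101.25 = real (card E6.mods) * (real_of_int E6.eta - real_of_int (- 6)) / 4"
    unfolding E6.card_mods length_lines_E6 eta_E6 by simp
qed

lemma sin_le_quintic:
  fixes x :: real
  assumes "0 \<le> x"
  shows "sin x \<le> x - x ^ 3 / 6 + x ^ 5 / 120"
proof -
  have "{..<5} = {0, 1, 2, 3, 4 :: nat}" by auto
  then have "(\<Sum>m<5. sin_coeff m * x ^ m) = x - x ^ 3 / 6"
    by (simp add: sin_coeff_def fact_numeral)
  moreover have "inverse (fact 5) * \<bar>x\<bar> ^ 5 = x ^ 5 / 120"
    using assms by (simp add: fact_numeral field_simps)
  ultimately have "\<bar>sin x - (x - x ^ 3 / 6)\<bar> \<le> x ^ 5 / 120"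
    using Maclaurin_sin_bound[of x 5] by simp
  then show ?thesis by linarith
qed

text \<open>
  Equivalent to \<open>sin (3 \<pi> / 28) < 1 / 3\<close>. The constant is the one for which the rounded value of the
  \<open>E\<^sub>7\<close> graph, \<open>28 (27 arccos (- 1 / 3) / \<pi> + 2)\<close>, exceeds 515.
\<close>

lemma arccos_minus_third_gt: "17 / 28 * pi < arccos (- (1 / 3))"
proof -
  have "sin (3 * pi / 28) \<le> sin 0.339"
    using pi_approx by (intro sin_monotone_2pi_le) auto
  also have "\<dots> < 1 / 3"
    using sin_le_quintic[of "0.339"] by (simp add: power_divide eval_nat_numeral)
  finally have "- (1 / 3) < - sin (3 * pi / 28)" by simp
  also have "\<dots> = cos (pi / 2 + 3 * pi / 28)" by (subst cos_add) simp
  finally have "- (1 / 3) < cos (pi / 2 + 3 * pi / 28)" .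
  then have "arccos (cos (pi / 2 + 3 * pi / 28)) < arccos (- (1 / 3))"
    by (intro arccos_less_arccos) auto
  moreover have "arccos (cos (pi / 2 + 3 * pi / 28)) = pi / 2 + 3 * pi / 28"
    by (intro arccos_cos) auto
  ultimately show ?thesis by simp
qed

lemma cut_between_E7: "cut_between 2 4 3 516 560"
proof -
  define t where "t = arccos (- (1 / 3)) / pi"
  have "cut_between 2 4 3 (28 * (27 * t + 2)) 560"
  proof (rule cut_between_rounding[OF E7.form])
    have "arccos ((1 / real (6 - 4) - real_of_int 1) / (1 + 1 / real (6 - 4))) = t * pi"
      "arccos ((1 / real (6 - 4) - real_of_int 2) / (1 + 1 / real (6 - 4))) = pi"
      by (simp_all add: t_def)
    then show "28 * (27 * t + 2) \<le> 1 / 2 * (\<Sum>U\<in>E7.mods. \<Sum>V\<in>E7.mods. divisor_mult 2 4 3 U V * (arccos (E7.F.G U V) / pi))"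
      unfolding E7.rounding_sum lines_E7_heights length_lines_E7 by simp
    show "560 = real (card E7.mods) * (real_of_int E7.eta - real_of_int (- 12)) / 4"
      unfolding E7.card_mods length_lines_E7 eta_E7 by simp
  qed
  moreover have "17 / 28 < t"
    using arccos_minus_third_gt by (simp add: t_def field_simps)
  then have "515 < 28 * (27 * t + 2)" by simp
  then have "515 < \<lceil>28 * (27 * t + 2)\<rceil>" by (simp add: less_ceiling_iff)
  then have "\<lceil>516::real\<rceil> \<le> \<lceil>28 * (27 * t + 2)\<rceil>" by simp
  then have "real_of_int \<lceil>516::real\<rceil> \<le> real_of_int \<lceil>28 * (27 * t + 2)\<rceil>" by (simp only: of_int_le_iff)
  ultimately show ?thesis unfolding cut_between_def by (meson order.trans)
qed

section \<open>The minuscule diagrams\<close>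

lemma type_A_if_params: "(n, s) \<in> type_A_params \<Longrightarrow> type_A s (n + 1) (n + 2) (n + 2 + s)"
  by unfold_locales (auto simp: type_A_params_def)

lemma type_D_if_ge: "3 \<le> n \<Longrightarrow> type_D n (n + 2)"
  by unfold_locales auto

lemma minuscule_cases [consumes 1, case_names A D E6 E7]:
  assumes "minuscule a b c"
  obtains n s where "(n, s) \<in> type_A_params" "a = s + 1" "b = 1" "c = n + 1"
    | n where "3 \<le> n" "a = 2" "b = 2" "c = n"
    | "a = 2" "b = 3" "c = 3"
    | "a = 2" "b = 4" "c = 3"
  using assms unfolding minuscule_def by blast

lemma minuscule_strongly_regular:
  assumes "minuscule a b c"
  shows "strongly_regular_multigraph (minus_one_divisors a b c) (divisor_mult a b c)"
  using assms
proof (cases rule: minuscule_cases)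
  case (A n s)
  interpret A: type_A s "n + 1" "n + 2" "n + 2 + s" by (rule type_A_if_params[OF A(1)])
  show ?thesis unfolding A(2-4) divisor_mult_eq by (rule A.F.strongly_regular)
next
  case (D n)
  interpret D: type_D n "n + 2" by (rule type_D_if_ge[OF D(1)])
  show ?thesis unfolding D(2-4) divisor_mult_eq by (rule D.F.strongly_regular)
next
  case E6
  show ?thesis unfolding E6 divisor_mult_eq by (rule E6.F.strongly_regular)
next
  case E7
  show ?thesis unfolding E7 divisor_mult_eq by (rule E7.F.strongly_regular)
qed

lemma minuscule_optimal:
  assumes "minuscule a b c"
  shows "(\<forall>V\<in>minus_one_divisors a b c.
            pic_form a b c (normalized_projection a b c V) (\<lambda>x. real_of_int (canonical_class a b c x)) = 0) \<and>
         projection_gram a b c \<in> elliptope (minus_one_divisors a b c) \<and>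
         SD_value (minus_one_divisors a b c) (divisor_mult a b c) (projection_gram a b c)
           = SD_opt (minus_one_divisors a b c) (divisor_mult a b c)"
  using assms
proof (cases rule: minuscule_cases)
  case (A n s)
  interpret A: type_A s "n + 1" "n + 2" "n + 2 + s" by (rule type_A_if_params[OF A(1)])
  show ?thesis unfolding A(2-4) by (rule A.optimal_A)
next
  case (D n)
  interpret D: type_D n "n + 2" by (rule type_D_if_ge[OF D(1)])
  show ?thesis unfolding D(2-4) by (rule D.optimal_D)
next
  case E6
  show ?thesis unfolding E6 by (rule E6.optimal_line_list)
next
  case E7
  show ?thesis unfolding E7 by (rule E7.optimal_line_list)
qed

text \<open>
  There are at most \<open>2 ^ N\<close> divisors, so \<open>N\<close> tends to infinity with their number, and the ratio differs
  from one by at most \<open>6 / N\<close>.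
\<close>

lemma ratio_limit_A:
  "((\<lambda>(n, s). m_cut (s + 1) 1 (n + 1) / upper_A (n + 2) s) \<longlongrightarrow> 1)
     (inf (filtercomap (\<lambda>(n, s). card (minus_one_divisors (s + 1) 1 (n + 1))) at_top)
        (principal type_A_params))"
proof (rule tendstoI)
  fix e :: real assume e: "0 < e"
  \<comment> \<open>More than \<open>2 ^ k\<close> divisors force \<open>N > k > 6 / e\<close>.\<close>
  obtain k :: nat where k: "6 / e < real k" using reals_Archimedean2 by blast
  have "\<forall>\<^sub>F p in filtercomap (\<lambda>(n, s). card (minus_one_divisors (s + 1) 1 (n + 1))) at_top.
      2 ^ k < (case p of (n, s) \<Rightarrow> card (minus_one_divisors (s + 1) 1 (n + 1)))"
    by (rule eventually_filtercomapI[OF eventually_gt_at_top])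
  then show "\<forall>\<^sub>F p in inf (filtercomap (\<lambda>(n, s). card (minus_one_divisors (s + 1) 1 (n + 1))) at_top)
        (principal type_A_params).
      dist (case p of (n, s) \<Rightarrow> m_cut (s + 1) 1 (n + 1) / upper_A (n + 2) s) 1 < e"
    unfolding eventually_inf_principal
  proof (rule eventually_mono, safe)
    fix n s assume big: "2 ^ k < card (minus_one_divisors (s + 1) 1 (n + 1))" and p: "(n, s) \<in> type_A_params"
    interpret A: type_A s "n + 1" "n + 2" "n + 2 + s" by (rule type_A_if_params[OF p])
    have "(2::nat) ^ k < 2 ^ (n + 2 + s)" using big A.card_mods_le by linarith
    then have "k < n + 2 + s" by (rule power_less_imp_less_exp[rotated]) simp
    then have "6 / e < real (n + 2 + s)" using k by linarith
    then have "6 / real (n + 2 + s) < e" using e by (simp add: field_simps)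
    then show "dist (m_cut (s + 1) 1 (n + 1) / upper_A (n + 2) s) 1 < e"
      using A.ratio_bounds unfolding dist_real_def by linarith
  qed
qed

lemma ratio_limit_D:
  "((\<lambda>n. m_cut 2 2 n / upper_D (n + 2)) \<longlongrightarrow> 1)
     (inf (filtercomap (\<lambda>n. card (minus_one_divisors 2 2 n)) at_top) (principal {3..}))"
proof (rule tendsto_eventually)
  show "\<forall>\<^sub>F n in inf (filtercomap (\<lambda>n. card (minus_one_divisors 2 2 n)) at_top) (principal {3..}).
      m_cut 2 2 n / upper_D (n + 2) = 1"
    unfolding eventually_inf_principal
  proof (rule always_eventually, intro allI impI)
    fix n :: nat assume "n \<in> {3..}"
    then have n: "3 \<le> n" by simp
    interpret D: type_D n "n + 2" by (rule type_D_if_ge[OF n])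
    have "upper_D (n + 2) \<noteq> 0" using n by (simp add: upper_D_def)
    then show "m_cut 2 2 n / upper_D (n + 2) = 1" using D.max_cut_D_eq_upper by simp
  qed
qed

theorem theorem5p3:
  shows
    "(\<comment> \<open>(1)\<close>
      (\<forall>a b c. minuscule a b c \<longrightarrow>
         strongly_regular_multigraph (minus_one_divisors a b c) (divisor_mult a b c)) \<and>
      (\<forall>(n, s)\<in>type_A_params.
         has_spectrum_values (s + 1) 1 (n + 1) (lambda_A (n + 2) s) (eta_A (n + 2) s)) \<and>
      (\<forall>n\<ge>3. let r = n + 2 in
         has_spectrum_values 2 2 n (- (2 ^ (r - 3))) ((real r - 4) * 2 ^ (r - 3))) \<and>
      has_spectrum_values 2 3 3 (- 6) 9 \<and>
      has_spectrum_values 2 4 3 (- 12) 28) \<and>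
     (\<comment> \<open>(2)\<close>
      \<forall>a b c. minuscule a b c \<longrightarrow>
         (\<forall>V\<in>minus_one_divisors a b c.
            pic_form a b c (normalized_projection a b c V)
              (\<lambda>x. real_of_int (canonical_class a b c x)) = 0) \<and>
         projection_gram a b c \<in> elliptope (minus_one_divisors a b c) \<and>
         SD_value (minus_one_divisors a b c) (divisor_mult a b c) (projection_gram a b c)
           = SD_opt (minus_one_divisors a b c) (divisor_mult a b c)) \<and>
     (\<comment> \<open>(3)\<close>
      (\<forall>(n, s)\<in>type_A_params.
         cut_between (s + 1) 1 (n + 1) (lower_A (n + 2) s) (upper_A (n + 2) s)) \<and>
      (\<forall>n\<ge>3. cut_between 2 2 n (lower_D (n + 2)) (upper_D (n + 2))) \<and>
      cut_between 2 3 3 90 101.25 \<and>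
      cut_between 2 4 3 516 560 \<and>
      ((\<lambda>(n, s). m_cut (s + 1) 1 (n + 1) / upper_A (n + 2) s) \<longlongrightarrow> 1)
         (inf (filtercomap (\<lambda>(n, s). card (minus_one_divisors (s + 1) 1 (n + 1))) at_top)
            (principal type_A_params)) \<and>
      ((\<lambda>n. m_cut 2 2 n / upper_D (n + 2)) \<longlongrightarrow> 1)
         (inf (filtercomap (\<lambda>n. card (minus_one_divisors 2 2 n)) at_top) (principal {3..}))) \<and>
     (\<comment> \<open>(4)\<close>
      (\<forall>n. 3 \<le> n \<and> n \<le> 8 \<longrightarrow> m_cut 2 2 n = upper_D (n + 2)) \<and>
      (\<forall>(n, s)\<in>type_A_params. let r = n + 2 in
         r = s + 2 \<and> r \<le> 7 \<longrightarrow> m_cut (s + 1) 1 (n + 1) = upper_A r s))"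
proof -
  have A: "has_spectrum_values (s + 1) 1 (n + 1) (lambda_A (n + 2) s) (eta_A (n + 2) s)"
    "cut_between (s + 1) 1 (n + 1) (lower_A (n + 2) s) (upper_A (n + 2) s)"
    "n = s \<Longrightarrow> m_cut (s + 1) 1 (n + 1) = upper_A (n + 2) s"
    if "(n, s) \<in> type_A_params" for n s
  proof -
    interpret A: type_A s "n + 1" "n + 2" "n + 2 + s" by (rule type_A_if_params[OF that])
    show "has_spectrum_values (s + 1) 1 (n + 1) (lambda_A (n + 2) s) (eta_A (n + 2) s)"
      by (rule A.spectrum_values)
    show "cut_between (s + 1) 1 (n + 1) (lower_A (n + 2) s) (upper_A (n + 2) s)"
      by (rule A.cut_between_A)
    show "n = s \<Longrightarrow> m_cut (s + 1) 1 (n + 1) = upper_A (n + 2) s"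
      by (rule A.max_cut_A_eq_upper) simp
  qed
  have D: "has_spectrum_values 2 2 n (- (2 ^ (n + 2 - 3))) ((real (n + 2) - 4) * 2 ^ (n + 2 - 3))"
    "cut_between 2 2 n (lower_D (n + 2)) (upper_D (n + 2))"
    "m_cut 2 2 n = upper_D (n + 2)" if "3 \<le> n" for n
  proof -
    interpret D: type_D n "n + 2" by (rule type_D_if_ge[OF that])
    show "has_spectrum_values 2 2 n (- (2 ^ (n + 2 - 3))) ((real (n + 2) - 4) * 2 ^ (n + 2 - 3))"
      by (rule D.spectrum_values)
    show "cut_between 2 2 n (lower_D (n + 2)) (upper_D (n + 2))" by (rule D.cut_between_D)
    show "m_cut 2 2 n = upper_D (n + 2)" by (rule D.max_cut_D_eq_upper)
  qed
  show ?thesis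
    unfolding Let_def
    by (intro conjI ballI allI impI; (elim conjE)?; clarsimp?)
      (use A D minuscule_strongly_regular minuscule_optimal spectrum_E6 spectrum_E7 cut_between_E6 cut_between_E7
        ratio_limit_A ratio_limit_D in \<open>simp_all\<close>)
qed

end
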